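(* Let $X$ be an Asplund space, $T$ a nonempty index set, $f_t:X\to\overline{\mathbb{R}}$ ($t\in T$), $f:=\sup_{t\in T}f_t$, and $\bar x\in\mathrm{dom}\,f$. Suppose there is a neighborhood of $\bar x$ on which all the functions $f_t$ are (finite and) locally Lipschitz. Then $$\partial f(\bar x)\subseteq\bigcap_{\epsilon>0}\mathrm{cl}^{w^*}\big(\mathcal{S}(\bar x,\epsilon)\big)\quad\text{and}\quad\partial^\infty f(\bar x)\subseteq\bigcap_{\epsilon>0}\mathrm{cl}^{w^*}\big([0,\epsilon]\cdot\mathcal{S}(\bar x,\epsilon)\big),$$ where $$\mathcal{S}(\bar x,\epsilon):=\bigcup\Big\{\sum_{t\in F}\lambda_t\circ\partial f_t(x')\ :\ F\subseteq T\text{ finite},\ x'\in\mathbb{B}(\bar x,\epsilon),\ |f_F(x')-f(\bar x)|\le\epsilon,\ \lambda\in\Delta(F),\ f_t(x')=f_F(x')\ \forall t\in\mathrm{supp}\,\lambda\Big\}.$$ In addition, if the family is uniformly locally Lipschitz at $\bar x$, then $$\partial f(\bar x)\subseteq\bigcap_{\epsilon>0}\mathrm{cl}^{w^*}\bigcup\Big\{\sum_{t\in F}\lambda_t\,\partial f_t(x')\ :\ F\subseteq T_\epsilon(\bar x)\text{ finite},\ x'\in\mathbb{B}(\bar x,\epsilon),\ \lambda\in\Delta(F),\ f_t(x')=f_F(x')\ \forall t\in F\Big\}.$$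
   Context: An Asplund space is a Banach space all of whose separable subspaces have separable dual. $\overline{\mathbb{R}}=\mathbb{R}\cup\{\pm\infty\}$, $\mathrm{dom}\,f=\{x:f(x)<+\infty\}$. $\mathrm{cl}^{w^*}$ is weak$^*$ closure, $\mathbb{B}(\bar x,\epsilon)$ the closed ball, $f_F:=\max_{s\in F}f_s$, $\Delta(F):=\{(\lambda_t)_{t\in F}:\lambda_t\ge0,\ \sum_{t\in F}\lambda_t=1\}$, $\mathrm{supp}\,\lambda=\{t:\lambda_t\neq0\}$, $T_\epsilon(\bar x):=\{t\in T:f(\bar x)\le f_t(\bar x)+\epsilon\}$. For $g$ lsc near $x$ and finite at $x$: $\hat\partial g(x)=\{x^*:\liminf_{h\to0}\frac{g(x+h)-g(x)-\langle x^*,h\rangle}{\|h\|}\ge0\}$; with $x_n\overset{g}{\to}x$ meaning $x_n\to x$ and $g(x_n)\to g(x)$, $\partial g(x)=\{w^*\text{-}\lim x_n^*:x_n^*\in\hat\partial g(x_n),\ x_n\overset{g}{\to}x\}$ and $\partial^\infty g(x)=\{w^*\text{-}\lim\lambda_nx_n^*:x_n^*\in\hat\partial g(x_n),\ x_n\overset{g}{\to}x,\ \lambda_n\to0^+\}$ (sequential limits). All are empty if $|g(x)|=+\infty$. Also $\lambda\circ\partial f_t(x):=\lambda\,\partial f_t(x)$ if $\lambda>0$ and $0\circ\partial f_t(x):=\partial^\infty f_t(x)$. The family is uniformly locally Lipschitz at $\bar x$ if there are $k,\epsilon_0>0$ with $|f_t(x)-f_t(y)|\le k\|x-y\|$ for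 all $x,y\in\mathbb{B}(\bar x,\epsilon_0)$ and all $t\in T$. *)

theory Defs
  imports "HOL-Analysis.Analysis"
begin

text \<open>The topological dual of a linear subspace \<open>Y\<close>. Functionals on \<open>Y\<close> are represented
  by functions that are \<open>undefined\<close> off \<open>Y\<close>, so that distinct functions are distinct
  functionals.\<close>

definition subspace_dual :: "'a::real_normed_vector set \<Rightarrow> ('a \<Rightarrow> real) set" where
  "subspace_dual Y = {\<phi> \<in> extensional Y.
     (\<forall>x\<in>Y. \<forall>y\<in>Y. \<phi> (x + y) = \<phi> x + \<phi> y) \<and>
     (\<forall>c. \<forall>x\<in>Y. \<phi> (c *\<^sub>R x) = c * \<phi> x) \<and>
     (\<exists>K. \<forall>x\<in>Y. \<bar>\<phi> x\<bar> \<le> K * norm x)}"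

text \<open>Separability of the dual for the dual norm: the inner bound says that the dual norm of
  \<open>\<phi> - \<psi>\<close> is at most \<open>e\<close>.\<close>

definition separable_subspace_dual :: "'a::real_normed_vector set \<Rightarrow> bool" where
  "separable_subspace_dual Y \<longleftrightarrow>
     (\<exists>D. countable D \<and> D \<subseteq> subspace_dual Y \<and>
       (\<forall>\<phi>\<in>subspace_dual Y. \<forall>e>0. \<exists>\<psi>\<in>D. \<forall>y\<in>Y. \<bar>\<phi> y - \<psi> y\<bar> \<le> e * norm y))"

definition asplund :: "'a::banach itself \<Rightarrow> bool" where
  "asplund _ \<longleftrightarrow>
     (\<forall>Y::'a set. subspace Y \<and> separable_space (top_of_set Y) \<longrightarrow> separable_subspace_dual Y)"

text \<open>For real-valued operators the strong operator topology is the topology of pointwise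
  convergence, that is, the weak* topology of the dual.\<close>

abbreviation weak_star :: "('a::real_normed_vector \<Rightarrow>\<^sub>L real) topology" where
  "weak_star \<equiv> strong_operator_topology"

text \<open>Lower semicontinuity is not built into the definitions below; they are only of interest
  at points near which the function is lower semicontinuous.\<close>

definition frechet_subdiff ::
    "('a::real_normed_vector \<Rightarrow> ereal) \<Rightarrow> 'a \<Rightarrow> ('a \<Rightarrow>\<^sub>L real) set" where
  "frechet_subdiff g x = {x'. \<bar>g x\<bar> \<noteq> \<infinity> \<and>
     0 \<le> Liminf (at 0) (\<lambda>h. (g (x + h) - g x - ereal (blinfun_apply x' h)) / ereal (norm h))}"

definition tendsto_along :: "('a::real_normed_vector \<Rightarrow> ereal) \<Rightarrow> (nat \<Rightarrow> 'a) \<Rightarrow> 'a \<Rightarrow> bool" where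
  "tendsto_along g xs x \<longleftrightarrow> xs \<longlonglongrightarrow> x \<and> (\<lambda>n. g (xs n)) \<longlonglongrightarrow> g x"

definition limiting_subdiff ::
    "('a::real_normed_vector \<Rightarrow> ereal) \<Rightarrow> 'a \<Rightarrow> ('a \<Rightarrow>\<^sub>L real) set" where
  "limiting_subdiff g x = {x'. \<bar>g x\<bar> \<noteq> \<infinity> \<and>
     (\<exists>xs ys. tendsto_along g xs x \<and> (\<forall>n. ys n \<in> frechet_subdiff g (xs n)) \<and>
        limitin weak_star ys x' sequentially)}"

definition singular_subdiff ::
    "('a::real_normed_vector \<Rightarrow> ereal) \<Rightarrow> 'a \<Rightarrow> ('a \<Rightarrow>\<^sub>L real) set" where
  "singular_subdiff g x = {x'. \<bar>g x\<bar> \<noteq> \<infinity> \<and>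
     (\<exists>xs ys l. tendsto_along g xs x \<and> (\<forall>n. ys n \<in> frechet_subdiff g (xs n)) \<and>
        (\<forall>n. 0 < l n) \<and> l \<longlonglongrightarrow> (0::real) \<and>
        limitin weak_star (\<lambda>n. l n *\<^sub>R ys n) x' sequentially)}"

text \<open>The operation \<open>\<lambda> \<circ> \<partial>g(x)\<close>, used for \<open>\<lambda> \<ge> 0\<close> only.\<close>

definition circ_subdiff ::
    "real \<Rightarrow> ('a::real_normed_vector \<Rightarrow> ereal) \<Rightarrow> 'a \<Rightarrow> ('a \<Rightarrow>\<^sub>L real) set" where
  "circ_subdiff l g x =
     (if l > 0 then (\<lambda>x'. l *\<^sub>R x') ` limiting_subdiff g x else singular_subdiff g x)"

definition locally_lipschitz_on ::
    "'a::real_normed_vector set \<Rightarrow> ('a \<Rightarrow> ereal) \<Rightarrow> bool" where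
  "locally_lipschitz_on U g \<longleftrightarrow>
     (\<forall>x\<in>U. \<bar>g x\<bar> \<noteq> \<infinity>) \<and>
     (\<forall>x\<in>U. \<exists>r>0. \<exists>L. L-lipschitz_on (ball x r \<inter> U) (\<lambda>y. real_of_ereal (g y)))"

definition uniformly_locally_lipschitz_at ::
    "'i set \<Rightarrow> ('i \<Rightarrow> 'a::real_normed_vector \<Rightarrow> ereal) \<Rightarrow> 'a \<Rightarrow> bool" where
  "uniformly_locally_lipschitz_at T f x \<longleftrightarrow>
     (\<exists>k>0. \<exists>e>0. \<forall>t\<in>T.
        (\<forall>y\<in>cball x e. \<bar>f t y\<bar> \<noteq> \<infinity>) \<and>
        k-lipschitz_on (cball x e) (\<lambda>y. real_of_ereal (f t y)))"

definition sup_fun :: "'i set \<Rightarrow> ('i \<Rightarrow> 'a \<Rightarrow> ereal) \<Rightarrow> 'a \<Rightarrow> ereal" where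
  "sup_fun T f x = (SUP t\<in>T. f t x)"

text \<open>\<open>Max\<close> is unspecified on the empty set, but \<open>F = {}\<close> never matters because
  \<open>simplex_weights {}\<close> is empty.\<close>

definition max_fun :: "'i set \<Rightarrow> ('i \<Rightarrow> 'a \<Rightarrow> ereal) \<Rightarrow> 'a \<Rightarrow> ereal" where
  "max_fun F f x = Max ((\<lambda>s. f s x) ` F)"

definition simplex_weights :: "'i set \<Rightarrow> ('i \<Rightarrow> real) set" where
  "simplex_weights F = {l. (\<forall>t\<in>F. 0 \<le> l t) \<and> (\<Sum>t\<in>F. l t) = 1}"

definition weight_support :: "'i set \<Rightarrow> ('i \<Rightarrow> real) \<Rightarrow> 'i set" where
  "weight_support F l = {t \<in> F. l t \<noteq> 0}"

definition eps_active :: "'i set \<Rightarrow> ('i \<Rightarrow> 'a \<Rightarrow> ereal) \<Rightarrow> 'a \<Rightarrow> real \<Rightarrow> 'i set" where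
  "eps_active T f x e = {t \<in> T. sup_fun T f x \<le> f t x + ereal e}"

definition minkowski_sum :: "'i set \<Rightarrow> ('i \<Rightarrow> 'b::comm_monoid_add set) \<Rightarrow> 'b set" where
  "minkowski_sum F A = {(\<Sum>t\<in>F. v t) | v. \<forall>t\<in>F. v t \<in> A t}"

definition fuzzy_sums ::
    "'i set \<Rightarrow> ('i \<Rightarrow> 'a::real_normed_vector \<Rightarrow> ereal) \<Rightarrow> 'a \<Rightarrow> real \<Rightarrow> ('a \<Rightarrow>\<^sub>L real) set" where
  "fuzzy_sums T f x e = \<Union> {minkowski_sum F (\<lambda>t. circ_subdiff (l t) (f t) x') | F x' l.
     F \<subseteq> T \<and> finite F \<and> x' \<in> cball x e \<and>
     \<bar>max_fun F f x' - sup_fun T f x\<bar> \<le> ereal e \<and>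
     l \<in> simplex_weights F \<and>
     (\<forall>t\<in>weight_support F l. f t x' = max_fun F f x')}"

definition active_fuzzy_sums ::
    "'i set \<Rightarrow> ('i \<Rightarrow> 'a::real_normed_vector \<Rightarrow> ereal) \<Rightarrow> 'a \<Rightarrow> real \<Rightarrow> ('a \<Rightarrow>\<^sub>L real) set" where
  "active_fuzzy_sums T f x e =
     \<Union> {minkowski_sum F (\<lambda>t. (\<lambda>y'. l t *\<^sub>R y') ` limiting_subdiff (f t) x') | F x' l.
     F \<subseteq> eps_active T f x e \<and> finite F \<and> x' \<in> cball x e \<and>
     l \<in> simplex_weights F \<and>
     (\<forall>t\<in>F. f t x' = max_fun F f x')}"

end

theory Submission
  imports Defs "HOL-Library.Diagonal_Subsequence"
begin

text \<open>Let \<open>x'\<close> be a Frechet subgradient of the supremum at \<open>z\<close>, and fix finitely many test vectors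
  \<open>V\<close>. Tilting the supremum by \<open>x'\<close> and a multiple of the norm makes \<open>z\<close> a strict local minimum;
  restricted to the slice \<open>z + span V\<close>, compactness replaces the supremum by a maximum over a finite
  \<open>F\<close>, whose tilted version has a local minimum \<open>y\<close> near \<open>z\<close> on the slice. It remains to show
  that \<open>x'\<close> is, on \<open>V\<close>, close to a convex combination of limiting subgradients at \<open>y\<close> of
  the members of \<open>F\<close> active there. All weights can be taken positive, so the singular
  subdifferentials in the fuzzy sums are never needed.

  This multiplier rule is obtained by smoothing the maximum, decoupling the functions with a penalty
  that is itself Frechet smooth, and applying a variational principle of Borwein--Preiss type. Such
  a penalty exists on separable subspaces because their duals are separable, and on a suitable
  separable subspace every Frechet subgradient extends to the whole space (separable reduction). The
  Asplund property enters once more through the weak* sequential compactness of dual balls, which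
  turns the Frechet subgradients at nearby points into limiting subgradients at the single point \<open>y\<close>.\<close>

subsection \<open>The Hahn--Banach theorem\<close>

text \<open>A weak* neighbourhood tests only finitely many vectors, so a finite-dimensional slice
  suffices; there closed balls are compact even though the space is infinite-dimensional. The tilt
  uses twice the slope \<eta> allowed by the Frechet inequality: the surplus \<eta> pushes
  minimisers off the boundary of the slice. The resulting error is a multiple of \<eta>, which is
  harmless because \<eta> is chosen after the test vectors. The hard constraint is that all
  subgradients must live at one common point, while decoupling produces them at different nearby
  points. Passing to the limit repairs this, but it must happen with the finite set of functions and
  the Lipschitz constant frozen, so that the subgradients stay in one dual ball. Since limiting
  subgradients are defined by sequences, cluster points of that ball are not enough and a convergent
  subsequence is required. The smoothing parameter grows along the same sequence; this drives the
  weight of every function strictly below the maximum to zero, so positive limit weights occur only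
  at active functions.\<close>

definition sublinear :: "('a::real_vector \<Rightarrow> real) \<Rightarrow> bool" where
  "sublinear p \<longleftrightarrow> (\<forall>x y. p (x + y) \<le> p x + p y) \<and> (\<forall>c\<ge>0. \<forall>x. p (c *\<^sub>R x) = c * p x)"

definition linear_form_on :: "'a::real_vector set \<Rightarrow> ('a \<Rightarrow> real) \<Rightarrow> bool" where
  "linear_form_on Y w \<longleftrightarrow>
     (\<forall>x\<in>Y. \<forall>y\<in>Y. w (x + y) = w x + w y) \<and> (\<forall>c. \<forall>x\<in>Y. w (c *\<^sub>R x) = c * w x)"

lemma sublinearI:
  assumes "\<And>x y. p (x + y) \<le> p x + p y" and "\<And>c x. 0 < c \<Longrightarrow> p (c *\<^sub>R x) \<le> c * p x"
    and "p 0 = 0"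
  shows "sublinear p"
  unfolding sublinear_def
proof (intro conjI allI impI)
  fix c :: real and x assume c: "0 \<le> c"
  show "p (c *\<^sub>R x) = c * p x"
  proof (cases "c = 0")
    case False
    with c have "0 < c" by simp
    have "p x = p ((1 / c) *\<^sub>R (c *\<^sub>R x))" using \<open>0 < c\<close> by simp
    also have "\<dots> \<le> (1 / c) * p (c *\<^sub>R x)" using assms(2)[of "1 / c" "c *\<^sub>R x"] \<open>0 < c\<close> by simp
    finally have "c * p x \<le> p (c *\<^sub>R x)" using \<open>0 < c\<close> by (simp add: field_simps)
    then show ?thesis using assms(2)[OF \<open>0 < c\<close>, of x] by simp
  qed (simp add: assms(3))
qed (rule assms(1))

lemma sublinear_add: "sublinear p \<Longrightarrow> p (x + y) \<le> p x + p y"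
  by (simp add: sublinear_def)

lemma sublinear_scale: "sublinear p \<Longrightarrow> 0 \<le> c \<Longrightarrow> p (c *\<^sub>R x) = c * p x"
  by (simp add: sublinear_def)

lemma sublinear_zero: "sublinear p \<Longrightarrow> p 0 = 0"
  using sublinear_scale[of p 0 0] by simp

lemma sublinear_minus: "sublinear p \<Longrightarrow> - p (- x) \<le> p x"
  using sublinear_add[of p x "- x"] sublinear_zero[of p] by simp

text \<open>For fixed y, the infimum of q (z + t y) - t q y over t \<ge> 0 is again sublinear and
  lies below q (take t = 0). By minimality it equals q, and t = 1 then gives q x + q y \<le> q (x +
  y).\<close>

lemma minimal_sublinear_linear:
  assumes q: "sublinear q"
    and min: "\<And>r. sublinear r \<Longrightarrow> (\<And>x. r x \<le> q x) \<Longrightarrow> r = q"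
  shows "linear q"
proof -
  have add: "q (x + y) = q x + q y" for x y
  proof -
    define A where "A z = (\<lambda>t. q (z + t *\<^sub>R y) - t * q y) ` {0..}" for z
    define r where "r z = Inf (A z)" for z
    have low: "- q (- z) \<le> a" if a: "a \<in> A z" for a z
    proof -
      obtain t where t: "t \<ge> 0" "a = q (z + t *\<^sub>R y) - t * q y" using a by (auto simp: A_def)
      have "t * q y = q ((z + t *\<^sub>R y) + (- z))" using sublinear_scale[OF q t(1)] by simp
      also have "\<dots> \<le> q (z + t *\<^sub>R y) + q (- z)" by (rule sublinear_add[OF q])
      finally show ?thesis using t by simp
    qed
    have bdd: "bdd_below (A z)" for z using low by (meson bdd_belowI)
    have ne: "A z \<noteq> {}" for z by (auto simp: A_def)
    have rle: "r z \<le> q (z + t *\<^sub>R y) - t * q y" if "t \<ge> 0" for z t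
      unfolding r_def using that by (intro cInf_lower bdd) (auto simp: A_def)
    have "sublinear r"
    proof (rule sublinearI)
      fix z w
      have *: "r (z + w) \<le> a + b" if a: "a \<in> A z" and b: "b \<in> A w" for a b
      proof -
        obtain t where t: "t \<ge> 0" "a = q (z + t *\<^sub>R y) - t * q y" using a by (auto simp: A_def)
        obtain s where s: "s \<ge> 0" "b = q (w + s *\<^sub>R y) - s * q y" using b by (auto simp: A_def)
        have "r (z + w) \<le> q (z + w + (t + s) *\<^sub>R y) - (t + s) * q y"
          using t s by (intro rle) simp
        also have "z + w + (t + s) *\<^sub>R y = (z + t *\<^sub>R y) + (w + s *\<^sub>R y)"
          by (simp add: algebra_simps)
        finally show ?thesis
          using sublinear_add[OF q, of "z + t *\<^sub>R y" "w + s *\<^sub>R y"] t s by (simp add: algebra_simps)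
      qed
      then have "r (z + w) - a \<le> r w" if "a \<in> A z" for a
        unfolding r_def[of w]
      proof (intro cInf_greatest ne)
        fix b assume "b \<in> A w"
        then show "r (z + w) - a \<le> b" using *[OF that, of b] by linarith
      qed
      then have "r (z + w) - r w \<le> r z"
        unfolding r_def[of z] by (intro cInf_greatest ne) (simp add: algebra_simps)
      then show "r (z + w) \<le> r z + r w" by simp
    next
      fix c :: real and z assume c: "0 < c"
      have "r (c *\<^sub>R z) / c \<le> a" if a: "a \<in> A z" for a
      proof -
        obtain t where t: "t \<ge> 0" "a = q (z + t *\<^sub>R y) - t * q y" using a by (auto simp: A_def)
        have "r (c *\<^sub>R z) \<le> q (c *\<^sub>R z + (c * t) *\<^sub>R y) - (c * t) * q y"
          using t c by (intro rle) simp
        also have "c *\<^sub>R z + (c * t) *\<^sub>R y = c *\<^sub>R (z + t *\<^sub>R y)" by (simp add: algebra_simps)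
        also have "q \<dots> = c * q (z + t *\<^sub>R y)" using sublinear_scale[OF q, of c] c by simp
        finally have "r (c *\<^sub>R z) \<le> a * c" unfolding t(2) by (simp add: algebra_simps)
        then show ?thesis using c by (simp add: field_simps)
      qed
      then have "r (c *\<^sub>R z) / c \<le> r z"
        unfolding r_def[of z] by (intro cInf_greatest ne)
      then show "r (c *\<^sub>R z) \<le> c * r z" using c by (simp add: field_simps)
    next
      have "a = 0" if "a \<in> A 0" for a using that sublinear_scale[OF q] by (auto simp: A_def)
      then have "A 0 = {0}" using ne[of 0] by blast
      then show "r 0 = 0" by (simp add: r_def)
    qed
    moreover have "r z \<le> q z" for z using rle[of 0 z] by simp
    ultimately have "r = q" by (rule min)
    then have "q x \<le> q (x + y) - q y" using rle[of 1 x] by simp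
    then show ?thesis using sublinear_add[OF q, of x y] by simp
  qed
  have neg: "q (- x) = - q x" for x using add[of x "- x"] sublinear_zero[OF q] by simp
  show "linear q"
  proof (rule linearI)
    fix c :: real and x
    show "q (c *\<^sub>R x) = c *\<^sub>R q x"
    proof (cases "c \<ge> 0")
      case True then show ?thesis using sublinear_scale[OF q] by simp
    next
      case False
      then have "q (c *\<^sub>R x) = - q ((- c) *\<^sub>R x)" using neg[of "(- c) *\<^sub>R x"] by simp
      also have "\<dots> = c * q x" using sublinear_scale[OF q, of "- c" x] False by simp
      finally show ?thesis by simp
    qed
  qed (rule add)
qed

text \<open>Zorn's lemma for the reversed pointwise order: the infimum of a chain stays finite
  because every member at x is at least - p (- x), and it is subadditive because two members of a
  chain are comparable. A minimal element is linear.\<close>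

lemma sublinear_dominates_linear:
  assumes p: "sublinear p"
  shows "\<exists>u. linear u \<and> (\<forall>x. u x \<le> p x)"
proof -
  define S where "S = {q. sublinear q \<and> (\<forall>x. q x \<le> p x)}"
  define P where "P a b \<longleftrightarrow> (\<forall>x. b x \<le> a x)" for a b :: "'a \<Rightarrow> real"
  have pS: "p \<in> S" using p by (simp add: S_def)
  have "\<exists>m\<in>S. \<forall>a\<in>S. P m a \<longrightarrow> a = m"
  proof (rule predicate_Zorn)
    show "partial_order_on S (relation_of P S)"
      unfolding P_def by (rule partial_order_on_relation_ofI) (auto intro: order_trans intro!: ext order.antisym)
  next
    fix C assume C: "C \<in> Chains (relation_of P S)"
    then have CS: "C \<subseteq> S" and tot: "\<And>a b. a \<in> C \<Longrightarrow> b \<in> C \<Longrightarrow> P a b \<or> P b a"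
      by (auto simp: Chains_def relation_of_def)
    show "\<exists>u\<in>S. \<forall>a\<in>C. P a u"
    proof (cases "C = {}")
      case True then show ?thesis using pS by auto
    next
      case ne: False
      define r where "r x = (INF q\<in>C. q x)" for x
      have low: "- p (- x) \<le> q x" if "q \<in> C" for q x
      proof -
        have "sublinear q" "q (- x) \<le> p (- x)" using that CS by (auto simp: S_def)
        then show ?thesis using sublinear_minus[of q x] by simp
      qed
      have bdd: "bdd_below ((\<lambda>q. q x) ` C)" for x using low by (intro bdd_belowI2) auto
      have rle: "r x \<le> q x" if "q \<in> C" for q x
        unfolding r_def using that by (intro cINF_lower bdd)
      have rge: "b \<le> r x" if "\<And>q. q \<in> C \<Longrightarrow> b \<le> q x" for b x
        unfolding r_def using that ne by (intro cINF_greatest) auto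
      have "sublinear r"
      proof (rule sublinearI)
        fix x y
        have *: "r (x + y) \<le> a x + b y" if ab: "a \<in> C" "b \<in> C" for a b
        proof -
          obtain c where c: "c \<in> C" "c x \<le> a x" "c y \<le> b y"
            using tot[OF ab] ab unfolding P_def by fastforce
          then have "sublinear c" using CS by (auto simp: S_def)
          then show ?thesis using rle[OF c(1), of "x + y"] sublinear_add[of c x y] c by linarith
        qed
        have "r (x + y) - a x \<le> r y" if "a \<in> C" for a
        proof (rule rge)
          fix b assume "b \<in> C"
          then show "r (x + y) - a x \<le> b y" using *[OF that] by fastforce
        qed
        then have "r (x + y) - r y \<le> r x" by (intro rge) (simp add: algebra_simps)
        then show "r (x + y) \<le> r x + r y" by simp
      next
        fix c :: real and x assume c: "0 < c"
        have "r (c *\<^sub>R x) / c \<le> q x" if "q \<in> C" for q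
        proof -
          have "sublinear q" using that CS by (auto simp: S_def)
          then show ?thesis using rle[OF that, of "c *\<^sub>R x"] sublinear_scale[of q c x] c
            by (simp add: field_simps)
        qed
        then have "r (c *\<^sub>R x) / c \<le> r x" by (rule rge)
        then show "r (c *\<^sub>R x) \<le> c * r x" using c by (simp add: field_simps)
      next
        have "q 0 = 0" if "q \<in> C" for q using that CS sublinear_zero by (auto simp: S_def)
        then show "r 0 = 0" using ne rle[of _ 0] rge[of 0 0] by force
      qed
      moreover have "r x \<le> p x" for x
      proof -
        obtain q where "q \<in> C" using ne by blast
        moreover from this have "q x \<le> p x" using CS by (auto simp: S_def)
        ultimately show ?thesis using rle[of q x] by linarith
      qed
      ultimately show ?thesis using rle by (auto simp: S_def P_def intro!: bexI[of _ r])
    qed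
  qed
  then obtain m where m: "m \<in> S" "\<And>a. a \<in> S \<Longrightarrow> P m a \<Longrightarrow> a = m" by blast
  have "linear m"
  proof (rule minimal_sublinear_linear)
    fix r assume r: "sublinear r" "\<And>x. r x \<le> m x"
    then have "r \<in> S" using m(1) by (auto simp: S_def intro: order_trans)
    then show "r = m" using m(2) r by (simp add: P_def)
  qed (use m in \<open>simp add: S_def\<close>)
  then show ?thesis using m(1) by (auto simp: S_def)
qed

text \<open>The infimal convolution r of p with w on Y is sublinear. A linear u below r is below p
  (use y = 0) and below w on Y (use y = x); since u and w are both odd on Y, the latter inequality
  is an equality.\<close>

lemma Hahn_Banach:
  assumes p: "sublinear p" and Y: "subspace Y" and w: "linear_form_on Y w"
    and le: "\<And>y. y \<in> Y \<Longrightarrow> w y \<le> p y"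
  shows "\<exists>u. linear u \<and> (\<forall>x. u x \<le> p x) \<and> (\<forall>y\<in>Y. u y = w y)"
proof -
  have w0: "w 0 = 0" using w subspace_0[OF Y] unfolding linear_form_on_def by (metis mult_zero_left scaleR_zero_left)
  have wneg: "w (- y) = - w y" if "y \<in> Y" for y
  proof -
    have "w ((-1) *\<^sub>R y) = (-1) * w y" using w that unfolding linear_form_on_def by blast
    then show ?thesis by simp
  qed
  define A where "A x = (\<lambda>y. p (x - y) + w y) ` Y" for x
  define r where "r x = Inf (A x)" for x
  have ne: "A x \<noteq> {}" for x using subspace_0[OF Y] by (auto simp: A_def)
  have low: "- p (- x) \<le> a" if a: "a \<in> A x" for a x
  proof -
    obtain y where y: "y \<in> Y" "a = p (x - y) + w y" using a by (auto simp: A_def)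
    have "w (- y) \<le> p (- y)" using le y Y subspace_neg by blast
    also have "p (- y) \<le> p (x - y) + p (- x)" using sublinear_add[OF p, of "x - y" "- x"] by simp
    finally show ?thesis using wneg y by simp
  qed
  have bdd: "bdd_below (A x)" for x using low by (meson bdd_belowI)
  have rle: "r x \<le> p (x - y) + w y" if "y \<in> Y" for x y
    unfolding r_def using that by (intro cInf_lower bdd) (auto simp: A_def)
  have rge: "b \<le> r x" if "\<And>y. y \<in> Y \<Longrightarrow> b \<le> p (x - y) + w y" for b x
    unfolding r_def using that by (intro cInf_greatest ne) (auto simp: A_def)
  have "sublinear r"
  proof (rule sublinearI)
    fix x x'
    have *: "r (x + x') \<le> (p (x - y) + w y) + (p (x' - y') + w y')" if yy: "y \<in> Y" "y' \<in> Y" for y y'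
    proof -
      have "r (x + x') \<le> p ((x + x') - (y + y')) + w (y + y')"
        using yy Y by (intro rle subspace_add)
      moreover have "p ((x + x') - (y + y')) \<le> p (x - y) + p (x' - y')"
        using sublinear_add[OF p, of "x - y" "x' - y'"] by (simp add: algebra_simps)
      moreover have "w (y + y') = w y + w y'" using w yy unfolding linear_form_on_def by blast
      ultimately show ?thesis by simp
    qed
    have "r (x + x') - (p (x - y) + w y) \<le> r x'" if "y \<in> Y" for y
    proof (rule rge)
      fix y' assume "y' \<in> Y"
      then show "r (x + x') - (p (x - y) + w y) \<le> p (x' - y') + w y'" using *[OF that] by fastforce
    qed
    then have "r (x + x') - r x' \<le> r x" by (intro rge) (simp add: algebra_simps)
    then show "r (x + x') \<le> r x + r x'" by simp
  next
    fix c :: real and x assume c: "0 < c"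
    have "r (c *\<^sub>R x) / c \<le> p (x - y) + w y" if y: "y \<in> Y" for y
    proof -
      have "r (c *\<^sub>R x) \<le> p (c *\<^sub>R x - c *\<^sub>R y) + w (c *\<^sub>R y)"
        using y Y by (intro rle subspace_scale)
      also have "c *\<^sub>R x - c *\<^sub>R y = c *\<^sub>R (x - y)" by (simp add: algebra_simps)
      also have "w (c *\<^sub>R y) = c * w y" using w y unfolding linear_form_on_def by blast
      also have "p (c *\<^sub>R (x - y)) = c * p (x - y)" using sublinear_scale[OF p, of c] c by simp
      finally show ?thesis using c by (simp add: field_simps)
    qed
    then have "r (c *\<^sub>R x) / c \<le> r x" by (rule rge)
    then show "r (c *\<^sub>R x) \<le> c * r x" using c by (simp add: field_simps)
  next
    have "r 0 \<le> 0" using rle[OF subspace_0[OF Y], of 0] w0 sublinear_zero[OF p] by simp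
    moreover have "0 \<le> r 0"
    proof (rule rge)
      fix y assume "y \<in> Y"
      then show "0 \<le> p (0 - y) + w y" using le[of "- y"] wneg subspace_neg[OF Y] by auto
    qed
    ultimately show "r 0 = 0" by simp
  qed
  then obtain u where u: "linear u" "\<And>x. u x \<le> r x" using sublinear_dominates_linear by blast
  have up: "u x \<le> p x" for x
    using u(2)[of x] rle[OF subspace_0[OF Y], of x] w0 by simp
  have uw: "u y \<le> w y" if "y \<in> Y" for y
    using u(2)[of y] rle[OF that, of y] sublinear_zero[OF p] by simp
  have "u y = w y" if "y \<in> Y" for y
    using uw[OF that] uw[of "- y"] wneg that subspace_neg[OF Y] linear_neg[OF u(1)] by fastforce
  then show ?thesis using u(1) up by blast
qed

subsection \<open>Countable closures and separable subspaces\<close>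

text \<open>Operations take lists as arguments so that all finite arities are treated at once;
  countability survives each stage because lists over a countable set are countable.\<close>

lemma countable_closed_under:
  assumes G: "\<And>xs. countable (G xs)" and C0: "countable (C0 :: 'a set)"
  shows "\<exists>C. countable C \<and> C0 \<subseteq> C \<and> (\<forall>xs. set xs \<subseteq> C \<longrightarrow> G xs \<subseteq> C)"
proof -
  define step where "step A = A \<union> (\<Union>xs\<in>lists A. G xs)" for A
  define C where "C n = (step ^^ n) C0" for n
  have cnt: "countable (C n)" for n
  proof (induction n)
    case (Suc n)
    then show ?case
      unfolding C_def funpow.simps o_def step_def[of "(step ^^ n) C0"]
      by (intro countable_Un countable_UN countable_lists G) auto
  qed (simp add: C_def C0)
  have Suc: "C (Suc n) = C n \<union> (\<Union>xs\<in>lists (C n). G xs)" for n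
    by (simp add: C_def step_def)
  have mono: "C m \<subseteq> C n" if "m \<le> n" for m n
    using that by (rule lift_Suc_mono_le[rotated]) (auto simp: Suc)
  have fin: "\<exists>n. set xs \<subseteq> C n" if "set xs \<subseteq> (\<Union>n. C n)" for xs
    using that
  proof (induction xs)
    case (Cons x xs)
    then obtain n m where "x \<in> C n" "set xs \<subseteq> C m" by auto
    then have "set (x # xs) \<subseteq> C (max n m)" using mono[of n "max n m"] mono[of m "max n m"] by auto
    then show ?case by blast
  qed simp
  have "G xs \<subseteq> (\<Union>n. C n)" if xs: "set xs \<subseteq> (\<Union>n. C n)" for xs
  proof -
    obtain n where "set xs \<subseteq> C n" using fin[OF xs] by blast
    then have "G xs \<subseteq> C (Suc n)" unfolding Suc by (auto simp: in_lists_conv_set)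
    then show ?thesis by blast
  qed
  moreover have "C0 \<subseteq> C 0" by (simp add: C_def)
  ultimately show ?thesis using cnt by (intro exI[of _ "\<Union>n. C n"]) auto
qed

lemma subspace_closure_rational:
  fixes D :: "'a::real_normed_vector set"
  assumes ne: "D \<noteq> {}" and add: "\<And>x y. x \<in> D \<Longrightarrow> y \<in> D \<Longrightarrow> x + y \<in> D"
    and scale: "\<And>x (q::rat). x \<in> D \<Longrightarrow> of_rat q *\<^sub>R x \<in> D"
  shows "subspace (closure D)"
proof (rule subspaceI)
  obtain x where "x \<in> D" using ne by blast
  then have "0 \<in> D" using scale[of x 0] by simp
  then show "0 \<in> closure D" using closure_subset by blast
next
  fix x y assume "x \<in> closure D" "y \<in> closure D"
  then obtain f g where f: "\<And>n. f n \<in> D" "f \<longlonglongrightarrow> x" and g: "\<And>n. g n \<in> D" "g \<longlonglongrightarrow> y"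
    unfolding closure_sequential by blast
  have "(\<lambda>n. f n + g n) \<longlonglongrightarrow> x + y" by (intro tendsto_intros f g)
  then show "x + y \<in> closure D"
    unfolding closure_sequential using add[OF f(1) g(1)]
    by (intro exI[of _ "\<lambda>n. f n + g n"]) simp
next
  fix c :: real and x assume "x \<in> closure D"
  then obtain f where f: "\<And>n. f n \<in> D" "f \<longlonglongrightarrow> x" unfolding closure_sequential by blast
  have "c \<in> closure \<rat>" by (simp add: Rats_closure_real)
  then obtain r where r: "\<And>n. r n \<in> \<rat>" "r \<longlonglongrightarrow> c" unfolding closure_sequential by blast
  have "(\<lambda>n. r n *\<^sub>R f n) \<longlonglongrightarrow> c *\<^sub>R x" by (intro tendsto_intros f r)
  moreover have "r n *\<^sub>R f n \<in> D" for n
    using r(1)[of n] scale[OF f(1)[of n]] by (auto elim: Rats_cases)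
  ultimately show "c *\<^sub>R x \<in> closure D"
    unfolding closure_sequential by (intro exI[of _ "\<lambda>n. r n *\<^sub>R f n"]) simp
qed

lemma separable_space_closure:
  fixes D :: "'a::real_normed_vector set"
  assumes "countable D"
  shows "separable_space (top_of_set (closure D))"
  unfolding separable_space_def
  using assms closure_subset[of D]
  by (intro exI[of _ D]) (auto simp: closure_of_subtopology Int_absorb1)

text \<open>Closing under sums and rational multiples together with \<open>G\<close> keeps the set
  countable and makes its closure a real subspace.\<close>

lemma separable_subspace_closed_under:
  fixes C0 :: "'a::real_normed_vector set"
  assumes G: "\<And>xs. countable (G xs)" and C0: "countable C0"
  shows "\<exists>D. countable D \<and> C0 \<subseteq> D \<and> (\<forall>xs. set xs \<subseteq> D \<longrightarrow> G xs \<subseteq> D) \<and> subspace (closure D)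
           \<and> separable_space (top_of_set (closure D))"
proof -
  define G' where "G' xs = G xs \<union> insert 0 {sum_list xs} \<union> (\<Union>x\<in>set xs. range (\<lambda>q::rat. of_rat q *\<^sub>R x))" for xs
  have "countable (G' xs)" for xs
    unfolding G'_def by (intro countable_Un G countable_UN countable_image) (auto simp: countable_finite)
  from countable_closed_under[of G', OF this C0]
  obtain D where D: "countable D" "C0 \<subseteq> D" "\<And>xs. set xs \<subseteq> D \<Longrightarrow> G' xs \<subseteq> D" by blast
  have "0 \<in> D" using D(3)[of "[]"] by (simp add: G'_def)
  moreover have "x + y \<in> D" if "x \<in> D" "y \<in> D" for x y
    using D(3)[of "[x, y]"] that by (simp add: G'_def)
  moreover have "of_rat q *\<^sub>R x \<in> D" if "x \<in> D" for x and q :: rat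
    using D(3)[of "[x]"] that by (auto simp: G'_def)
  ultimately have "subspace (closure D)" by (intro subspace_closure_rational) auto
  moreover have "\<forall>xs. set xs \<subseteq> D \<longrightarrow> G xs \<subseteq> D" using D(3) unfolding G'_def by (metis Un_subset_iff)
  ultimately show ?thesis
    by (intro exI[of _ D] conjI D(1,2) separable_space_closure)
qed

subsection \<open>Weak* sequential compactness of dual balls\<close>

text \<open>The infimum of the eventual upper bounds is the limit superior, a sublinear function of
  x; a linear functional below it plays the role of a cluster point of the sequence. Applied to - x,
  the conclusion bounds w from below as well.\<close>

lemma cluster_functional:
  fixes u :: "nat \<Rightarrow> 'a::real_normed_vector \<Rightarrow> real"
  assumes lin: "\<And>n. linear (u n)" and bd: "\<And>n x. \<bar>u n x\<bar> \<le> c * norm x"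
  shows "\<exists>w. linear w \<and> (\<forall>x b. (\<forall>\<^sub>F n in sequentially. u n x \<le> b) \<longrightarrow> w x \<le> b)"
proof -
  define A where "A x = {b. \<forall>\<^sub>F n in sequentially. u n x \<le> b}" for x
  define p where "p x = Inf (A x)" for x
  have low: "- (c * norm x) \<le> b" if "b \<in> A x" for b x
  proof -
    obtain n where "u n x \<le> b"
      using \<open>b \<in> A x\<close> unfolding A_def by (auto dest: eventually_happens)
    then show ?thesis using bd[of n x] by linarith
  qed
  have bdd: "bdd_below (A x)" for x using low by (meson bdd_belowI)
  have "u n x \<le> c * norm x" for n x using bd[of n x] by linarith
  then have mem: "c * norm x \<in> A x" for x by (simp add: A_def)
  have ne: "A x \<noteq> {}" for x using mem by blast
  have ple: "p x \<le> b" if "b \<in> A x" for b x unfolding p_def using that by (intro cInf_lower bdd)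
  have "sublinear p"
  proof (rule sublinearI)
    fix x y
    have "a + b \<in> A (x + y)" if "a \<in> A x" "b \<in> A y" for a b
    proof -
      have "\<forall>\<^sub>F n in sequentially. u n x \<le> a \<and> u n y \<le> b"
        using that by (auto simp: A_def eventually_conj_iff)
      then have "\<forall>\<^sub>F n in sequentially. u n (x + y) \<le> a + b"
        by eventually_elim (simp add: linear_add[OF lin] add_mono)
      then show ?thesis by (simp add: A_def)
    qed
    then have *: "p (x + y) \<le> a + b" if "a \<in> A x" "b \<in> A y" for a b using that ple by blast
    have "p (x + y) - a \<le> p y" if a: "a \<in> A x" for a
      unfolding p_def[of y]
    proof (intro cInf_greatest ne)
      fix b assume "b \<in> A y" then show "p (x + y) - a \<le> b" using *[OF a, of b] by simp
    qed
    then have "p (x + y) - p y \<le> p x"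
      unfolding p_def[of x] by (intro cInf_greatest ne) (simp add: algebra_simps)
    then show "p (x + y) \<le> p x + p y" by simp
  next
    fix k :: real and x assume k: "0 < k"
    have "k * b \<in> A (k *\<^sub>R x)" if "b \<in> A x" for b
    proof -
      have "\<forall>\<^sub>F n in sequentially. u n x \<le> b" using that by (simp add: A_def)
      then have "\<forall>\<^sub>F n in sequentially. u n (k *\<^sub>R x) \<le> k * b"
        by eventually_elim (use k in \<open>simp add: linear_scale[OF lin]\<close>)
      then show ?thesis by (simp add: A_def)
    qed
    then have "p (k *\<^sub>R x) \<le> k * b" if "b \<in> A x" for b using that ple by blast
    then have "p (k *\<^sub>R x) / k \<le> p x"
      unfolding p_def[of x] using k by (intro cInf_greatest ne) (simp add: field_simps)
    then show "p (k *\<^sub>R x) \<le> k * p x" using k by (simp add: field_simps)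
  next
    have "A 0 = {0..}" by (auto simp: A_def linear_0[OF lin])
    then show "p 0 = 0" by (simp add: p_def)
  qed
  then obtain w where w: "linear w" "\<And>x. w x \<le> p x" using sublinear_dominates_linear by blast
  have "w x \<le> b" if "\<forall>\<^sub>F n in sequentially. u n x \<le> b" for x b
    using w(2)[of x] ple[of b x] that by (force simp: A_def)
  then show ?thesis using w(1) by blast
qed

text \<open>Some subsequence tends to a limit l. If the whole sequence did not, infinitely many
  terms would stay e away from l on one side, while infinitely many lie within e/2 of l, which is an
  oscillation by e/2.\<close>

lemma convergent_if_no_oscillation:
  fixes a :: "nat \<Rightarrow> real"
  assumes bd: "bounded (range a)"
    and no: "\<And>e. 0 < e \<Longrightarrow> \<not> (\<exists>b. infinite {n. a n \<le> b} \<and> infinite {n. b + e \<le> a n})"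
  shows "convergent a"
proof -
  obtain l r where r: "strict_mono r" "(a \<circ> r) \<longlonglongrightarrow> l"
    using bounded_imp_convergent_subsequence[OF bd] by blast
  have near: "infinite {n. l - e < a n \<and> a n < l + e}" if "e > 0" for e
  proof -
    obtain N where N: "\<And>n. n \<ge> N \<Longrightarrow> \<bar>a (r n) - l\<bar> < e"
      using r(2) \<open>e > 0\<close> unfolding LIMSEQ_def by (auto simp: dist_real_def)
    have "infinite (r ` {N..})"
      using r(1) by (meson finite_imageD infinite_Ici strict_mono_imp_inj_on inj_on_subset subset_UNIV)
    moreover have "l - e < a (r n) \<and> a (r n) < l + e" if "n \<ge> N" for n
      using N[OF that] by (simp add: abs_diff_less_iff)
    then have "r ` {N..} \<subseteq> {n. l - e < a n \<and> a n < l + e}" by auto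
    ultimately show ?thesis using infinite_super by blast
  qed
  have "a \<longlonglongrightarrow> l"
  proof (rule ccontr)
    assume "\<not> a \<longlonglongrightarrow> l"
    then obtain e where e: "e > 0" "\<And>N. \<exists>n\<ge>N. \<bar>a n - l\<bar> \<ge> e"
      unfolding LIMSEQ_def dist_real_def by (meson not_less)
    then have "infinite {n. \<bar>a n - l\<bar> \<ge> e}" by (auto simp: infinite_nat_iff_unbounded_le)
    moreover have "{n. \<bar>a n - l\<bar> \<ge> e} = {n. l + e \<le> a n} \<union> {n. a n \<le> l - e}" by auto
    ultimately consider "infinite {n. l + e \<le> a n}" | "infinite {n. a n \<le> l - e}" by auto
    then show False
    proof cases
      case 1
      moreover have "infinite {n. a n \<le> l + e / 2}"
        by (rule infinite_super[OF _ near[of "e / 2"]]) (use e in auto)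
      ultimately show False using no[of "e / 2"] e(1) by (force simp: add.assoc)
    next
      case 2
      moreover have "infinite {n. l - e + e / 2 \<le> a n}"
        by (rule infinite_super[OF _ near[of "e / 2"]]) (use e in auto)
      ultimately show False using no[of "e / 2"] e(1) by force
    qed
  qed
  then show ?thesis by (auto simp: convergent_def)
qed

lemma infinite_nat_shift:
  assumes "infinite {n::nat. Q n}"
  shows "infinite {n. Q (k + n)}"
proof
  assume "finite {n. Q (k + n)}"
  then have "finite ({..<k} \<union> (+) k ` {n. Q (k + n)})" by simp
  moreover have "{n. Q n} \<subseteq> {..<k} \<union> (+) k ` {n. Q (k + n)}"
  proof
    fix n assume "n \<in> {n. Q n}"
    then show "n \<in> {..<k} \<union> (+) k ` {n. Q (k + n)}"
      by (cases "n < k") (auto intro!: image_eqI[of _ _ "n - k"])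
  qed
  ultimately show False using assms finite_subset by blast
qed

text \<open>Hagler and Johnson: a bounded sequence without pointwise convergent subsequence yields a
  dyadic tree of infinite index sets along which it oscillates by a fixed amount at points of the
  unit ball. Limits along the branches form an uncountable uniformly separated family of functionals
  on the span of these countably many points.\<close>

lemma oscillation_tree_nonseparable:
  fixes v :: "nat \<Rightarrow> 'a::banach \<Rightarrow> real"
  assumes A: "asplund TYPE('a)"
    and lin: "\<And>n. linear (v n)" and bd: "\<And>n x. \<bar>v n x\<bar> \<le> c * norm x"
    and e: "0 < e"
    and osc: "\<And>M. infinite M \<Longrightarrow>
      \<exists>x a. norm x \<le> 1 \<and> infinite {n\<in>M. v n x \<le> a} \<and> infinite {n\<in>M. a + e \<le> v n x}"
  shows False
proof -
  have "\<forall>M. \<exists>x a. infinite M \<longrightarrow>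
      norm x \<le> 1 \<and> infinite {n\<in>M. v n x \<le> a} \<and> infinite {n\<in>M. a + e \<le> v n x}"
    using osc by blast
  from choice[OF this] obtain X where "\<forall>M. \<exists>a. infinite M \<longrightarrow> norm (X M) \<le> 1 \<and>
      infinite {n\<in>M. v n (X M) \<le> a} \<and> infinite {n\<in>M. a + e \<le> v n (X M)}" ..
  from choice[OF this] obtain a where XA: "\<And>M. infinite M \<Longrightarrow> norm (X M) \<le> 1 \<and>
      infinite {n\<in>M. v n (X M) \<le> a M} \<and> infinite {n\<in>M. a M + e \<le> v n (X M)}" by blast
  define S where "S M b = {n\<in>M. if b then a M + e \<le> v n (X M) else v n (X M) \<le> a M}" for M b
  define N where "N l = foldr (\<lambda>b M. S M b) l UNIV" for l
  have Sinf: "infinite (S M b)" if "infinite M" for M b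
    using XA[OF that] by (cases b) (auto simp: S_def)
  have Ninf: "infinite (N l)" for l
    by (induction l) (auto simp: N_def Sinf)
  \<comment> \<open>A set \<open>T\<close> of naturals encodes a branch. As \<open>foldr\<close>
    applies the head of the list last, \<open>rev\<close> puts the most recent decision at the
    head.\<close>
  define B where "B T k = N (rev (map (\<lambda>i. i \<in> T) [0..<k]))" for T :: "nat set" and k
  have BSuc: "B T (Suc k) = S (B T k) (k \<in> T)" for T k by (simp add: B_def N_def)
  have Binf: "infinite (B T k)" for T k by (simp add: B_def Ninf)
  have Bmono: "B T m \<subseteq> B T k" if "k \<le> m" for T k m
    using that by (rule lift_Suc_antimono_le[rotated]) (auto simp: BSuc S_def)
  have Beq: "B T k = B T' k" if "\<And>i. i < k \<Longrightarrow> i \<in> T \<longleftrightarrow> i \<in> T'" for T T' k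
  proof -
    have "map (\<lambda>i. i \<in> T) [0..<k] = map (\<lambda>i. i \<in> T') [0..<k]" using that by auto
    then show ?thesis unfolding B_def by (rule arg_cong)
  qed
  have "\<exists>n. n \<in> B T k" for T k using infinite_imp_nonempty[OF Binf] by blast
  then obtain i where i: "\<And>T k. i T k \<in> B T k" by metis
  \<comment> \<open>Only the tail of the selected indices matters for \<open>w\<close>, and from
    stage \<open>Suc k\<close> on they all lie in \<open>B T (Suc k)\<close>. Hence
    \<open>w T\<close> inherits every inequality that holds along the branch.\<close>
  have "\<exists>w. linear w \<and> (\<forall>x b. (\<forall>\<^sub>F k in sequentially. v (i T k) x \<le> b) \<longrightarrow> w x \<le> b)" for T
    by (rule cluster_functional[of _ c]) (auto simp: lin bd)
  then obtain w where w: "\<And>T. linear (w T)"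
    "\<And>T x b. (\<forall>\<^sub>F k in sequentially. v (i T k) x \<le> b) \<Longrightarrow> w T x \<le> b" by metis
  have wge: "b \<le> w T x" if "\<forall>\<^sub>F k in sequentially. b \<le> v (i T k) x" for T x b
  proof -
    have "\<forall>\<^sub>F k in sequentially. v (i T k) (- x) \<le> - b"
      using that by eventually_elim (simp add: linear_neg[OF lin])
    then show ?thesis using w(2)[of T "- x" "- b"] linear_neg[OF w(1)] by simp
  qed
  have wbd: "\<bar>w T x\<bar> \<le> c * norm x" for T x
  proof -
    have "v n x \<le> c * norm x \<and> - (c * norm x) \<le> v n x" for n using bd[of n x] by linarith
    then have "w T x \<le> c * norm x" "- (c * norm x) \<le> w T x" by (auto intro!: w(2) wge)
    then show ?thesis by linarith
  qed
  have wup: "a (B T k) + e \<le> w T (X (B T k))" if "k \<in> T" for T k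
  proof (rule wge, rule eventually_sequentiallyI)
    fix m assume "Suc k \<le> m"
    then have "i T m \<in> S (B T k) True" using i[of T m] Bmono[of "Suc k" m T] BSuc[of T k] that by auto
    then show "a (B T k) + e \<le> v (i T m) (X (B T k))" by (simp add: S_def)
  qed
  have wlow: "w T (X (B T k)) \<le> a (B T k)" if "k \<notin> T" for T k
  proof (rule w(2), rule eventually_sequentiallyI)
    fix m assume "Suc k \<le> m"
    then have "i T m \<in> S (B T k) False" using i[of T m] Bmono[of "Suc k" m T] BSuc[of T k] that by auto
    then show "v (i T m) (X (B T k)) \<le> a (B T k)" by (simp add: S_def)
  qed
  \<comment> \<open>There are only countably many nodes, one for each finite list of decisions, so
    all the separating points fit into a single separable subspace although there are uncountably
    many branches.\<close>
  obtain D where D: "countable D" "range (X \<circ> N) \<subseteq> D" "subspace (closure D)"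
      "separable_space (top_of_set (closure D))"
    using separable_subspace_closed_under[of "\<lambda>_. {}" "range (X \<circ> N)"] by auto
  define Y where "Y = closure D"
  have XY: "X (B T k) \<in> Y" for T k
    using D(2) closure_subset[of D] by (auto simp: Y_def B_def)
  have "separable_subspace_dual Y" using A D(3,4) by (simp add: asplund_def Y_def)
  then obtain E where E: "countable E"
    "\<And>\<phi> \<epsilon>. \<phi> \<in> subspace_dual Y \<Longrightarrow> \<epsilon> > 0 \<Longrightarrow> \<exists>\<psi>\<in>E. \<forall>y\<in>Y. \<bar>\<phi> y - \<psi> y\<bar> \<le> \<epsilon> * norm y"
    unfolding separable_subspace_dual_def by blast
  have "restrict (w T) Y \<in> subspace_dual Y" for T
    using D(3) wbd[of T] linear_add[OF w(1)[of T]] linear_scale[OF w(1)[of T]]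
    by (auto simp: subspace_dual_def Y_def subspace_add subspace_scale)
  then have "\<exists>\<psi>\<in>E. \<forall>y\<in>Y. \<bar>w T y - \<psi> y\<bar> \<le> e / 4 * norm y" for T
    using E(2)[of "restrict (w T) Y" "e / 4"] e by force
  then obtain \<psi> where \<psi>: "\<And>T. \<psi> T \<in> E" "\<And>T y. y \<in> Y \<Longrightarrow> \<bar>w T y - \<psi> T y\<bar> \<le> e / 4 * norm y"
    by metis
  \<comment> \<open>At the first index where two branches differ they share a node. At its point, of
    norm at most 1, the two limits differ by at least e, whereas a common approximant within e/4 of
    both would force a difference of at most e/2.\<close>
  have sep: "\<psi> T \<noteq> \<psi> T'" if k: "k \<in> T" "k \<notin> T'" "\<And>i. i < k \<Longrightarrow> i \<in> T \<longleftrightarrow> i \<in> T'" for T T' k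
  proof
    assume eq: "\<psi> T = \<psi> T'"
    define x where "x = X (B T k)"
    have "B T k = B T' k" by (rule Beq) (use k in auto)
    then have "e \<le> w T x - w T' x" using wup[OF k(1)] wlow[OF k(2)] by (simp add: x_def)
    have "e / 4 * norm x \<le> e / 4"
      using XA[OF Binf] e by (simp add: x_def mult_left_le)
    moreover have "x \<in> Y" using XY x_def by simp
    ultimately have "\<bar>w T x - \<psi> T x\<bar> \<le> e / 4" "\<bar>w T' x - \<psi> T' x\<bar> \<le> e / 4"
      using \<psi>(2)[of x T] \<psi>(2)[of x T'] by linarith+
    then show False using \<open>e \<le> w T x - w T' x\<close> eq e by simp
  qed
  have "inj \<psi>"
  proof (rule injI, rule ccontr)
    fix T T' assume eq: "\<psi> T = \<psi> T'" and "T \<noteq> T'"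
    then have ex: "\<exists>k. (k \<in> T) \<noteq> (k \<in> T')" by blast
    define k where "k = (LEAST k. (k \<in> T) \<noteq> (k \<in> T'))"
    have "(k \<in> T) \<noteq> (k \<in> T')" unfolding k_def by (rule LeastI_ex[OF ex])
    moreover have "(i \<in> T) = (i \<in> T')" if "i < k" for i
      using not_less_Least[of i "\<lambda>k. (k \<in> T) \<noteq> (k \<in> T')"] that by (auto simp: k_def)
    ultimately show False using sep[of k T T'] sep[of k T' T] eq by metis
  qed
  moreover have "countable (range \<psi>)" by (rule countable_subset[OF _ E(1)]) (use \<psi>(1) in auto)
  ultimately have "countable (UNIV :: nat set set)" using countable_image_inj_on by blast
  then obtain g :: "nat \<Rightarrow> nat set" where "range g = UNIV"
    by (metis UNIV_not_empty range_from_nat_into)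
  then show False using Cantors_theorem[of "UNIV :: nat set"] by simp
qed

text \<open>If every further subsequence oscillated by 1/(k+1) at some point of the unit ball, the
  tree would arise. So the oscillation can be removed at all points of the ball simultaneously, and
  a diagonal over k removes it altogether, leaving pointwise convergence.\<close>

lemma asplund_dual_sequentially_compact:
  fixes u :: "nat \<Rightarrow> 'a::banach \<Rightarrow> real"
  assumes A: "asplund TYPE('a)"
    and lin: "\<And>n. linear (u n)" and bd: "\<And>n x. \<bar>u n x\<bar> \<le> c * norm x"
  shows "\<exists>r w. strict_mono r \<and> linear w \<and> (\<forall>x. (\<lambda>n. u (r n) x) \<longlonglongrightarrow> w x)"
proof -
  define osc where "osc s \<epsilon> x \<longleftrightarrow>
      (\<exists>b. infinite {n. u (s n) x \<le> b} \<and> infinite {n. b + \<epsilon> \<le> u (s n) x})"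
    for s :: "nat \<Rightarrow> nat" and \<epsilon> x
  define P where "P k s \<longleftrightarrow> (\<forall>x. norm x \<le> 1 \<longrightarrow> \<not> osc s (1 / Suc k) x)" for k s
  have ex: "\<exists>r'. strict_mono r' \<and> P k (s \<circ> r')" if s: "strict_mono s" for k and s :: "nat \<Rightarrow> nat"
  proof (rule ccontr)
    assume no: "\<not> ?thesis"
    show False
    proof (rule oscillation_tree_nonseparable[OF A])
      show "linear (u (s n))" for n by (rule lin)
      show "\<bar>u (s n) x\<bar> \<le> c * norm x" for n x by (rule bd)
      show "0 < 1 / real (Suc k)" by simp
      fix M :: "nat set" assume M: "infinite M"
      then have en: "strict_mono (enumerate M)" "range (enumerate M) = M"
        by (simp_all add: strict_mono_enumerate range_enumerate)
      with no obtain x where x: "norm x \<le> 1" "osc (s \<circ> enumerate M) (1 / Suc k) x"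
        unfolding P_def by blast
      then obtain b where b: "infinite {n. u (s (enumerate M n)) x \<le> b}"
        "infinite {n. b + 1 / Suc k \<le> u (s (enumerate M n)) x}" by (auto simp: osc_def)
      have tr: "infinite {n\<in>M. Q n}" if "infinite {n. Q (enumerate M n)}" for Q
      proof -
        have "infinite (enumerate M ` {n. Q (enumerate M n)})"
          using that en(1) by (meson finite_imageD inj_on_subset strict_mono_imp_inj_on subset_UNIV)
        moreover have "enumerate M ` {n. Q (enumerate M n)} \<subseteq> {n\<in>M. Q n}" using en(2) by auto
        ultimately show ?thesis using infinite_super by blast
      qed
      show "\<exists>x a. norm x \<le> 1 \<and> infinite {n\<in>M. u (s n) x \<le> a}
          \<and> infinite {n\<in>M. a + 1 / Suc k \<le> u (s n) x}"
        using x(1) tr[OF b(1)] tr[OF b(2)] by blast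
    qed
  qed
  interpret subseqs P by unfold_locales (rule ex)
  have stable: "P k (s \<circ> r)" if r: "strict_mono r" and Pk: "P k s" for k s r
    unfolding P_def
  proof (intro allI impI notI)
    fix x :: 'a assume x: "norm x \<le> 1" "osc (s \<circ> r) (1 / Suc k) x"
    have tr: "infinite {n. Q n}" if "infinite {n. Q (r n)}" for Q
    proof -
      have "infinite (r ` {n. Q (r n)})"
        using that r by (meson finite_imageD inj_on_subset strict_mono_imp_inj_on subset_UNIV)
      then show ?thesis by (rule infinite_super[rotated]) auto
    qed
    have "osc s (1 / Suc k) x"
      using x(2) tr[of "\<lambda>n. u (s n) x \<le> _"] tr[of "\<lambda>n. _ \<le> u (s n) x"]
      by (auto simp: osc_def)
    then show False using Pk x(1) by (auto simp: P_def)
  qed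
  have conv1: "convergent (\<lambda>n. u (diagseq n) x)" if x: "norm x \<le> 1" for x
  proof (rule convergent_if_no_oscillation)
    show "bounded (range (\<lambda>n. u (diagseq n) x))"
      using bd[of _ x] by (auto simp: bounded_iff)
  next
    fix \<epsilon> :: real assume "0 < \<epsilon>"
    then obtain k where k: "1 / Suc k < \<epsilon>" using nat_approx_posE by blast
    show "\<not> (\<exists>b. infinite {n. u (diagseq n) x \<le> b} \<and> infinite {n. b + \<epsilon> \<le> u (diagseq n) x})"
    proof
      assume "\<exists>b. infinite {n. u (diagseq n) x \<le> b} \<and> infinite {n. b + \<epsilon> \<le> u (diagseq n) x}"
      then obtain b where b: "infinite {n. u (diagseq n) x \<le> b}" "infinite {n. b + \<epsilon> \<le> u (diagseq n) x}"
        by blast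
      have "infinite {n. b + 1 / Suc k \<le> u (diagseq n) x}"
        by (rule infinite_super[OF _ b(2)]) (use k in auto)
      \<comment> \<open>The diagonal sequence is a subsequence of stage k only from index
        \<open>Suc k\<close> on, so the infinite index sets are shifted.\<close>
      then have "osc (diagseq \<circ> ((+) (Suc k))) (1 / Suc k) x"
        unfolding osc_def o_def using infinite_nat_shift[OF b(1), of "Suc k"]
          infinite_nat_shift[of "\<lambda>n. b + 1 / Suc k \<le> u (diagseq n) x" "Suc k"] by blast
      then show False using diagseq_holds[of k, OF stable] x by (auto simp: P_def)
    qed
  qed
  have conv: "convergent (\<lambda>n. u (diagseq n) x)" for x
  proof (cases "x = 0")
    case False
    have "convergent (\<lambda>n. norm x * u (diagseq n) ((1 / norm x) *\<^sub>R x))"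
      using False by (intro convergent_mult convergent_const conv1) simp
    then show ?thesis using False by (simp add: linear_scale[OF lin])
  qed (simp add: linear_0[OF lin] convergent_const)
  define w where "w x = lim (\<lambda>n. u (diagseq n) x)" for x
  have w: "(\<lambda>n. u (diagseq n) x) \<longlonglongrightarrow> w x" for x
    using conv[of x] by (simp add: convergent_LIMSEQ_iff w_def)
  have "linear w"
  proof (rule linearI)
    fix x y
    have "(\<lambda>n. u (diagseq n) (x + y)) \<longlonglongrightarrow> w x + w y"
      unfolding linear_add[OF lin] by (intro tendsto_add w)
    then show "w (x + y) = w x + w y" using w LIMSEQ_unique by blast
  next
    fix k :: real and x
    have "(\<lambda>n. u (diagseq n) (k *\<^sub>R x)) \<longlonglongrightarrow> k *\<^sub>R w x"
      unfolding linear_scale[OF lin] by (intro tendsto_scaleR tendsto_const w)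
    then show "w (k *\<^sub>R x) = k *\<^sub>R w x" using w LIMSEQ_unique by blast
  qed
  then show ?thesis using w subseq_diagseq by blast
qed

subsection \<open>A smooth gauge on a subspace with separable dual\<close>

text \<open>In contrast to \<open>subspace_dual\<close>, values off Y are unconstrained, so
  functionals on the whole space and pointwise limits belong here without being restricted
  first.\<close>

definition dual_on :: "'a::real_normed_vector set \<Rightarrow> ('a \<Rightarrow> real) set" where
  "dual_on Y = {\<phi>. linear_form_on Y \<phi> \<and> (\<exists>K. \<forall>y\<in>Y. \<bar>\<phi> y\<bar> \<le> K * norm y)}"

lemma linear_form_on_linear: "linear u \<Longrightarrow> linear_form_on Y u"
  by (simp add: linear_form_on_def linear_add linear_scale)

lemma norming_functional:
  fixes y :: "'a::real_normed_vector"
  shows "\<exists>u. linear u \<and> (\<forall>x. \<bar>u x\<bar> \<le> norm x) \<and> u y = norm y"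
proof (cases "y = 0")
  case True
  have "linear (\<lambda>x::'a. 0::real)" by (simp add: linear_iff)
  then show ?thesis using True by (intro exI[of _ "\<lambda>x. 0"]) auto
next
  case False
  define w where "w z = norm y * (THE k. z = k *\<^sub>R y)" for z
  have wk: "w (k *\<^sub>R y) = norm y * k" for k
  proof -
    have "(THE j. k *\<^sub>R y = j *\<^sub>R y) = k" using False by (intro the_equality) auto
    then show ?thesis by (simp add: w_def)
  qed
  have Y: "subspace (range (\<lambda>k. k *\<^sub>R y))" using subspace_span[of "{y}"] by (simp add: span_singleton)
  have "w (i *\<^sub>R y + j *\<^sub>R y) = w (i *\<^sub>R y) + w (j *\<^sub>R y)" for i j
    unfolding scaleR_add_left[symmetric] wk by (simp add: algebra_simps)
  moreover have "w (c *\<^sub>R i *\<^sub>R y) = c * w (i *\<^sub>R y)" for c i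
    unfolding scaleR_scaleR wk by simp
  ultimately have lin: "linear_form_on (range (\<lambda>k. k *\<^sub>R y)) w"
    by (auto simp: linear_form_on_def)
  have sub: "sublinear (norm :: 'a \<Rightarrow> real)"
    by (auto simp: sublinear_def norm_triangle_ineq)
  have "w x \<le> norm x" if "x \<in> range (\<lambda>k. k *\<^sub>R y)" for x
    using that by (auto simp: wk mult.commute[of "norm y"] intro!: mult_right_mono)
  then obtain u where u: "linear u" "\<And>x. u x \<le> norm x" "\<And>x. x \<in> range (\<lambda>k. k *\<^sub>R y) \<Longrightarrow> u x = w x"
    using Hahn_Banach[OF sub Y lin] by blast
  have "\<bar>u x\<bar> \<le> norm x" for x
    using u(2)[of x] u(2)[of "- x"] linear_neg[OF u(1)] by simp
  moreover have "u y = norm y" using u(3)[of y] wk[of 1] by (force intro: range_eqI[of _ _ 1])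
  ultimately show ?thesis using u(1) by blast
qed

locale separable_dual =
  fixes Y :: "'a::real_normed_vector set" and e :: "nat \<Rightarrow> 'a" and \<psi> :: "nat \<Rightarrow> 'a \<Rightarrow> real"
  assumes Y: "subspace Y"
    and eY: "\<And>n. e n \<in> Y" "\<And>n. norm (e n) \<le> 1"
    and e_dense: "\<And>y \<delta>. y \<in> Y \<Longrightarrow> norm y \<le> 1 \<Longrightarrow> 0 < \<delta> \<Longrightarrow> \<exists>n. norm (y - e n) < \<delta>"
    and \<psi>_dual: "\<And>n. \<psi> n \<in> dual_on Y"
    and \<psi>_dense: "\<And>\<phi> \<delta>. \<phi> \<in> dual_on Y \<Longrightarrow> 0 < \<delta> \<Longrightarrow> \<exists>n. \<forall>y\<in>Y. \<bar>\<phi> y - \<psi> n y\<bar> \<le> \<delta> * norm y"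
begin

abbreviation "B \<equiv> {y\<in>Y. norm y \<le> 1}"

text \<open>In \<open>Q\<close> below, the unit ball \<open>A 0\<close> bounds the maximizers, the singletons make near
  maximizers converge pointwise, and the sets on which the first \<open>\<psi> i\<close> are small upgrade this to
  convergence in norm, since modulo such a set the unit ball is finite.\<close>

definition A :: "nat \<Rightarrow> 'a set" where
  "A n = (if n = 0 then B else if odd n then {e (n div 2)}
          else {y\<in>B. \<forall>i\<le>n. \<bar>\<psi> i y\<bar> \<le> 1 / n})"

text \<open>\<open>p 0\<close> is the dual norm on Y, and \<open>p (2 * k + 1)\<close> is the
  absolute value at \<open>e k\<close>.\<close>

definition p :: "nat \<Rightarrow> ('a \<Rightarrow> real) \<Rightarrow> real" where
  "p n \<phi> = (SUP y\<in>A n. \<bar>\<phi> y\<bar>)"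

text \<open>The term n = 0 makes \<open>Q\<close> at least the squared dual norm, which keeps the
  supremum in \<open>s\<close> finite; the weights keep it below twice that square.\<close>

definition Q :: "('a \<Rightarrow> real) \<Rightarrow> real" where
  "Q \<phi> = (\<Sum>n. (1/2) ^ n * (p n \<phi>)\<^sup>2)"

definition s :: "'a \<Rightarrow> real" where
  "s y = (SUP \<phi>\<in>dual_on Y. \<phi> y - Q \<phi>)"

text \<open>The approximate maximizers for \<open>s y\<close>. That any two of them are close for
  small \<eta> yields both the existence of a maximizer and its continuous dependence on y.\<close>

definition near :: "'a \<Rightarrow> real \<Rightarrow> ('a \<Rightarrow> real) \<Rightarrow> bool" where
  "near y \<eta> \<phi> \<longleftrightarrow> \<phi> \<in> dual_on Y \<and> s y - \<eta> \<le> \<phi> y - Q \<phi>"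

section \<open>Elementary estimates for the seminorms, their quadratic sum and its conjugate\<close>

lemma dual_add: "\<phi> \<in> dual_on Y \<Longrightarrow> x \<in> Y \<Longrightarrow> y \<in> Y \<Longrightarrow> \<phi> (x + y) = \<phi> x + \<phi> y"
  by (simp add: dual_on_def linear_form_on_def)

lemma dual_scale: "\<phi> \<in> dual_on Y \<Longrightarrow> x \<in> Y \<Longrightarrow> \<phi> (c *\<^sub>R x) = c * \<phi> x"
  by (simp add: dual_on_def linear_form_on_def)

lemma dual_diff: "\<phi> \<in> dual_on Y \<Longrightarrow> x \<in> Y \<Longrightarrow> y \<in> Y \<Longrightarrow> \<phi> (x - y) = \<phi> x - \<phi> y"
  using dual_add[of \<phi> x "(-1) *\<^sub>R y"] dual_scale[of \<phi> y "-1"] subspace_neg[OF Y, of y] by simp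

lemma dual_zero: "\<phi> \<in> dual_on Y \<Longrightarrow> \<phi> 0 = 0"
  using dual_scale[of \<phi> 0 0] subspace_0[OF Y] by simp

lemma A_sub: "A n \<subseteq> B"
  using eY by (auto simp: A_def)

lemma A_ne: "A n \<noteq> {}"
proof -
  have "\<psi> i 0 = 0" for i by (rule dual_zero[OF \<psi>_dual])
  then have "0 \<in> A n \<or> e (n div 2) \<in> A n" using subspace_0[OF Y] by (auto simp: A_def)
  then show ?thesis by blast
qed

lemma p_bdd:
  assumes "\<phi> \<in> dual_on Y"
  shows "bdd_above ((\<lambda>y. \<bar>\<phi> y\<bar>) ` A n)"
proof -
  obtain K where K: "\<And>y. y \<in> Y \<Longrightarrow> \<bar>\<phi> y\<bar> \<le> K * norm y" using assms by (auto simp: dual_on_def)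
  have "\<bar>\<phi> y\<bar> \<le> \<bar>K\<bar>" if "y \<in> A n" for y
  proof -
    have y: "y \<in> Y" "norm y \<le> 1" using that A_sub by auto
    have "K * norm y \<le> \<bar>K\<bar> * norm y" by (intro mult_right_mono) auto
    also have "\<dots> \<le> \<bar>K\<bar>" using y by (simp add: mult_left_le)
    finally show ?thesis using K[OF y(1)] by simp
  qed
  then show ?thesis by (intro bdd_aboveI2)
qed

lemma p_upper: "\<phi> \<in> dual_on Y \<Longrightarrow> y \<in> A n \<Longrightarrow> \<bar>\<phi> y\<bar> \<le> p n \<phi>"
  unfolding p_def by (rule cSUP_upper[OF _ p_bdd])

lemma p_least: "(\<And>y. y \<in> A n \<Longrightarrow> \<bar>\<phi> y\<bar> \<le> b) \<Longrightarrow> p n \<phi> \<le> b"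
  unfolding p_def by (rule cSUP_least[OF A_ne])

lemma p_nonneg: "\<phi> \<in> dual_on Y \<Longrightarrow> 0 \<le> p n \<phi>"
  using A_ne[of n] p_upper[of \<phi> _ n] by (meson abs_ge_zero all_not_in_conv order_trans)

lemma p_le_p0: "\<phi> \<in> dual_on Y \<Longrightarrow> p n \<phi> \<le> p 0 \<phi>"
  by (rule p_least, rule p_upper) (use A_sub[of n] in \<open>auto simp: A_def\<close>)

lemma dual_bound:
  assumes \<phi>: "\<phi> \<in> dual_on Y" and y: "y \<in> Y"
  shows "\<bar>\<phi> y\<bar> \<le> p 0 \<phi> * norm y"
proof (cases "y = 0")
  case False
  have "(1 / norm y) *\<^sub>R y \<in> A 0" using y False Y by (simp add: A_def subspace_scale)
  then have "\<bar>\<phi> ((1 / norm y) *\<^sub>R y)\<bar> \<le> p 0 \<phi>" by (rule p_upper[OF \<phi>])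
  then show ?thesis using False by (simp add: dual_scale[OF \<phi> y] abs_mult field_simps)
qed (simp add: dual_zero[OF \<phi>])

lemma Q_term_le: "\<phi> \<in> dual_on Y \<Longrightarrow> (1/2) ^ n * (p n \<phi>)\<^sup>2 \<le> (p 0 \<phi>)\<^sup>2 * (1/2) ^ n"
  using p_le_p0[of \<phi> n] p_nonneg[of \<phi> n] by (simp add: power_mono mult.commute)

lemma geometric_half_sums: "(\<lambda>n. c * (1/2::real) ^ n) sums (2 * c)"
  using sums_mult[OF geometric_sums[of "1/2::real"], of c] by (simp add: mult.commute)

lemma Q_summable: "\<phi> \<in> dual_on Y \<Longrightarrow> summable (\<lambda>n. (1/2) ^ n * (p n \<phi>)\<^sup>2)"
  by (rule summable_comparison_test'[OF sums_summable[OF geometric_half_sums[of "(p 0 \<phi>)\<^sup>2"]], of 0])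
     (use Q_term_le in auto)

lemma Q_le: "\<phi> \<in> dual_on Y \<Longrightarrow> Q \<phi> \<le> 2 * (p 0 \<phi>)\<^sup>2"
  unfolding Q_def sums_unique[OF geometric_half_sums[of "(p 0 \<phi>)\<^sup>2"]]
  by (intro suminf_le Q_term_le Q_summable sums_summable[OF geometric_half_sums])

lemma Q_partial: "\<phi> \<in> dual_on Y \<Longrightarrow> (\<Sum>n<m. (1/2) ^ n * (p n \<phi>)\<^sup>2) \<le> Q \<phi>"
  unfolding Q_def by (intro sum_le_suminf Q_summable) auto

lemma Q_ge: "\<phi> \<in> dual_on Y \<Longrightarrow> (p 0 \<phi>)\<^sup>2 \<le> Q \<phi>"
  using Q_partial[of \<phi> 1] by simp

lemma s_bdd:
  assumes "y \<in> Y"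
  shows "bdd_above ((\<lambda>\<phi>. \<phi> y - Q \<phi>) ` dual_on Y)"
proof (rule bdd_aboveI2)
  fix \<phi> assume \<phi>: "\<phi> \<in> dual_on Y"
  have "0 \<le> (p 0 \<phi> - norm y)\<^sup>2 + (norm y)\<^sup>2 + (p 0 \<phi>)\<^sup>2" by simp
  then have "p 0 \<phi> * norm y - (p 0 \<phi>)\<^sup>2 \<le> (norm y)\<^sup>2"
    by (simp add: power2_eq_square algebra_simps)
  then show "\<phi> y - Q \<phi> \<le> (norm y)\<^sup>2" using dual_bound[OF \<phi> assms] Q_ge[OF \<phi>] by linarith
qed

lemma s_upper: "y \<in> Y \<Longrightarrow> \<phi> \<in> dual_on Y \<Longrightarrow> \<phi> y - Q \<phi> \<le> s y"
  unfolding s_def by (rule cSUP_upper[OF _ s_bdd])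

lemma zero_dual: "(\<lambda>y. 0) \<in> dual_on Y"
  by (auto simp: dual_on_def linear_form_on_def intro: exI[of _ 0])

lemma near_exists:
  assumes "y \<in> Y" "0 < \<eta>"
  shows "\<exists>\<phi>. near y \<eta> \<phi>"
proof (rule ccontr)
  assume "\<not> ?thesis"
  then have "\<phi> y - Q \<phi> \<le> s y - \<eta>" if "\<phi> \<in> dual_on Y" for \<phi>
    using that by (auto simp: near_def)
  then have "s y \<le> s y - \<eta>"
    using zero_dual unfolding s_def[of y] by (intro cSUP_least) auto
  then show False using assms by simp
qed

lemma near_mono: "near y \<eta> \<phi> \<Longrightarrow> \<eta> \<le> \<eta>' \<Longrightarrow> near y \<eta>' \<phi>"
  by (auto simp: near_def)

lemma s_nonneg: "y \<in> Y \<Longrightarrow> 0 \<le> s y"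
proof -
  assume "y \<in> Y"
  have "p n (\<lambda>y. 0) = 0" for n using A_ne[of n] by (simp add: p_def)
  then have "Q (\<lambda>y. 0) = 0" by (simp add: Q_def)
  then show ?thesis using s_upper[OF \<open>y \<in> Y\<close> zero_dual] by simp
qed

section \<open>Uniform convexity: approximate maximizers are close to each other\<close>

definition mid :: "('a \<Rightarrow> real) \<Rightarrow> ('a \<Rightarrow> real) \<Rightarrow> 'a \<Rightarrow> real" where
  "mid \<phi> \<xi> y = (\<phi> y + \<xi> y) / 2"

lemma mid_dual:
  assumes \<phi>: "\<phi> \<in> dual_on Y" and \<xi>: "\<xi> \<in> dual_on Y"
  shows "mid \<phi> \<xi> \<in> dual_on Y"
proof -
  have "\<bar>mid \<phi> \<xi> y\<bar> \<le> (p 0 \<phi> + p 0 \<xi>) * norm y" if "y \<in> Y" for y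
  proof -
    have "\<bar>mid \<phi> \<xi> y\<bar> \<le> \<bar>\<phi> y\<bar> + \<bar>\<xi> y\<bar>" by (simp add: mid_def)
    then show ?thesis using dual_bound[OF \<phi> that] dual_bound[OF \<xi> that] by (simp add: algebra_simps)
  qed
  then have "\<exists>K. \<forall>y\<in>Y. \<bar>mid \<phi> \<xi> y\<bar> \<le> K * norm y" by blast
  moreover have "linear_form_on Y (mid \<phi> \<xi>)"
    using dual_add[OF \<phi>] dual_add[OF \<xi>] dual_scale[OF \<phi>] dual_scale[OF \<xi>]
    by (auto simp: linear_form_on_def mid_def field_simps)
  ultimately show ?thesis by (simp add: dual_on_def)
qed

text \<open>The midpoint convexity defect of the squared seminorm \<open>p n\<close>.\<close>

definition gap :: "nat \<Rightarrow> ('a \<Rightarrow> real) \<Rightarrow> ('a \<Rightarrow> real) \<Rightarrow> real" where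
  "gap n \<phi> \<xi> = ((p n \<phi>)\<^sup>2 + (p n \<xi>)\<^sup>2) / 2 - (p n (mid \<phi> \<xi>))\<^sup>2"

lemma gap_ge:
  assumes \<phi>: "\<phi> \<in> dual_on Y" and \<xi>: "\<xi> \<in> dual_on Y"
  shows "((p n \<phi> - p n \<xi>) / 2)\<^sup>2 \<le> gap n \<phi> \<xi>"
proof -
  have "p n (mid \<phi> \<xi>) \<le> (p n \<phi> + p n \<xi>) / 2"
  proof (rule p_least)
    fix y assume "y \<in> A n"
    then show "\<bar>mid \<phi> \<xi> y\<bar> \<le> (p n \<phi> + p n \<xi>) / 2"
      using p_upper[OF \<phi>, of y n] p_upper[OF \<xi>, of y n] by (simp add: mid_def)
  qed
  then have "(p n (mid \<phi> \<xi>))\<^sup>2 \<le> ((p n \<phi> + p n \<xi>) / 2)\<^sup>2"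
    using p_nonneg[OF mid_dual[OF \<phi> \<xi>]] by (rule power_mono)
  then show ?thesis unfolding gap_def by (simp add: power2_eq_square field_simps)
qed

text \<open>On a singleton the parallelogram identity is exact and sees the difference of the two
  values; \<open>gap_ge\<close> would only compare their absolute values.\<close>

lemma gap_point:
  assumes \<phi>: "\<phi> \<in> dual_on Y" and \<xi>: "\<xi> \<in> dual_on Y"
  shows "gap (2 * k + 1) \<phi> \<xi> = ((\<phi> (e k) - \<xi> (e k)) / 2)\<^sup>2"
proof -
  have "p (2 * k + 1) \<theta> = \<bar>\<theta> (e k)\<bar>" for \<theta> by (simp add: p_def A_def)
  then show ?thesis by (simp add: gap_def mid_def power2_eq_square field_simps)
qed

text \<open>The midpoint competes in the supremum, so the weighted sum of all gaps is at most
  \<eta>. All gaps are nonnegative, so each single one is controlled after dividing by its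
  weight.\<close>

lemma near_gap:
  assumes y: "y \<in> Y" and \<phi>: "near y \<eta> \<phi>" and \<xi>: "near y \<eta> \<xi>"
  shows "gap n \<phi> \<xi> \<le> 2 ^ n * \<eta>"
proof -
  have d: "\<phi> \<in> dual_on Y" "\<xi> \<in> dual_on Y" using \<phi> \<xi> by (auto simp: near_def)
  note d' = mid_dual[OF d]
  define t where "t n = (1/2) ^ n * gap n \<phi> \<xi>" for n
  have t: "t n = ((1/2) ^ n * (p n \<phi>)\<^sup>2 + (1/2) ^ n * (p n \<xi>)\<^sup>2) / 2 - (1/2) ^ n * (p n (mid \<phi> \<xi>))\<^sup>2" for n
    by (simp add: t_def gap_def field_simps)
  have t0: "0 \<le> t n" for n
    using gap_ge[OF d, of n] zero_le_power2[of "(p n \<phi> - p n \<xi>) / 2"] unfolding t_def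
    by (intro mult_nonneg_nonneg) (simp, linarith)
  have "t sums ((Q \<phi> + Q \<xi>) / 2 - Q (mid \<phi> \<xi>))"
    unfolding t Q_def
    by (intro sums_diff sums_divide sums_add summable_sums Q_summable d d')
  then have "t n \<le> (Q \<phi> + Q \<xi>) / 2 - Q (mid \<phi> \<xi>)"
    using sum_le_suminf[of t "{n}"] t0 by (simp add: sums_iff)
  also have "\<dots> \<le> \<eta>"
    using s_upper[OF y d'] \<phi> \<xi> unfolding near_def mid_def[of _ _ y] by argo
  finally show ?thesis by (simp add: t_def field_simps)
qed

text \<open>Comparison with the zero functional, whose value is 0, bounds p (p - norm y) by 1 for p
  = \<open>p 0 \<phi>\<close>; this fails once p exceeds norm y + 1.\<close>

lemma near_bound:
  assumes y: "y \<in> Y" and \<phi>: "near y 1 \<phi>"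
  shows "p 0 \<phi> \<le> norm y + 1"
proof (rule ccontr)
  assume no: "\<not> ?thesis"
  then have "(norm y + 1) * (p 0 \<phi> - norm y) < p 0 \<phi> * (p 0 \<phi> - norm y)"
    by (intro mult_strict_right_mono) auto
  moreover have "1 * 1 \<le> (norm y + 1) * (p 0 \<phi> - norm y)"
    using no by (intro mult_mono) auto
  moreover have d: "\<phi> \<in> dual_on Y" using \<phi> by (simp add: near_def)
  then have "(p 0 \<phi>)\<^sup>2 - p 0 \<phi> * norm y \<le> 1"
    using \<phi> s_nonneg[OF y] dual_bound[OF d y] Q_ge[OF d] by (simp add: near_def)
  ultimately show False by (simp add: power2_eq_square algebra_simps)
qed

lemma near_seminorm:
  assumes y: "y \<in> Y" and \<epsilon>: "0 < \<epsilon>"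
  shows "\<exists>\<eta>>0. \<forall>\<phi> \<xi>. near y \<eta> \<phi> \<longrightarrow> near y \<eta> \<xi> \<longrightarrow> \<bar>p n \<phi> - p n \<xi>\<bar> \<le> \<epsilon>"
proof (intro exI[of _ "(\<epsilon> / 2)\<^sup>2 / 2 ^ n"] conjI allI impI)
  fix \<phi> \<xi> assume n: "near y ((\<epsilon> / 2)\<^sup>2 / 2 ^ n) \<phi>" "near y ((\<epsilon> / 2)\<^sup>2 / 2 ^ n) \<xi>"
  then have "((p n \<phi> - p n \<xi>) / 2)\<^sup>2 \<le> (\<epsilon> / 2)\<^sup>2"
    using near_gap[OF y n, of n] gap_ge[of \<phi> \<xi> n] by (simp add: near_def)
  then have "\<bar>(p n \<phi> - p n \<xi>) / 2\<bar> \<le> \<epsilon> / 2" by (rule power2_le_iff_abs_le[THEN iffD1, rotated]) (use \<epsilon> in simp)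
  then show "\<bar>p n \<phi> - p n \<xi>\<bar> \<le> \<epsilon>" by simp
qed (use \<epsilon> in simp)

text \<open>At the dense points \<open>e k\<close> the gap gives the estimate directly. The uniform
  bound on the dual norms of approximate maximizers carries it to the whole unit ball, and scaling
  to all of Y.\<close>

lemma near_pointwise:
  assumes y: "y \<in> Y" and x: "x \<in> Y" and \<epsilon>: "0 < \<epsilon>"
  shows "\<exists>\<eta>>0. \<forall>\<phi> \<xi>. near y \<eta> \<phi> \<longrightarrow> near y \<eta> \<xi> \<longrightarrow> \<bar>\<phi> x - \<xi> x\<bar> \<le> \<epsilon>"
proof -
  have 1: "\<exists>\<eta>>0. \<forall>\<phi> \<xi>. near y \<eta> \<phi> \<longrightarrow> near y \<eta> \<xi> \<longrightarrow> \<bar>\<phi> x - \<xi> x\<bar> \<le> \<epsilon>"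
    if x: "x \<in> Y" "norm x \<le> 1" and \<epsilon>: "0 < \<epsilon>" for x \<epsilon>
  proof -
    define M where "M = norm y + 1"
    have M: "M > 0" by (simp add: M_def add_nonneg_pos)
    obtain k where k: "norm (x - e k) < \<epsilon> / (4 * M)" using e_dense[OF x] M \<epsilon> by (meson divide_pos_pos mult_pos_pos zero_less_numeral)
    \<comment> \<open>The errors add up to \<epsilon>/2 at \<open>e k\<close> and \<epsilon>/4 for
      each functional; the cap 1 makes \<open>near_bound\<close> applicable.\<close>
    define \<eta> where "\<eta> = min 1 ((\<epsilon> / 4)\<^sup>2 / 2 ^ (2 * k + 1))"
    have "\<bar>\<phi> x - \<xi> x\<bar> \<le> \<epsilon>" if n: "near y \<eta> \<phi>" "near y \<eta> \<xi>" for \<phi> \<xi>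
    proof -
      have d: "\<phi> \<in> dual_on Y" "\<xi> \<in> dual_on Y" using n by (auto simp: near_def)
      have "gap (2 * k + 1) \<phi> \<xi> \<le> 2 ^ (2 * k + 1) * \<eta>" by (rule near_gap[OF y n])
      also have "\<dots> \<le> 2 ^ (2 * k + 1) * ((\<epsilon> / 4)\<^sup>2 / 2 ^ (2 * k + 1))"
        by (intro mult_left_mono) (auto simp: \<eta>_def)
      also have "\<dots> = (\<epsilon> / 4)\<^sup>2" by simp
      finally have "((\<phi> (e k) - \<xi> (e k)) / 2)\<^sup>2 \<le> (\<epsilon> / 4)\<^sup>2" unfolding gap_point[OF d] .
      then have "\<bar>(\<phi> (e k) - \<xi> (e k)) / 2\<bar> \<le> \<epsilon> / 4" by (rule power2_le_iff_abs_le[THEN iffD1, rotated]) (use \<epsilon> in simp)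
      then have e: "\<bar>\<phi> (e k) - \<xi> (e k)\<bar> \<le> \<epsilon> / 2" by simp
      have "\<bar>\<theta> x - \<theta> (e k)\<bar> \<le> \<epsilon> / 4" if "near y \<eta> \<theta>" for \<theta>
      proof -
        have d: "\<theta> \<in> dual_on Y" using that by (simp add: near_def)
        have "\<bar>\<theta> x - \<theta> (e k)\<bar> \<le> p 0 \<theta> * norm (x - e k)"
          using dual_bound[OF d subspace_diff[OF Y x(1) eY(1)]] dual_diff[OF d x(1) eY(1)] by simp
        also have "\<dots> \<le> M * (\<epsilon> / (4 * M))"
        proof (intro mult_mono)
          have "near y 1 \<theta>" using that by (rule near_mono) (simp add: \<eta>_def)
          then show "p 0 \<theta> \<le> M" unfolding M_def by (rule near_bound[OF y])
        qed (use k M p_nonneg[OF d] in auto)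
        finally show ?thesis using M by simp
      qed
      from this[OF n(1)] this[OF n(2)] e show ?thesis by linarith
    qed
    moreover have "\<eta> > 0" using \<epsilon> by (simp add: \<eta>_def)
    ultimately show ?thesis by blast
  qed
  define c where "c = norm x + 1"
  have c: "c > 0" by (simp add: c_def add_nonneg_pos)
  have x': "(1 / c) *\<^sub>R x \<in> Y" "norm ((1 / c) *\<^sub>R x) \<le> 1"
    using x c Y by (auto simp: subspace_scale) (simp add: c_def)
  obtain \<eta> where \<eta>: "\<eta> > 0" "\<And>\<phi> \<xi>. near y \<eta> \<phi> \<Longrightarrow> near y \<eta> \<xi> \<Longrightarrow>
      \<bar>\<phi> ((1 / c) *\<^sub>R x) - \<xi> ((1 / c) *\<^sub>R x)\<bar> \<le> \<epsilon> / c"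
    using 1[OF x', of "\<epsilon> / c"] \<epsilon> c by (metis divide_pos_pos)
  have "\<bar>\<phi> x - \<xi> x\<bar> \<le> \<epsilon>" if n: "near y \<eta> \<phi>" "near y \<eta> \<xi>" for \<phi> \<xi>
  proof -
    have "\<theta> ((1 / c) *\<^sub>R x) = \<theta> x / c" if "near y \<eta> \<theta>" for \<theta>
      using that dual_scale[OF _ x, of \<theta> "1 / c"] by (simp add: near_def)
    then have "\<bar>\<phi> x / c - \<xi> x / c\<bar> \<le> \<epsilon> / c" using \<eta>(2)[OF n] n by simp
    then show ?thesis using c by (simp add: diff_divide_distrib[symmetric] abs_divide divide_le_cancel)
  qed
  then show ?thesis using \<eta>(1) by blast
qed

text \<open>The exact maximizer \<phi> is within \<delta> of some \<psi> i, hence small on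
  \<open>A n\<close> for large even n, and closeness of \<open>p n\<close> makes an approximate
  maximizer small there too. On finitely many representatives of the ball modulo \<open>A n\<close>,
  pointwise closeness takes over.\<close>

lemma near_norm:
  assumes y: "y \<in> Y" and \<phi>: "\<And>\<eta>. 0 < \<eta> \<Longrightarrow> near y \<eta> \<phi>" and \<epsilon>: "0 < \<epsilon>"
  shows "\<exists>\<eta>>0. \<forall>\<xi>. near y \<eta> \<xi> \<longrightarrow> (\<forall>x\<in>Y. \<bar>\<xi> x - \<phi> x\<bar> \<le> \<epsilon> * norm x)"
proof -
  \<comment> \<open>The final estimate collects 2 * 3\<delta> and 2 * 2\<delta> from the
    half-difference in \<open>A n\<close>, and \<delta> from the representative.\<close>
  define \<delta> where "\<delta> = \<epsilon> / 11"
  have \<delta>: "\<delta> > 0" using \<epsilon> by (simp add: \<delta>_def)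
  have \<phi>d: "\<phi> \<in> dual_on Y" using \<phi>[of 1] by (simp add: near_def)
  obtain i where i: "\<And>x. x \<in> Y \<Longrightarrow> \<bar>\<phi> x - \<psi> i x\<bar> \<le> \<delta> * norm x" using \<psi>_dense[OF \<phi>d \<delta>] by blast
  obtain m where m: "1 / Suc m < \<delta>" using \<delta> nat_approx_posE by blast
  \<comment> \<open>Even, so that \<open>A n\<close> is of the third kind; at least i, so that
    \<psi> i is among its constraints; at least m + 1, so that 1/n \<le> \<delta>.\<close>
  define n where "n = 2 * (Suc (i + m))"
  have n: "n > 0" "even n" "i \<le> n" by (auto simp: n_def)
  have "1 / real n \<le> 1 / Suc m" by (intro divide_left_mono) (auto simp: n_def)
  then have n1: "1 / real n \<le> \<delta>" using m by simp
  have An: "A n = {y\<in>B. \<forall>i\<le>n. \<bar>\<psi> i y\<bar> \<le> 1 / n}" using n by (simp add: A_def)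
  have pn: "p n \<phi> \<le> 2 * \<delta>"
  proof (rule p_least)
    fix x assume "x \<in> A n"
    then have x: "x \<in> Y" "norm x \<le> 1" "\<bar>\<psi> i x\<bar> \<le> 1 / n" using n An by auto
    have "\<bar>\<phi> x - \<psi> i x\<bar> \<le> \<delta>" using i[OF x(1)] mult_left_le[of "norm x" \<delta>] x(2) \<delta> by linarith
    then show "\<bar>\<phi> x\<bar> \<le> 2 * \<delta>" using x(3) n1 by linarith
  qed
  \<comment> \<open>Rounding the scaled values of the first functionals assigns one of finitely many
    codes to each point of the ball; points with equal codes differ by twice an element of
    \<open>A n\<close>.\<close>
  define \<kappa> where "\<kappa> x = restrict (\<lambda>i. \<lfloor>n * \<psi> i x\<rfloor>) {..n}" for x
  define b where "b i = \<lceil>n * p 0 (\<psi> i)\<rceil>" for i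
  have "\<kappa> ` B \<subseteq> PiE {..n} (\<lambda>i. {- b i - 1 .. b i})"
  proof (intro image_subsetI PiE_I)
    fix x i assume x: "x \<in> B"
    have "\<bar>\<psi> i x\<bar> \<le> p 0 (\<psi> i)" using x by (intro p_upper \<psi>_dual) (simp add: A_def)
    then have "n * \<psi> i x \<le> n * p 0 (\<psi> i)" "- (n * p 0 (\<psi> i)) \<le> n * \<psi> i x"
      using mult_left_mono[of "\<psi> i x" "p 0 (\<psi> i)" n] mult_left_mono[of "- p 0 (\<psi> i)" "\<psi> i x" n]
      by auto
    then have "\<lfloor>n * \<psi> i x\<rfloor> \<le> b i" "- b i - 1 \<le> \<lfloor>n * \<psi> i x\<rfloor>"
      unfolding b_def by linarith+
    moreover assume "i \<in> {..n}"
    ultimately show "\<kappa> x i \<in> {- b i - 1 .. b i}" by (simp add: \<kappa>_def)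
  qed (simp add: \<kappa>_def)
  then have "finite (\<kappa> ` B)" by (rule finite_subset) (simp add: finite_PiE)
  then obtain R where R: "R \<subseteq> B" "finite R" "\<kappa> ` B = \<kappa> ` R"
    using finite_subset_image[of "\<kappa> ` B" \<kappa> B] by auto
  have "\<exists>\<eta>>0. \<forall>\<xi>. near y \<eta> \<xi> \<longrightarrow> (\<forall>x\<in>R. \<bar>\<xi> x - \<phi> x\<bar> \<le> \<delta>)"
    using R(2,1)
  proof (induction R rule: finite_induct)
    case empty then show ?case by (intro exI[of _ 1]) simp
  next
    case (insert x R)
    then obtain \<eta>1 where \<eta>1: "\<eta>1 > 0" "\<And>\<xi> x. near y \<eta>1 \<xi> \<Longrightarrow> x \<in> R \<Longrightarrow> \<bar>\<xi> x - \<phi> x\<bar> \<le> \<delta>" by auto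
    have "x \<in> Y" using insert by auto
    from near_pointwise[OF y this \<delta>] obtain \<eta>2 where \<eta>2: "\<eta>2 > 0"
      "\<And>\<xi> \<phi>. near y \<eta>2 \<xi> \<Longrightarrow> near y \<eta>2 \<phi> \<Longrightarrow> \<bar>\<xi> x - \<phi> x\<bar> \<le> \<delta>" by blast
    have "\<forall>x'\<in>insert x R. \<bar>\<xi> x' - \<phi> x'\<bar> \<le> \<delta>" if "near y (min \<eta>1 \<eta>2) \<xi>" for \<xi>
    proof -
      have "near y \<eta>1 \<xi>" "near y \<eta>2 \<xi>" using that by (auto elim: near_mono)
      then show ?thesis using \<eta>1(2) \<eta>2(2)[OF _ \<phi>[OF \<eta>2(1)]] by blast
    qed
    then show ?case using \<eta>1(1) \<eta>2(1) by (intro exI[of _ "min \<eta>1 \<eta>2"]) simp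
  qed
  then obtain \<eta>1 where \<eta>1: "\<eta>1 > 0" "\<And>\<xi> x. near y \<eta>1 \<xi> \<Longrightarrow> x \<in> R \<Longrightarrow> \<bar>\<xi> x - \<phi> x\<bar> \<le> \<delta>" by blast
  obtain \<eta>2 where \<eta>2: "\<eta>2 > 0" "\<And>\<xi> \<phi>. near y \<eta>2 \<xi> \<Longrightarrow> near y \<eta>2 \<phi> \<Longrightarrow> \<bar>p n \<xi> - p n \<phi>\<bar> \<le> \<delta>"
    using near_seminorm[OF y \<delta>] by blast
  have main: "\<bar>\<xi> x - \<phi> x\<bar> \<le> \<epsilon> * norm x" if near: "near y (min \<eta>1 \<eta>2) \<xi>" and x: "x \<in> Y" for \<xi> x
  proof -
    have n12: "near y \<eta>1 \<xi>" "near y \<eta>2 \<xi>" using near by (auto elim: near_mono)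
    have \<xi>d: "\<xi> \<in> dual_on Y" using near by (simp add: near_def)
    have p\<xi>: "p n \<xi> \<le> 3 * \<delta>" using \<eta>2(2)[OF n12(2) \<phi>[OF \<eta>2(1)]] pn by linarith
    have ball: "\<bar>\<xi> z - \<phi> z\<bar> \<le> \<epsilon>" if z: "z \<in> B" for z
    proof -
      have "\<kappa> z \<in> \<kappa> ` R" using z R(3) by blast
      then obtain z' where z': "z' \<in> R" "\<kappa> z = \<kappa> z'" by blast
      then have z'B: "z' \<in> B" using R(1) by blast
      have zY: "z \<in> Y" "z' \<in> Y" using z z'B by auto
      define h where "h = (1/2) *\<^sub>R (z - z')"
      have hY: "h \<in> Y" unfolding h_def using zY Y by (intro subspace_scale subspace_diff)
      have hev: "\<theta> h = (\<theta> z - \<theta> z') / 2" if "\<theta> \<in> dual_on Y" for \<theta>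
        unfolding h_def using dual_scale[OF that subspace_diff[OF Y zY], of "1/2"] dual_diff[OF that zY]
        by simp
      have "norm h \<le> 1" unfolding h_def using norm_triangle_ineq4[of z z'] z z'B by simp
      moreover have "\<bar>\<psi> i h\<bar> \<le> 1 / n" if "i \<le> n" for i
      proof -
        have "\<lfloor>n * \<psi> i z\<rfloor> = \<lfloor>n * \<psi> i z'\<rfloor>" using fun_cong[OF z'(2), of i] that by (simp add: \<kappa>_def)
        then have "\<bar>n * \<psi> i z - n * \<psi> i z'\<bar> \<le> 1" by linarith
        moreover have "n * \<psi> i z - n * \<psi> i z' = 2 * (n * \<psi> i h)"
          unfolding hev[OF \<psi>_dual] by (simp add: algebra_simps)
        ultimately have "\<bar>n * \<psi> i h\<bar> \<le> 1" by linarith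
        then show ?thesis using n(1) by (simp add: abs_mult field_simps)
      qed
      ultimately have "h \<in> A n" using hY by (simp add: An)
      then have "\<bar>\<xi> h\<bar> \<le> 3 * \<delta>" "\<bar>\<phi> h\<bar> \<le> 2 * \<delta>"
        using p_upper[OF \<xi>d, of h n] p_upper[OF \<phi>d, of h n] p\<xi> pn by linarith+
      moreover have "\<bar>\<xi> z' - \<phi> z'\<bar> \<le> \<delta>" by (rule \<eta>1(2)[OF n12(1) z'(1)])
      moreover have "\<xi> z - \<xi> z' = 2 * \<xi> h" "\<phi> z - \<phi> z' = 2 * \<phi> h"
        using hev[OF \<xi>d] hev[OF \<phi>d] by simp_all
      ultimately have "\<bar>\<xi> z - \<phi> z\<bar> \<le> 11 * \<delta>" by linarith
      then show ?thesis by (simp add: \<delta>_def)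
    qed
    show ?thesis
    proof (cases "x = 0")
      case True then show ?thesis using dual_zero[OF \<xi>d] dual_zero[OF \<phi>d] by simp
    next
      case False
      have "(1 / norm x) *\<^sub>R x \<in> B" using x False Y by (simp add: subspace_scale)
      from ball[OF this] have "\<bar>\<xi> x / norm x - \<phi> x / norm x\<bar> \<le> \<epsilon>"
        using dual_scale[OF \<xi>d x, of "1 / norm x"] dual_scale[OF \<phi>d x, of "1 / norm x"] by simp
      then show ?thesis using False
        by (simp add: diff_divide_distrib[symmetric] abs_divide divide_le_eq)
    qed
  qed
  then show ?thesis using \<eta>1(1) \<eta>2(1) by (intro exI[of _ "min \<eta>1 \<eta>2"]) simp
qed

text \<open>A maximizing sequence is pointwise Cauchy, and so are its seminorms. Each
  \<open>p n\<close> of the pointwise limit is at most the limit of the seminorms, so finite partial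
  sums show that \<open>Q\<close> does not jump up and the supremum is attained.\<close>

lemma maximizer_exists:
  assumes y: "y \<in> Y"
  shows "\<exists>\<phi>\<in>dual_on Y. s y = \<phi> y - Q \<phi>"
proof -
  have "\<exists>\<phi>. near y (1 / Suc k) \<phi>" for k by (rule near_exists[OF y]) simp
  then obtain F where F: "\<And>k. near y (1 / Suc k) (F k)" by metis
  have Fn: "near y \<eta> (F k)" if "1 / Suc m < \<eta>" "m \<le> k" for \<eta> k m
  proof (rule near_mono[OF F])
    have "1 / real (Suc k) \<le> 1 / real (Suc m)" using that by (intro divide_left_mono) auto
    then show "1 / Suc k \<le> \<eta>" using that by simp
  qed
  have ev: "\<exists>m. \<forall>k\<ge>m. near y \<eta> (F k)" if "\<eta> > 0" for \<eta>
    using nat_approx_posE[OF that] Fn by metis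
  have Fd: "F k \<in> dual_on Y" for k using F by (simp add: near_def)
  have F1: "near y 1 (F k)" for k by (rule near_mono[OF F]) simp
  have conv: "convergent (\<lambda>k. F k x)" if x: "x \<in> Y" for x
  proof (rule Cauchy_convergent, rule metric_CauchyI)
    fix \<epsilon> :: real assume "0 < \<epsilon>"
    then obtain \<eta> where \<eta>: "\<eta> > 0" "\<And>\<phi> \<xi>. near y \<eta> \<phi> \<Longrightarrow> near y \<eta> \<xi> \<Longrightarrow> \<bar>\<phi> x - \<xi> x\<bar> \<le> \<epsilon> / 2"
      using near_pointwise[OF y x, of "\<epsilon> / 2"] by auto
    obtain m where m: "\<And>k. k \<ge> m \<Longrightarrow> near y \<eta> (F k)" using ev[OF \<eta>(1)] by blast
    have "dist (F k x) (F l x) < \<epsilon>" if "k \<ge> m" "l \<ge> m" for k l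
      using \<eta>(2)[OF m[OF that(1)] m[OF that(2)]] \<open>0 < \<epsilon>\<close> by (simp add: dist_real_def)
    then show "\<exists>M. \<forall>m\<ge>M. \<forall>n\<ge>M. dist (F m x) (F n x) < \<epsilon>" by blast
  qed
  define \<phi> where "\<phi> x = lim (\<lambda>k. F k x)" for x
  have \<phi>: "(\<lambda>k. F k x) \<longlonglongrightarrow> \<phi> x" if "x \<in> Y" for x
    using conv[OF that] by (simp add: convergent_LIMSEQ_iff \<phi>_def)
  have "\<phi> (x + z) = \<phi> x + \<phi> z" if xz: "x \<in> Y" "z \<in> Y" for x z
  proof (rule LIMSEQ_unique[OF \<phi>[OF subspace_add[OF Y xz]]])
    show "(\<lambda>k. F k (x + z)) \<longlonglongrightarrow> \<phi> x + \<phi> z"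
      unfolding dual_add[OF Fd xz] by (intro tendsto_add \<phi> xz)
  qed
  moreover have "\<phi> (c *\<^sub>R x) = c * \<phi> x" if x: "x \<in> Y" for x c
  proof (rule LIMSEQ_unique[OF \<phi>[OF subspace_scale[OF Y x]]])
    show "(\<lambda>k. F k (c *\<^sub>R x)) \<longlonglongrightarrow> c * \<phi> x"
      unfolding dual_scale[OF Fd x] by (intro tendsto_mult tendsto_const \<phi> x)
  qed
  moreover have "\<bar>\<phi> x\<bar> \<le> (norm y + 1) * norm x" if x: "x \<in> Y" for x
  proof (rule LIMSEQ_le_const2[OF tendsto_rabs[OF \<phi>[OF x]]], intro exI allI impI)
    fix k show "\<bar>F k x\<bar> \<le> (norm y + 1) * norm x"
      using dual_bound[OF Fd x, of k] near_bound[OF y F1, of k] mult_right_mono norm_ge_zero order_trans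
      by metis
  qed
  ultimately have \<phi>d: "\<phi> \<in> dual_on Y"
    unfolding dual_on_def linear_form_on_def mem_Collect_eq by blast
  have pconv: "convergent (\<lambda>k. p n (F k))" for n
  proof (rule Cauchy_convergent, rule metric_CauchyI)
    fix \<epsilon> :: real assume "0 < \<epsilon>"
    then have "0 < \<epsilon> / 2" by simp
    then obtain \<eta> where \<eta>: "\<eta> > 0" "\<And>\<phi> \<xi>. near y \<eta> \<phi> \<Longrightarrow> near y \<eta> \<xi> \<Longrightarrow> \<bar>p n \<phi> - p n \<xi>\<bar> \<le> \<epsilon> / 2"
      using near_seminorm[OF y] by blast
    obtain m where m: "\<And>k. k \<ge> m \<Longrightarrow> near y \<eta> (F k)" using ev[OF \<eta>(1)] by blast
    have "dist (p n (F k)) (p n (F l)) < \<epsilon>" if "k \<ge> m" "l \<ge> m" for k l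
      using \<eta>(2)[OF m[OF that(1)] m[OF that(2)]] \<open>0 < \<epsilon>\<close> by (simp add: dist_real_def)
    then show "\<exists>M. \<forall>k\<ge>M. \<forall>l\<ge>M. dist (p n (F k)) (p n (F l)) < \<epsilon>" by blast
  qed
  define \<pi> where "\<pi> n = lim (\<lambda>k. p n (F k))" for n
  have \<pi>: "(\<lambda>k. p n (F k)) \<longlonglongrightarrow> \<pi> n" for n
    using pconv[of n] by (simp add: convergent_LIMSEQ_iff \<pi>_def)
  have p\<pi>: "p n \<phi> \<le> \<pi> n" for n
  proof (rule p_least)
    fix x assume x: "x \<in> A n"
    then have "x \<in> Y" using A_sub by blast
    show "\<bar>\<phi> x\<bar> \<le> \<pi> n"
      by (rule LIMSEQ_le[OF tendsto_rabs[OF \<phi>[OF \<open>x \<in> Y\<close>]] \<pi>]) (use p_upper[OF Fd x] in blast)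
  qed
  have "(\<Sum>n<m. (1/2) ^ n * (\<pi> n)\<^sup>2) \<le> \<phi> y - s y" for m
  proof (rule LIMSEQ_le)
    show "(\<lambda>k. \<Sum>n<m. (1/2) ^ n * (p n (F k))\<^sup>2) \<longlonglongrightarrow> (\<Sum>n<m. (1/2) ^ n * (\<pi> n)\<^sup>2)"
      by (intro tendsto_intros \<pi>)
    have "(\<lambda>k. F k y - s y + 1 / Suc k) \<longlonglongrightarrow> \<phi> y - s y + 0"
      by (intro tendsto_intros \<phi> y LIMSEQ_Suc[OF lim_1_over_n])
    then show "(\<lambda>k. F k y - s y + 1 / Suc k) \<longlonglongrightarrow> \<phi> y - s y" by simp
    have "(\<Sum>n<m. (1/2) ^ n * (p n (F k))\<^sup>2) \<le> F k y - s y + 1 / Suc k" for k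
      using Q_partial[OF Fd[of k], of m] F[of k] by (simp add: near_def)
    then show "\<exists>N. \<forall>k\<ge>N. (\<Sum>n<m. (1/2) ^ n * (p n (F k))\<^sup>2) \<le> F k y - s y + 1 / Suc k" by blast
  qed
  moreover have "(\<Sum>n<m. (1/2) ^ n * (p n \<phi>)\<^sup>2) \<le> (\<Sum>n<m. (1/2) ^ n * (\<pi> n)\<^sup>2)" for m
    by (intro sum_mono mult_left_mono power_mono p\<pi> p_nonneg \<phi>d) simp
  ultimately have "Q \<phi> \<le> \<phi> y - s y"
    unfolding Q_def by (intro suminf_le_const Q_summable \<phi>d) (meson order_trans)
  then show ?thesis using s_upper[OF y \<phi>d] \<phi>d by (intro bexI[of _ \<phi>]) auto
qed

section \<open>The maximizer as the gradient of the conjugate\<close>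

definition g :: "'a \<Rightarrow> 'a \<Rightarrow> real" where
  "g y = (SOME \<phi>. \<phi> \<in> dual_on Y \<and> s y = \<phi> y - Q \<phi>)"

lemma g:
  assumes "y \<in> Y"
  shows "g y \<in> dual_on Y" "s y = g y y - Q (g y)"
proof -
  have "\<exists>\<phi>. \<phi> \<in> dual_on Y \<and> s y = \<phi> y - Q \<phi>" using maximizer_exists[OF assms] by blast
  from someI_ex[OF this] show "g y \<in> dual_on Y" "s y = g y y - Q (g y)" by (auto simp: g_def)
qed

lemma g_near: "y \<in> Y \<Longrightarrow> 0 < \<eta> \<Longrightarrow> near y \<eta> (g y)"
  using g[of y] by (simp add: near_def)

text \<open>Since \<open>s y\<close> is nonnegative, the squared dual norm of the maximizer is at
  most \<open>Q\<close>, hence at most its value at y, which is at most its dual norm times norm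
  y.\<close>

lemma g_bound:
  assumes y: "y \<in> Y" and h: "h \<in> Y"
  shows "\<bar>g y h\<bar> \<le> norm y * norm h"
proof -
  have "(p 0 (g y))\<^sup>2 \<le> p 0 (g y) * norm y"
    using Q_ge[OF g(1)[OF y]] g(2)[OF y] s_nonneg[OF y] dual_bound[OF g(1)[OF y] y] by linarith
  then have "p 0 (g y) \<le> norm y"
    using p_nonneg[OF g(1)[OF y], of 0] by (cases "p 0 (g y) = 0") (auto simp: power2_eq_square)
  then show ?thesis
    using dual_bound[OF g(1)[OF y] h] by (meson mult_right_mono norm_ge_zero order_trans)
qed

lemma s_lower:
  assumes y: "y \<in> Y" and h: "h \<in> Y"
  shows "g y h \<le> s (y + h) - s y"
  using s_upper[OF subspace_add[OF Y y h] g(1)[OF y]] g(2)[OF y] dual_add[OF g(1)[OF y] y h] by simp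

lemma s_upper_increment:
  assumes y: "y \<in> Y" and h: "h \<in> Y"
  shows "s (y + h) - s y \<le> g (y + h) h"
proof -
  have yh: "y + h \<in> Y" by (rule subspace_add[OF Y y h])
  show ?thesis
    using s_upper[OF y g(1)[OF yh]] g(2)[OF yh] dual_add[OF g(1)[OF yh] y h] by simp
qed

text \<open>The maximizer at y + h loses at most g (y + h) h - g y h in the problem at y, which is
  at most M * norm h. It is therefore an approximate maximizer at y, and \<open>near_norm\<close>
  applies.\<close>

lemma g_continuous:
  assumes y: "y \<in> Y" and \<epsilon>: "0 < \<epsilon>"
  shows "\<exists>\<delta>>0. \<forall>h\<in>Y. norm h < \<delta> \<longrightarrow> (\<forall>k\<in>Y. \<bar>g (y + h) k - g y k\<bar> \<le> \<epsilon> * norm k)"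
proof -
  obtain \<eta> where \<eta>: "\<eta> > 0"
    "\<And>\<xi>. near y \<eta> \<xi> \<Longrightarrow> \<forall>x\<in>Y. \<bar>\<xi> x - g y x\<bar> \<le> \<epsilon> * norm x"
    using near_norm[OF y g_near[OF y] \<epsilon>] by blast
  define M where "M = 2 * norm y + 1"
  have M: "M > 0" by (simp add: M_def add_nonneg_pos)
  define \<delta> where "\<delta> = min 1 (\<eta> / M)"
  have "near y \<eta> (g (y + h))" if h: "h \<in> Y" "norm h < \<delta>" for h
  proof -
    have yh: "y + h \<in> Y" by (rule subspace_add[OF Y y h(1)])
    have "g (y + h) h - g y h \<le> norm (y + h) * norm h + norm y * norm h"
      using g_bound[OF yh h(1)] g_bound[OF y h(1)] by linarith
    also have "\<dots> = (norm (y + h) + norm y) * norm h" by (simp add: algebra_simps)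
    also have "\<dots> \<le> M * norm h"
      using norm_triangle_ineq[of y h] h(2) by (intro mult_right_mono) (auto simp: M_def \<delta>_def)
    also have "\<dots> \<le> \<eta>" using h(2) M by (auto simp: \<delta>_def field_simps)
    finally have "g (y + h) h - g y h \<le> \<eta>" .
    then show ?thesis
      using s_lower[OF y h(1)] g[OF yh] dual_add[OF g(1)[OF yh] y h(1)]
      by (simp add: near_def)
  qed
  moreover have "\<delta> > 0" using M \<eta>(1) by (simp add: \<delta>_def)
  ultimately show ?thesis using \<eta>(2) by blast
qed

text \<open>Test with the multiple \<tau> * norm y of a norming functional: the value is at least
  (\<tau> - 2 \<tau>^2) times the square of norm y, and \<tau> = 1/4 is the best choice.\<close>

lemma s_ge:
  assumes y: "y \<in> Y"
  shows "(norm y)\<^sup>2 / 8 \<le> s y"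
proof -
  obtain u where u: "linear u" "\<And>x. \<bar>u x\<bar> \<le> norm x" "u y = norm y" using norming_functional by blast
  define \<phi> where "\<phi> x = norm y / 4 * u x" for x
  have "linear \<phi>" unfolding \<phi>_def using u(1) by (simp add: linear_iff algebra_simps)
  moreover have b: "\<bar>\<phi> x\<bar> \<le> norm y / 4 * norm x" for x
    using mult_left_mono[OF u(2), of "norm y / 4" x] by (simp add: \<phi>_def abs_mult)
  ultimately have d: "\<phi> \<in> dual_on Y" by (auto simp: dual_on_def linear_form_on_linear intro!: exI[of _ "norm y / 4"])
  have "p 0 \<phi> \<le> norm y / 4"
  proof (rule p_least)
    fix x assume "x \<in> A 0"
    then have "norm y / 4 * norm x \<le> norm y / 4" by (intro mult_left_le) (auto simp: A_def)
    then show "\<bar>\<phi> x\<bar> \<le> norm y / 4" using b[of x] by linarith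
  qed
  then have "(p 0 \<phi>)\<^sup>2 \<le> (norm y / 4)\<^sup>2" using p_nonneg[OF d] by (intro power_mono)
  then have "Q \<phi> \<le> (norm y)\<^sup>2 / 8" using Q_le[OF d] by (simp add: power_divide)
  then show ?thesis using s_upper[OF y d] u(3) by (simp add: \<phi>_def power2_eq_square)
qed

lemma s_zero: "s 0 = 0"
  using g(2)[OF subspace_0[OF Y]] dual_zero[OF g(1)[OF subspace_0[OF Y]]]
    Q_ge[OF g(1)[OF subspace_0[OF Y]]] s_nonneg[OF subspace_0[OF Y]]
  by (smt (verit) zero_le_power2)

end

text \<open>Smoothness is recorded through increments: \<open>g\<close> at the two ends of a segment
  traps the increment of \<open>s\<close>, and norm continuity of \<open>g\<close> turns this into
  Frechet differentiability. The quadratic lower bound lets the gauge control distances when it is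
  used as a penalty.\<close>

definition smooth_gauge :: "'a::real_normed_vector set \<Rightarrow> ('a \<Rightarrow> real) \<Rightarrow> ('a \<Rightarrow> 'a \<Rightarrow> real) \<Rightarrow> bool" where
  "smooth_gauge Y s g \<longleftrightarrow>
     (\<forall>y\<in>Y. linear_form_on Y (g y)) \<and>
     (\<forall>y\<in>Y. \<forall>h\<in>Y. \<bar>g y h\<bar> \<le> norm y * norm h) \<and>
     (\<forall>y\<in>Y. \<forall>h\<in>Y. g y h \<le> s (y + h) - s y \<and> s (y + h) - s y \<le> g (y + h) h) \<and>
     (\<forall>y\<in>Y. \<forall>\<epsilon>>0. \<exists>\<delta>>0. \<forall>h\<in>Y. norm h < \<delta> \<longrightarrow>
        (\<forall>k\<in>Y. \<bar>g (y + h) k - g y k\<bar> \<le> \<epsilon> * norm k)) \<and>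
     s 0 = 0 \<and> (\<forall>y\<in>Y. (norm y)\<^sup>2 / 8 \<le> s y)"

text \<open>The gauge is the convex conjugate of a locally uniformly convex function on the dual (the idea
  behind Kadec's renorming): uniform convexity of the dual function makes the maximizers depend
  norm continuously on the point, so the conjugate is continuously Frechet differentiable.\<close>

lemma smooth_gauge_exists:
  fixes Y :: "'a::real_normed_vector set"
  assumes Y: "subspace Y" and sep: "separable_space (top_of_set Y)"
    and dual: "separable_subspace_dual Y"
  shows "\<exists>s g. smooth_gauge Y s g"
proof -
  obtain C where C: "countable C" "C \<subseteq> Y" "Y \<subseteq> closure C"
    using sep by (auto simp: separable_space_def closure_of_subtopology Int_absorb1)
  obtain y0 where "y0 \<in> C" using subspace_0[OF Y] C(3) by (metis closure_empty empty_iff equals0I subsetD)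
  then have ne: "C \<noteq> {}" by blast
  define e where "e n = (1 / max 1 (norm (from_nat_into C n))) *\<^sub>R from_nat_into C n" for n
  obtain E where E: "countable E" "E \<subseteq> subspace_dual Y"
    "\<And>\<phi> \<epsilon>. \<phi> \<in> subspace_dual Y \<Longrightarrow> \<epsilon> > 0 \<Longrightarrow> \<exists>\<psi>\<in>E. \<forall>y\<in>Y. \<bar>\<phi> y - \<psi> y\<bar> \<le> \<epsilon> * norm y"
    using dual unfolding separable_subspace_dual_def by blast
  have res: "restrict \<phi> Y \<in> subspace_dual Y" if "\<phi> \<in> dual_on Y" for \<phi>
    using that Y by (auto simp: dual_on_def linear_form_on_def subspace_dual_def subspace_add subspace_scale)
  have "(\<lambda>y. 0::real) \<in> dual_on Y" by (auto simp: dual_on_def linear_form_on_def intro: exI[of _ 0])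
  then have Ene: "E \<noteq> {}" using E(3)[OF res, of "\<lambda>y. 0" 1] by auto
  have sd: "subspace_dual Y \<subseteq> dual_on Y" by (auto simp: dual_on_def linear_form_on_def subspace_dual_def)
  interpret separable_dual Y e "from_nat_into E"
  proof
    fix n
    have "from_nat_into C n \<in> Y" using C(2) from_nat_into[OF ne] by blast
    then show "e n \<in> Y" unfolding e_def using Y by (intro subspace_scale)
    show "norm (e n) \<le> 1" by (simp add: e_def divide_le_eq_1 less_max_iff_disj)
    show "from_nat_into E n \<in> dual_on Y" using sd E(2) from_nat_into[OF Ene] by blast
  next
    fix y \<delta> assume y: "y \<in> Y" "norm y \<le> 1" and \<delta>: "0 < (\<delta>::real)"
    then obtain c where c: "c \<in> C" "dist c y < \<delta> / 2"
      using C(3) unfolding closure_approachable by (meson half_gt_zero subsetD closure_approachable)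
    obtain n where n: "from_nat_into C n = c" using from_nat_into_surj[OF C(1) c(1)] by blast
    \<comment> \<open>Radial retraction onto the ball moves c by at most m - 1, which is at most
      \<delta>/2 because c is that close to a point of the ball.\<close>
    define m where "m = max 1 (norm c)"
    have m: "m \<ge> 1" "m \<ge> norm c" by (auto simp: m_def)
    have "norm c \<le> norm y + dist c y" using norm_triangle_ineq[of y "c - y"] by (simp add: dist_norm)
    then have "m - 1 \<le> \<delta> / 2" using y c \<delta> by (auto simp: m_def)
    have "norm (c - e n) = norm ((1 - 1 / m) *\<^sub>R c)" by (simp add: e_def n m_def algebra_simps)
    also have "\<dots> = (1 - 1 / m) * norm c" using m by simp
    also have "\<dots> \<le> (1 - 1 / m) * m" using m by (intro mult_left_mono) auto
    also have "\<dots> = m - 1" using m by (simp add: field_simps)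
    finally have "norm (c - e n) \<le> \<delta> / 2" using \<open>m - 1 \<le> \<delta> / 2\<close> by simp
    then have "norm (y - e n) < \<delta>"
      using c(2) norm_triangle_ineq[of "y - c" "c - e n"] by (simp add: dist_norm norm_minus_commute)
    then show "\<exists>n. norm (y - e n) < \<delta>" by blast
  next
    fix \<phi> \<delta> assume \<phi>: "\<phi> \<in> dual_on Y" and \<delta>: "0 < (\<delta>::real)"
    obtain \<psi> where \<psi>: "\<psi> \<in> E" "\<forall>y\<in>Y. \<bar>restrict \<phi> Y y - \<psi> y\<bar> \<le> \<delta> * norm y" using E(3)[OF res[OF \<phi>] \<delta>] by blast
    obtain n where "from_nat_into E n = \<psi>" using from_nat_into_surj[OF E(1) \<psi>(1)] by blast
    then show "\<exists>n. \<forall>y\<in>Y. \<bar>\<phi> y - from_nat_into E n y\<bar> \<le> \<delta> * norm y" using \<psi>(2) by auto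
  qed (rule Y)
  have "smooth_gauge Y s g"
    unfolding smooth_gauge_def
    using g(1) g_bound s_lower s_upper_increment g_continuous s_zero s_ge
    by (auto simp: dual_on_def)
  then show ?thesis by blast
qed

subsection \<open>Separable reduction of Frechet subgradients\<close>

text \<open>The subgradient inequality with increments confined to \<open>Y\<close>: one predicate
  serves restrictions to a subspace and, with \<open>UNIV\<close>, the whole space.\<close>

definition frechet_at :: "('a::real_normed_vector \<Rightarrow> real) \<Rightarrow> 'a set \<Rightarrow> 'a \<Rightarrow> ('a \<Rightarrow> real) \<Rightarrow> bool" where
  "frechet_at \<phi> Y z w \<longleftrightarrow>
     (\<forall>\<epsilon>>0. \<exists>\<delta>>0. \<forall>h\<in>Y. norm h < \<delta> \<longrightarrow> w h \<le> \<phi> (z + h) - \<phi> z + \<epsilon> * norm h)"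

text \<open>Testing the inequality at small multiples of h and dividing by the factor replaces the
  local estimate by a global one.\<close>

lemma frechet_at_bound:
  assumes w: "linear_form_on Y w" and Y: "subspace Y"
    and lip: "\<And>x y. \<bar>\<phi> x - \<phi> y\<bar> \<le> c * norm (x - y)"
    and fr: "frechet_at \<phi> Y z w" and h: "h \<in> Y"
  shows "\<bar>w h\<bar> \<le> c * norm h"
proof -
  have le: "w h \<le> c * norm h" if h: "h \<in> Y" for h
  proof (rule field_le_epsilon)
    fix \<epsilon> :: real assume \<epsilon>: "0 < \<epsilon>"
    define \<epsilon>' where "\<epsilon>' = \<epsilon> / (norm h + 1)"
    have n1: "0 < norm h + 1" by (simp add: add_nonneg_pos)
    then have "\<epsilon>' > 0" using \<epsilon> by (simp add: \<epsilon>'_def)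
    then obtain \<delta> where \<delta>: "\<delta> > 0" "\<And>k. k \<in> Y \<Longrightarrow> norm k < \<delta> \<Longrightarrow> w k \<le> \<phi> (z + k) - \<phi> z + \<epsilon>' * norm k"
      using fr unfolding frechet_at_def by blast
    define \<tau> where "\<tau> = \<delta> / (norm h + 1)"
    have \<tau>: "\<tau> > 0" using \<delta> n1 by (simp add: \<tau>_def)
    have "norm (\<tau> *\<^sub>R h) < \<delta>" using \<tau> \<delta>(1) n1 by (simp add: \<tau>_def field_simps)
    then have "w (\<tau> *\<^sub>R h) \<le> \<phi> (z + \<tau> *\<^sub>R h) - \<phi> z + \<epsilon>' * norm (\<tau> *\<^sub>R h)"
      using \<delta>(2) subspace_scale[OF Y h] by blast
    also have "\<phi> (z + \<tau> *\<^sub>R h) - \<phi> z \<le> c * norm (\<tau> *\<^sub>R h)" using lip[of "z + \<tau> *\<^sub>R h" z] by simp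
    finally have "\<tau> * w h \<le> \<tau> * (c * norm h + \<epsilon>' * norm h)"
      using w h \<tau> by (simp add: linear_form_on_def algebra_simps)
    then have "w h \<le> c * norm h + \<epsilon>' * norm h" using \<tau> by simp
    also have "\<epsilon>' * norm h \<le> \<epsilon>" using n1 \<epsilon> by (simp add: \<epsilon>'_def field_simps)
    finally show "w h \<le> c * norm h + \<epsilon>" by simp
  qed
  have "w ((-1) *\<^sub>R h) = (-1) * w h" using w h unfolding linear_form_on_def by blast
  then show ?thesis using le[OF h] le[of "- h"] subspace_neg[OF Y h] by simp
qed

lemma nonneg_rat_sequence:
  fixes a :: real assumes "0 \<le> a"
  shows "\<exists>r. (\<forall>k. 0 \<le> r k) \<and> (\<lambda>k. real_of_rat (r k)) \<longlonglongrightarrow> a"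
proof -
  have "a \<in> closure \<rat>" by (simp add: Rats_closure_real)
  then obtain q where q: "\<And>n. q n \<in> \<rat>" "q \<longlonglongrightarrow> a" unfolding closure_sequential by blast
  have "\<exists>r. q n = real_of_rat r" for n using q(1)[of n] by (auto elim: Rats_cases)
  then obtain r where r: "\<And>n. q n = real_of_rat (r n)" by metis
  have "(\<lambda>n. \<bar>q n\<bar>) \<longlonglongrightarrow> \<bar>a\<bar>" by (rule tendsto_rabs[OF q(2)])
  then have "(\<lambda>n. real_of_rat \<bar>r n\<bar>) \<longlonglongrightarrow> a" using assms by (simp add: r)
  then show ?thesis by (intro exI[of _ "\<lambda>n. \<bar>r n\<bar>"]) simp
qed

text \<open>By Hahn--Banach, \<open>w\<close> extends to a Frechet subgradient as soon as no value of the following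
  functional with increments \<open>h\<close> from the whole space lies below \<open>w l\<close>.\<close>

definition cone_value :: "('a::real_normed_vector \<Rightarrow> real) \<Rightarrow> real \<Rightarrow> nat \<Rightarrow> (nat \<Rightarrow> real) \<Rightarrow> (nat \<Rightarrow> real) \<Rightarrow>
    'a \<Rightarrow> 'a \<Rightarrow> (nat \<Rightarrow> 'a) \<Rightarrow> real" where
  "cone_value \<phi> c m \<alpha> \<epsilon> z l h =
     (\<Sum>j<m. \<alpha> j * (\<phi> (z + h j) - \<phi> z + \<epsilon> j * norm (h j))) + c * norm (l - (\<Sum>j<m. \<alpha> j *\<^sub>R h j))"

text \<open>Whatever strict upper bound increments from the whole space achieve, increments from
  \<open>D\<close> achieve too. All parameters are rational so that only countably many requirements
  arise for countable \<open>D\<close>.\<close>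

definition rich_for :: "('a::real_normed_vector \<Rightarrow> real) \<Rightarrow> real \<Rightarrow> 'a set \<Rightarrow> bool" where
  "rich_for \<phi> c D \<longleftrightarrow> (\<forall>m \<alpha> \<epsilon> d q. \<forall>z\<in>D. \<forall>l\<in>D.
     (\<exists>h. (\<forall>j<m. norm (h j) < real_of_rat (d j)) \<and>
        cone_value \<phi> c m (\<lambda>j. real_of_rat (\<alpha> j)) (\<lambda>j. real_of_rat (\<epsilon> j)) z l h < real_of_rat q) \<longrightarrow>
     (\<exists>h. (\<forall>j<m. h j \<in> D \<and> norm (h j) < real_of_rat (d j)) \<and>
        cone_value \<phi> c m (\<lambda>j. real_of_rat (\<alpha> j)) (\<lambda>j. real_of_rat (\<epsilon> j)) z l h < real_of_rat q))"

lemma cone_value_cong: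
  assumes "\<And>j. j < m \<Longrightarrow> \<alpha> j = \<alpha>' j" "\<And>j. j < m \<Longrightarrow> \<epsilon> j = \<epsilon>' j"
  shows "cone_value \<phi> c m \<alpha> \<epsilon> z l h = cone_value \<phi> c m \<alpha>' \<epsilon>' z l h"
  unfolding cone_value_def using assms by simp

text \<open>For each function, rational data and pair z, l, one choice of finitely many witnesses is
  added. Finite families of parameters become lists, of which there are countably many.\<close>

lemma rich_set_exists:
  fixes \<phi> :: "'i \<Rightarrow> 'a::real_normed_vector \<Rightarrow> real"
  assumes F: "countable F" and C0: "countable C0"
  shows "\<exists>D. countable D \<and> C0 \<subseteq> D \<and> (\<forall>t\<in>F. rich_for (\<phi> t) c D) \<and> subspace (closure D)
           \<and> separable_space (top_of_set (closure D))"
proof -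
  define ok where "ok t ps q z l h \<longleftrightarrow>
      (\<forall>j<length ps. norm (h j) < real_of_rat (snd (snd (ps ! j)))) \<and>
      cone_value (\<phi> t) c (length ps) (\<lambda>j. real_of_rat (fst (ps ! j)))
        (\<lambda>j. real_of_rat (fst (snd (ps ! j)))) z l h < real_of_rat q"
    for t and ps :: "(rat \<times> rat \<times> rat) list" and q z l h
  \<comment> \<open>The first two list entries stand for z and l. If no witness exists,
    \<open>SOME\<close> merely contributes irrelevant points, still finitely many.\<close>
  define G where "G xs = (\<Union>t\<in>F. \<Union>ps. \<Union>q. (SOME h. ok t ps q (xs ! 0) (xs ! 1) h) ` {..<length ps})" for xs
  have "countable (G xs)" for xs
    unfolding G_def by (intro countable_UN F countable_image) auto
  from separable_subspace_closed_under[of G, OF this C0]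
  obtain D where D: "countable D" "C0 \<subseteq> D" "\<And>xs. set xs \<subseteq> D \<Longrightarrow> G xs \<subseteq> D"
    "subspace (closure D)" "separable_space (top_of_set (closure D))" by blast
  have "rich_for (\<phi> t) c D" if t: "t \<in> F" for t
    unfolding rich_for_def
  proof (intro allI ballI impI)
    fix m :: nat and \<alpha> \<epsilon> d :: "nat \<Rightarrow> rat" and q z l
    assume zl: "z \<in> D" "l \<in> D"
    assume "\<exists>h. (\<forall>j<m. norm (h j) < real_of_rat (d j)) \<and>
        cone_value (\<phi> t) c m (\<lambda>j. real_of_rat (\<alpha> j)) (\<lambda>j. real_of_rat (\<epsilon> j)) z l h < real_of_rat q"
    then obtain h where h: "\<forall>j<m. norm (h j) < real_of_rat (d j)"
        "cone_value (\<phi> t) c m (\<lambda>j. real_of_rat (\<alpha> j)) (\<lambda>j. real_of_rat (\<epsilon> j)) z l h < real_of_rat q"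
      by blast
    define ps where "ps = map (\<lambda>j. (\<alpha> j, \<epsilon> j, d j)) [0..<m]"
    have ps: "length ps = m" "\<And>j. j < m \<Longrightarrow> ps ! j = (\<alpha> j, \<epsilon> j, d j)" by (simp_all add: ps_def)
    have eq: "ok t ps q z l h \<longleftrightarrow> (\<forall>j<m. norm (h j) < real_of_rat (d j)) \<and>
        cone_value (\<phi> t) c m (\<lambda>j. real_of_rat (\<alpha> j)) (\<lambda>j. real_of_rat (\<epsilon> j)) z l h < real_of_rat q" for h
    proof -
      have "cone_value (\<phi> t) c m (\<lambda>j. real_of_rat (fst (ps ! j))) (\<lambda>j. real_of_rat (fst (snd (ps ! j)))) z l h
          = cone_value (\<phi> t) c m (\<lambda>j. real_of_rat (\<alpha> j)) (\<lambda>j. real_of_rat (\<epsilon> j)) z l h"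
        by (rule cone_value_cong) (simp_all add: ps)
      then show ?thesis unfolding ok_def ps(1) by (simp add: ps(2))
    qed
    define h' where "h' = (SOME h. ok t ps q z l h)"
    have "ok t ps q z l h" using eq h by blast
    then have ok': "ok t ps q z l h'" unfolding h'_def by (rule someI[where P="ok t ps q z l"])
    have "h' j \<in> D" if "j < m" for j
    proof -
      have "h' j \<in> G [z, l]" unfolding G_def h'_def using t that ps(1) by auto
      then show ?thesis using D(3)[of "[z, l]"] zl by auto
    qed
    then show "\<exists>h. (\<forall>j<m. h j \<in> D \<and> norm (h j) < real_of_rat (d j)) \<and>
        cone_value (\<phi> t) c m (\<lambda>j. real_of_rat (\<alpha> j)) (\<lambda>j. real_of_rat (\<epsilon> j)) z l h < real_of_rat q"
      using ok' eq by blast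
  qed
  then show ?thesis using D by blast
qed

text \<open>A value strictly below \<open>w l\<close> would survive a small perturbation of z and l
  into \<open>D\<close> and of the weights to nonnegative rationals. Richness then moves the
  increments into \<open>D\<close>, hence into Y, where the subgradient inequality and the bound c
  for w force the value up to \<open>w l\<close> again.\<close>

lemma cone_value_ge:
  fixes \<phi> :: "'a::real_normed_vector \<Rightarrow> real"
  assumes rich: "rich_for \<phi> c D" and Y: "Y = closure D" "subspace Y" and c: "0 \<le> c"
    and lip: "\<And>x y. \<bar>\<phi> x - \<phi> y\<bar> \<le> c * norm (x - y)"
    and z: "z \<in> Y" and l: "l \<in> Y" and w: "linear_form_on Y w" and wc: "\<And>h. h \<in> Y \<Longrightarrow> \<bar>w h\<bar> \<le> c * norm h"
    and fr: "\<And>j h. j < m \<Longrightarrow> h \<in> Y \<Longrightarrow> norm h < real_of_rat (d j) \<Longrightarrow>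
        w h \<le> \<phi> (z + h) - \<phi> z + real_of_rat (\<epsilon> j) * norm h"
    and \<alpha>: "\<And>j. 0 \<le> \<alpha> j" and h: "\<And>j. j < m \<Longrightarrow> norm (h j) < real_of_rat (d j)"
  shows "w l \<le> cone_value \<phi> c m \<alpha> (\<lambda>j. real_of_rat (\<epsilon> j)) z l h"
proof (rule ccontr)
  let ?\<epsilon> = "\<lambda>j. real_of_rat (\<epsilon> j)"
  assume "\<not> ?thesis"
  then obtain q where q: "cone_value \<phi> c m \<alpha> ?\<epsilon> z l h < real_of_rat q" "real_of_rat q < w l"
    using of_rat_dense by (meson not_le)
  obtain zs where zs: "\<And>k. zs k \<in> D" "zs \<longlonglongrightarrow> z" using z unfolding Y closure_sequential by blast
  obtain ls where ls: "\<And>k. ls k \<in> D" "ls \<longlonglongrightarrow> l" using l unfolding Y closure_sequential by blast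
  obtain r where r: "\<And>j k. 0 \<le> r j k" "\<And>j. (\<lambda>k. real_of_rat (r j k)) \<longlonglongrightarrow> \<alpha> j"
    using nonneg_rat_sequence[OF \<alpha>] by metis
  have lip': "c-lipschitz_on UNIV \<phi>"
    using lip c by (intro lipschitz_onI) (auto simp: dist_norm)
  have \<phi>: "(\<lambda>k. \<phi> (f k)) \<longlonglongrightarrow> \<phi> a" if "f \<longlonglongrightarrow> a" for f a
    using lipschitz_on_continuous_on[OF lip'] that
    by (auto simp: continuous_on_eq_continuous_at intro: isCont_tendsto_compose)
  have "(\<lambda>k. cone_value \<phi> c m (\<lambda>j. real_of_rat (r j k)) ?\<epsilon> (zs k) (ls k) h)
      \<longlonglongrightarrow> cone_value \<phi> c m \<alpha> ?\<epsilon> z l h"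
    unfolding cone_value_def by (intro tendsto_intros r \<phi> zs ls)
  then have ev1: "\<forall>\<^sub>F k in sequentially.
      cone_value \<phi> c m (\<lambda>j. real_of_rat (r j k)) ?\<epsilon> (zs k) (ls k) h < real_of_rat q"
    using q(1) by (rule order_tendstoD)
  \<comment> \<open>The cost of the perturbation: changing the base point alters each increment of
    \<phi> by at most twice c times the distance, and changing l alters the last term by c times the
    distance.\<close>
  define err where "err k = (\<Sum>j<m. real_of_rat (r j k)) * (2 * c * norm (zs k - z)) + c * norm (ls k - l)" for k
  have "err \<longlonglongrightarrow> (\<Sum>j<m. \<alpha> j) * (2 * c * norm (z - z)) + c * norm (l - l)"
    unfolding err_def by (intro tendsto_intros r zs ls)
  then have "\<forall>\<^sub>F k in sequentially. err k < w l - real_of_rat q"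
    using q(2) by (intro order_tendstoD(2)) auto
  with ev1 obtain k where
    k: "cone_value \<phi> c m (\<lambda>j. real_of_rat (r j k)) ?\<epsilon> (zs k) (ls k) h < real_of_rat q"
       "err k < w l - real_of_rat q"
    by (metis (mono_tags, lifting) eventually_conj eventually_sequentially order_refl)
  then obtain g where g: "\<And>j. j < m \<Longrightarrow> g j \<in> D" "\<And>j. j < m \<Longrightarrow> norm (g j) < real_of_rat (d j)"
    "cone_value \<phi> c m (\<lambda>j. real_of_rat (r j k)) ?\<epsilon> (zs k) (ls k) g < real_of_rat q"
    using rich h zs(1)[of k] ls(1)[of k] unfolding rich_for_def by metis
  define a where "a j = real_of_rat (r j k)" for j
  have a0: "0 \<le> a j" for j using r(1) by (simp add: a_def)
  have gY: "g j \<in> Y" if "j < m" for j using g(1)[OF that] closure_subset Y(1) by blast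
  define v where "v = (\<Sum>j<m. a j *\<^sub>R g j)"
  have vY: "v \<in> Y" unfolding v_def using gY Y(2) by (intro subspace_sum subspace_scale) auto
  have wv: "w v = (\<Sum>j<m. a j * w (g j))"
  proof -
    have "w (\<Sum>j\<in>J. a j *\<^sub>R g j) = (\<Sum>j\<in>J. a j * w (g j))" if "finite J" "J \<subseteq> {..<m}" for J
      using that
    proof (induction J rule: finite_induct)
      case empty
      have "w (0 *\<^sub>R z) = 0 * w z" using w z unfolding linear_form_on_def by blast
      then show ?case by simp
    next
      case (insert j J)
      have "a j *\<^sub>R g j \<in> Y" "(\<Sum>j\<in>J. a j *\<^sub>R g j) \<in> Y"
        using insert gY Y(2) by (auto intro!: subspace_sum subspace_scale)
      moreover have "w (a j *\<^sub>R g j) = a j * w (g j)" using w gY insert unfolding linear_form_on_def by blast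
      ultimately show ?case using insert w unfolding linear_form_on_def by simp
    qed
    then show ?thesis by (simp add: v_def)
  qed
  have "w l = w v + w (l - v)"
    using w vY subspace_diff[OF Y(2) l vY] unfolding linear_form_on_def by (metis add.commute diff_add_cancel)
  also have "\<dots> \<le> (\<Sum>j<m. a j * w (g j)) + c * norm (l - v)"
    using wv wc[OF subspace_diff[OF Y(2) l vY]] by linarith
  also have "(\<Sum>j<m. a j * w (g j)) \<le> (\<Sum>j<m. a j * (\<phi> (z + g j) - \<phi> z + ?\<epsilon> j * norm (g j)))"
    using fr gY g(2) a0 by (intro sum_mono mult_left_mono) auto
  also have "\<dots> \<le> (\<Sum>j<m. a j * (\<phi> (zs k + g j) - \<phi> (zs k) + ?\<epsilon> j * norm (g j)) + a j * (2 * c * norm (zs k - z)))"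
  proof (rule sum_mono)
    fix j
    have "\<phi> (z + g j) - \<phi> z \<le> \<phi> (zs k + g j) - \<phi> (zs k) + 2 * c * norm (zs k - z)"
      using lip[of "zs k + g j" "z + g j"] lip[of "zs k" z] by simp
    then have "a j * (\<phi> (z + g j) - \<phi> z + ?\<epsilon> j * norm (g j)) \<le>
        a j * (\<phi> (zs k + g j) - \<phi> (zs k) + ?\<epsilon> j * norm (g j) + 2 * c * norm (zs k - z))"
      using a0 by (intro mult_left_mono) auto
    then show "a j * (\<phi> (z + g j) - \<phi> z + ?\<epsilon> j * norm (g j)) \<le>
        a j * (\<phi> (zs k + g j) - \<phi> (zs k) + ?\<epsilon> j * norm (g j)) + a j * (2 * c * norm (zs k - z))"
      by (simp add: algebra_simps)
  qed
  also have "c * norm (l - v) \<le> c * norm (ls k - v) + c * norm (ls k - l)"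
  proof -
    have "norm (l - v) \<le> norm (ls k - v) + norm (ls k - l)"
      using norm_triangle_ineq4[of "ls k - v" "ls k - l"] by simp
    then show ?thesis using c by (simp add: distrib_left[symmetric] mult_left_mono)
  qed
  finally have "w l \<le> cone_value \<phi> c m a ?\<epsilon> (zs k) (ls k) g + err k"
    by (simp add: cone_value_def err_def a_def v_def sum.distrib sum_distrib_right)
  then show False using g(3) k(2) by (simp add: a_def[abs_def])
qed

text \<open>The infimum of the cone values over all finite lists is sublinear and dominates w on Y,
  so w extends to a linear u below it. The empty list then bounds u by c times the norm, and a list
  with a single entry of weight 1 is the Frechet inequality for u.\<close>

lemma frechet_at_extend:
  fixes \<phi> :: "'a::real_normed_vector \<Rightarrow> real"
  assumes rich: "rich_for \<phi> c D" and Y: "Y = closure D" "subspace Y" and c: "0 \<le> c"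
    and lip: "\<And>x y. \<bar>\<phi> x - \<phi> y\<bar> \<le> c * norm (x - y)"
    and z: "z \<in> Y" and w: "linear_form_on Y w" and fr: "frechet_at \<phi> Y z w"
  shows "\<exists>u. linear u \<and> (\<forall>x. \<bar>u x\<bar> \<le> c * norm x) \<and> frechet_at \<phi> UNIV z u \<and> (\<forall>y\<in>Y. u y = w y)"
proof -
  have wc: "\<bar>w h\<bar> \<le> c * norm h" if "h \<in> Y" for h
    by (rule frechet_at_bound[OF w Y(2) lip fr that])
  \<comment> \<open>Tolerances and radii are chosen rational because richness speaks only of
    rational data.\<close>
  have "\<exists>d. 0 < real_of_rat d \<and> (\<forall>h\<in>Y. norm h < real_of_rat d \<longrightarrow>
      w h \<le> \<phi> (z + h) - \<phi> z + real_of_rat (1 / of_nat (Suc k)) * norm h)" for k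
  proof -
    have "0 < real_of_rat (1 / of_nat (Suc k))" by simp
    then obtain \<delta> where \<delta>: "\<delta> > 0" "\<And>h. h \<in> Y \<Longrightarrow> norm h < \<delta> \<Longrightarrow>
        w h \<le> \<phi> (z + h) - \<phi> z + real_of_rat (1 / of_nat (Suc k)) * norm h"
      using fr unfolding frechet_at_def by metis
    obtain d where "0 < real_of_rat d" "real_of_rat d < \<delta>" using of_rat_dense[OF \<delta>(1)] by blast
    then show ?thesis using \<delta>(2) by force
  qed
  then obtain d where d: "\<And>k. 0 < real_of_rat (d k)"
    "\<And>k h. h \<in> Y \<Longrightarrow> norm h < real_of_rat (d k) \<Longrightarrow>
      w h \<le> \<phi> (z + h) - \<phi> z + real_of_rat (1 / of_nat (Suc k)) * norm h" by metis
  define slope where "slope k h = \<phi> (z + h) - \<phi> z + real_of_rat (1 / of_nat (Suc k)) * norm h" for k h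
  define ok where "ok L \<longleftrightarrow> (\<forall>(\<alpha>, k, h)\<in>set L. (0::real) \<le> \<alpha> \<and> norm h < real_of_rat (d k))"
    for L :: "(real \<times> nat \<times> 'a) list"
  \<comment> \<open>Entries are weight, index of the tolerance, increment. With lists, concatenation
    gives subadditivity and rescaling of the weights gives homogeneity.\<close>
  define val where "val L x = (\<Sum>(\<alpha>, k, h)\<leftarrow>L. \<alpha> * slope k h) + c * norm (x - (\<Sum>(\<alpha>, k, h)\<leftarrow>L. \<alpha> *\<^sub>R h))" for L x
  define p where "p x = (INF L\<in>{L. ok L}. val L x)" for x
  have lowY: "w l \<le> val L l" if L: "ok L" and l: "l \<in> Y" for L l
  proof -
    \<comment> \<open>The weight 0 beyond the end meets the requirement that all weights be
      nonnegative.\<close>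
    define \<alpha> where "\<alpha> j = (if j < length L then fst (L ! j) else 0)" for j
    define k where "k j = fst (snd (L ! j))" for j
    define h where "h j = snd (snd (L ! j))" for j
    have Lj: "L ! j = (\<alpha> j, k j, h j)" if "j < length L" for j
      using that by (simp add: \<alpha>_def k_def h_def)
    have good: "0 \<le> \<alpha> j \<and> norm (h j) < real_of_rat (d (k j))" if "j < length L" for j
      using L nth_mem[OF that] unfolding ok_def Lj[OF that] by blast
    have "w l \<le> cone_value \<phi> c (length L) \<alpha> (\<lambda>j. real_of_rat (1 / of_nat (Suc (k j)))) z l h"
    proof (rule cone_value_ge[OF rich Y c lip z l w wc])
      show "0 \<le> \<alpha> j" for j using good[of j] by (cases "j < length L") (auto simp: \<alpha>_def)
    qed (use d(2) good in auto)
    also have "\<dots> = val L l"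
      by (simp add: cone_value_def val_def sum_list_sum_nth atLeast0LessThan Lj slope_def)
    finally show ?thesis .
  qed
  \<comment> \<open>Off Y nothing is known about w; the lower bound is transported from 0, where it
    is \<open>w 0\<close>, since the last term of the value is c-Lipschitz in x.\<close>
  have low: "- (c * norm x) \<le> val L x" if "ok L" for L x
  proof -
    define S where "S = (\<Sum>(\<alpha>, k, h)\<leftarrow>L. \<alpha> *\<^sub>R h)"
    have "0 \<le> val L 0" using lowY[OF that subspace_0[OF Y(2)]] wc[OF subspace_0[OF Y(2)]] by simp
    moreover have "norm (0 - S) \<le> norm (x - S) + norm x"
      using norm_triangle_ineq4[of "x - S" x] by simp
    then have "c * norm (0 - S) \<le> c * norm (x - S) + c * norm x"
      using c by (simp add: distrib_left[symmetric] mult_left_mono)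
    ultimately show ?thesis by (simp add: val_def S_def)
  qed
  have bdd: "bdd_below ((\<lambda>L. val L x) ` {L. ok L})" for x
    using low by (intro bdd_belowI2) auto
  have ple: "p x \<le> val L x" if "ok L" for L x
    unfolding p_def using that by (intro cINF_lower bdd) auto
  have ok0: "ok []" by (simp add: ok_def)
  have pge: "b \<le> p x" if "\<And>L. ok L \<Longrightarrow> b \<le> val L x" for b x
    unfolding p_def using that ok0 by (intro cINF_greatest) auto
  have "sublinear p"
  proof (rule sublinearI)
    fix x y
    have *: "p (x + y) \<le> val L x + val M y" if "ok L" "ok M" for L M
    proof -
      define S where "S L = (\<Sum>(\<alpha>, k, h)\<leftarrow>L. \<alpha> *\<^sub>R h)" for L :: "(real \<times> nat \<times> 'a) list"
      have "p (x + y) \<le> val (L @ M) (x + y)" using that by (intro ple) (auto simp: ok_def)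
      moreover have "norm ((x + y) - (S L + S M)) \<le> norm (x - S L) + norm (y - S M)"
        using norm_triangle_ineq[of "x - S L" "y - S M"] by (simp add: algebra_simps)
      then have "c * norm ((x + y) - (S L + S M)) \<le> c * norm (x - S L) + c * norm (y - S M)"
        using c by (simp add: distrib_left[symmetric] mult_left_mono)
      ultimately show ?thesis by (simp add: val_def S_def)
    qed
    have "p (x + y) - val L x \<le> p y" if "ok L" for L
    proof (rule pge)
      fix M assume "ok M" then show "p (x + y) - val L x \<le> val M y" using *[OF that, of M] by simp
    qed
    then have "p (x + y) - p y \<le> p x" by (intro pge) (simp add: algebra_simps)
    then show "p (x + y) \<le> p x + p y" by simp
  next
    fix r :: real and x assume r: "0 < r"
    have "p (r *\<^sub>R x) / r \<le> val L x" if L: "ok L" for L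
    proof -
      define M where "M = map (\<lambda>(\<alpha>, k, h). (r * \<alpha>, k, h)) L"
      have "ok M" using L r by (fastforce simp: ok_def M_def)
      have 1: "(\<Sum>(\<alpha>, k, h)\<leftarrow>M. \<alpha> * slope k h) = r * (\<Sum>(\<alpha>, k, h)\<leftarrow>L. \<alpha> * slope k h)"
        unfolding M_def by (induction L) (auto simp: algebra_simps)
      have 2: "(\<Sum>(\<alpha>, k, h)\<leftarrow>M. \<alpha> *\<^sub>R h) = r *\<^sub>R (\<Sum>(\<alpha>, k, h)\<leftarrow>L. \<alpha> *\<^sub>R h)"
        unfolding M_def by (induction L) (auto simp: algebra_simps)
      have "val M (r *\<^sub>R x) = r * val L x"
        unfolding val_def 1 2 scaleR_diff_right[symmetric] norm_scaleR using r by (simp add: algebra_simps)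
      then show ?thesis using ple[OF \<open>ok M\<close>, of "r *\<^sub>R x"] r by (simp add: field_simps)
    qed
    then have "p (r *\<^sub>R x) / r \<le> p x" by (rule pge)
    then show "p (r *\<^sub>R x) \<le> r * p x" using r by (simp add: field_simps)
  next
    have "p 0 \<le> 0" using ple[OF ok0, of 0] by (simp add: val_def)
    moreover have "0 \<le> p 0" using low[of _ 0] by (intro pge) simp
    ultimately show "p 0 = 0" by simp
  qed
  moreover have "w l \<le> p l" if "l \<in> Y" for l using lowY[OF _ that] by (rule pge)
  ultimately obtain u where u: "linear u" "\<And>x. u x \<le> p x" "\<And>y. y \<in> Y \<Longrightarrow> u y = w y"
    using Hahn_Banach[OF _ Y(2) w, of p] by blast
  have uc: "u x \<le> c * norm x" for x
    using u(2)[of x] ple[OF ok0, of x] by (simp add: val_def)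
  have "\<bar>u x\<bar> \<le> c * norm x" for x
    using uc[of x] uc[of "- x"] linear_neg[OF u(1)] by simp
  moreover have "frechet_at \<phi> UNIV z u"
    unfolding frechet_at_def
  proof (intro allI impI)
    fix \<epsilon> :: real assume "0 < \<epsilon>"
    then obtain k where k: "1 / Suc k < \<epsilon>" using nat_approx_posE by blast
    have "u h \<le> \<phi> (z + h) - \<phi> z + \<epsilon> * norm h" if h: "norm h < real_of_rat (d k)" for h
    proof -
      have "u h \<le> val [(1, k, h)] h"
        using u(2)[of h] ple[of "[(1, k, h)]" h] h by (simp add: ok_def)
      also have "\<dots> = \<phi> (z + h) - \<phi> z + 1 / Suc k * norm h"
        by (simp add: val_def slope_def of_rat_divide of_rat_add)
      also have "1 / Suc k * norm h \<le> \<epsilon> * norm h" using k by (intro mult_right_mono) auto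
      finally show ?thesis by simp
    qed
    then show "\<exists>\<delta>>0. \<forall>h\<in>UNIV. norm h < \<delta> \<longrightarrow> u h \<le> \<phi> (z + h) - \<phi> z + \<epsilon> * norm h"
      using d(1) by blast
  qed
  ultimately show ?thesis using u by blast
qed

subsection \<open>A smooth variational principle\<close>

text \<open>Penalties centred at successive near minimisers are added one by one, so the total
  perturbation is a series of smooth terms. Closeness is measured by the penalty \<open>S\<close>
  itself, without a triangle inequality; \<open>complete\<close> packages completeness of the domain
  and continuity along sequences that are Cauchy in this sense.\<close>

lemma smooth_variational_principle:
  fixes G :: "'z \<Rightarrow> real" and S :: "'z \<Rightarrow> 'z \<Rightarrow> real"
  assumes x0: "x0 \<in> D" and low: "\<And>z. z \<in> D \<Longrightarrow> b \<le> G z"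
    and S0: "\<And>z w. z \<in> D \<Longrightarrow> w \<in> D \<Longrightarrow> 0 \<le> S z w" and Srefl: "\<And>z. z \<in> D \<Longrightarrow> S z z = 0"
    and SM: "\<And>z w. z \<in> D \<Longrightarrow> w \<in> D \<Longrightarrow> S z w \<le> M"
    and \<mu>: "\<And>i. 0 < \<mu> i" and \<mu>s: "summable \<mu>"
    and complete: "\<And>zs. (\<And>n. zs n \<in> D) \<Longrightarrow>
      (\<And>e. 0 < e \<Longrightarrow> \<exists>N. \<forall>n\<ge>N. S (zs n) (zs N) < e) \<Longrightarrow>
      \<exists>z\<in>D. (\<lambda>n. G (zs n)) \<longlonglongrightarrow> G z \<and> (\<forall>w\<in>D. (\<lambda>n. S (zs n) w) \<longlonglongrightarrow> S z w)"
  shows "\<exists>zs z. (\<forall>n. zs n \<in> D) \<and> z \<in> D \<and>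
      (\<forall>w\<in>D. G z + (\<Sum>n. \<mu> n * S z (zs n)) \<le> G w + (\<Sum>n. \<mu> n * S w (zs n))) \<and>
      G z + (\<Sum>n. \<mu> n * S z (zs n)) \<le> G x0"
proof -
  \<comment> \<open>The state is the current function with its near minimiser. No near minimality is
    asked at n = 0, so the construction can start from the prescribed point.\<close>
  define P where "P n f \<longleftrightarrow> snd f \<in> D \<and> (\<forall>w\<in>D. b \<le> fst f w) \<and>
      (n = 0 \<longrightarrow> f = (G, x0)) \<and> (0 < n \<longrightarrow> (\<forall>w\<in>D. fst f (snd f) \<le> fst f w + \<mu> n * (1/2) ^ n))"
    for n and f :: "('z \<Rightarrow> real) \<times> 'z"
  define R where "R n f f' \<longleftrightarrow> fst f' = (\<lambda>w. fst f w + \<mu> n * S w (snd f)) \<and> fst f' (snd f') \<le> fst f' (snd f)"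
    for n and f f' :: "('z \<Rightarrow> real) \<times> 'z"
  have "\<exists>f. \<forall>n. P n (f n) \<and> R n (f n) (f (Suc n))"
  proof (rule dependent_nat_choice)
    show "\<exists>f. P 0 f" by (intro exI[of _ "(G, x0)"]) (auto simp: P_def x0 low)
  next
    fix f n assume Pf: "P n f"
    define H where "H w = fst f w + \<mu> n * S w (snd f)" for w
    have Hb: "b \<le> H w" if "w \<in> D" for w
    proof -
      have "0 \<le> \<mu> n * S w (snd f)" using Pf that S0 \<mu>[of n] by (intro mult_nonneg_nonneg) (auto simp: P_def)
      moreover have "b \<le> fst f w" using Pf that by (simp add: P_def)
      ultimately show ?thesis by (simp add: H_def)
    qed
    define \<epsilon> where "\<epsilon> = \<mu> (Suc n) * (1/2) ^ Suc n"
    have \<epsilon>: "\<epsilon> > 0" using \<mu> by (simp add: \<epsilon>_def)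
    have sD: "snd f \<in> D" using Pf by (simp add: P_def)
    have bdd: "bdd_below (H ` D)" using Hb by (intro bdd_belowI2)
    \<comment> \<open>The old point is kept if it is already good enough; otherwise a sufficiently
      good point has a smaller value. Either way the value does not increase.\<close>
    have "\<exists>z\<in>D. H z \<le> H (snd f) \<and> (\<forall>w\<in>D. H z \<le> H w + \<epsilon>)"
    proof (cases "\<forall>w\<in>D. H (snd f) \<le> H w + \<epsilon>")
      case True then show ?thesis using sD by auto
    next
      case False
      then obtain w where w: "w \<in> D" "H w + \<epsilon> < H (snd f)" by force
      have "(INF z\<in>D. H z) < (INF z\<in>D. H z) + \<epsilon>" using \<epsilon> by simp
      then obtain z where z: "z \<in> D" "H z < (INF z\<in>D. H z) + \<epsilon>"
        using cINF_less_iff[of D H] bdd sD by blast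
      have le: "H z \<le> H w + \<epsilon>" if "w \<in> D" for w
        using z(2) cINF_lower[OF bdd that] by linarith
      then have "H z \<le> H (snd f)" using w by fastforce
      then show ?thesis using z(1) le by blast
    qed
    then obtain z where z: "z \<in> D" "H z \<le> H (snd f)" "\<forall>w\<in>D. H z \<le> H w + \<epsilon>" by blast
    have "P (Suc n) (H, z)" using z Hb by (simp add: P_def \<epsilon>_def)
    moreover have "R n f (H, z)" using z(2) by (simp add: R_def H_def[abs_def])
    ultimately show "\<exists>f'. P (Suc n) f' \<and> R n f f'" by blast
  qed
  then obtain f where f: "\<And>n. P n (f n)" "\<And>n. R n (f n) (f (Suc n))" by blast
  define H where "H n = fst (f n)" for n
  define zs where "zs n = snd (f n)" for n
  have zsD: "zs n \<in> D" for n using f(1)[of n] by (simp add: P_def zs_def)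
  have H0: "H 0 = G" "zs 0 = x0" using f(1)[of 0] by (simp_all add: P_def H_def zs_def)
  have HSuc: "H (Suc n) w = H n w + \<mu> n * S w (zs n)" for n w
    using f(2)[of n] by (simp add: R_def H_def zs_def)
  have Hsum: "H n w = G w + (\<Sum>i<n. \<mu> i * S w (zs i))" for n w
    by (induction n) (simp_all add: H0 HSuc)
  have near: "H n (zs n) \<le> H n w + \<mu> n * (1/2) ^ n" if "0 < n" "w \<in> D" for n w
    using f(1)[of n] that by (simp add: P_def H_def zs_def)
  have Hmono: "H m w \<le> H n w" if "m \<le> n" "w \<in> D" for m n w
    unfolding Hsum using that S0 zsD \<mu> by (intro add_left_mono sum_mono2) (auto simp: less_imp_le)
  have dec1: "H (Suc n) (zs (Suc n)) \<le> H n (zs n)" for n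
  proof -
    have "H (Suc n) (zs (Suc n)) \<le> H (Suc n) (zs n)"
      using f(2)[of n] unfolding R_def H_def zs_def by blast
    then show ?thesis using HSuc[of n "zs n"] Srefl[OF zsD] by simp
  qed
  have dec: "H n (zs n) \<le> H m (zs m)" if "m \<le> n" for m n
    using that by (rule lift_Suc_antimono_le[of "\<lambda>n. H n (zs n)", rotated]) (rule dec1)
  \<comment> \<open>Values along the construction decrease while the functions increase. Compared
    with the near minimality of \<open>zs n\<close>, this forces the penalty between
    \<open>zs n\<close> and every later point below (1/2)^n.\<close>
  have later: "H (Suc n) (zs m) \<le> H n (zs n)" if "n \<le> m" for n m
  proof (cases "m = n")
    case True then show ?thesis using HSuc Srefl zsD by simp
  next
    case False
    then have "H (Suc n) (zs m) \<le> H m (zs m)" using that by (intro Hmono zsD) simp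
    also have "\<dots> \<le> H n (zs n)" by (rule dec[OF that])
    finally show ?thesis .
  qed
  have Sle: "S (zs m) (zs n) \<le> (1/2) ^ n" if "0 < n" "n \<le> m" for n m
  proof -
    have "\<mu> n * S (zs m) (zs n) \<le> \<mu> n * (1/2) ^ n"
      using later[OF that(2)] near[OF that(1) zsD[of m]] HSuc[of n "zs m"] by simp
    then show ?thesis using \<mu>[of n] by simp
  qed
  obtain z where z: "z \<in> D" "(\<lambda>n. G (zs n)) \<longlonglongrightarrow> G z" "\<And>w. w \<in> D \<Longrightarrow> (\<lambda>n. S (zs n) w) \<longlonglongrightarrow> S z w"
  proof -
    have "\<exists>N. \<forall>n\<ge>N. S (zs n) (zs N) < e" if e: "0 < e" for e
    proof -
      obtain N where N: "(1/2::real) ^ N < e" using real_arch_pow_inv[OF e, of "1/2"] by auto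
      have "S (zs n) (zs (Suc N)) < e" if "n \<ge> Suc N" for n
      proof -
        have "S (zs n) (zs (Suc N)) \<le> (1/2) ^ Suc N" by (rule Sle) (use that in auto)
        also have "\<dots> \<le> (1/2) ^ N" by simp
        finally show ?thesis using N by simp
      qed
      then show ?thesis by blast
    qed
    then have "\<exists>z\<in>D. (\<lambda>n. G (zs n)) \<longlonglongrightarrow> G z \<and> (\<forall>w\<in>D. (\<lambda>n. S (zs n) w) \<longlonglongrightarrow> S z w)"
      by (rule complete[of zs, OF zsD])
    then show ?thesis using that by blast
  qed
  have Hz: "H (Suc n) z \<le> H n (zs n)" for n
  proof (rule LIMSEQ_le_const2)
    show "(\<lambda>m. H (Suc n) (zs m)) \<longlonglongrightarrow> H (Suc n) z"
      unfolding Hsum by (intro tendsto_intros z zsD)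
    show "\<exists>N. \<forall>m\<ge>N. H (Suc n) (zs m) \<le> H n (zs n)" using later by blast
  qed
  have summ: "summable (\<lambda>n. \<mu> n * S w (zs n))" if "w \<in> D" for w
  proof (rule summable_comparison_test'[OF summable_mult[OF \<mu>s, of M]])
    fix n show "norm (\<mu> n * S w (zs n)) \<le> M * \<mu> n"
      using S0[OF that zsD] SM[OF that zsD, of n] \<mu>[of n] by (simp add: abs_mult mult.commute mult_left_mono)
  qed
  define Hinf where "Hinf w = G w + (\<Sum>n. \<mu> n * S w (zs n))" for w
  have lim: "(\<lambda>n. H n w) \<longlonglongrightarrow> Hinf w" if "w \<in> D" for w
    unfolding Hsum Hinf_def by (intro tendsto_add tendsto_const summable_LIMSEQ summ that)
  have Hle: "H n w \<le> Hinf w" if "w \<in> D" for n w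
    unfolding Hsum Hinf_def using S0 zsD \<mu> that
    by (intro add_left_mono sum_le_suminf summ) (auto simp: less_imp_le)
  have "Hinf z \<le> Hinf w" if w: "w \<in> D" for w
  proof (rule LIMSEQ_le)
    show "(\<lambda>n. H (Suc n) z) \<longlonglongrightarrow> Hinf z" by (rule LIMSEQ_Suc[OF lim[OF z(1)]])
    have "(\<lambda>n. Hinf w + \<mu> n * (1/2) ^ n) \<longlonglongrightarrow> Hinf w + 0 * 0"
      using summable_LIMSEQ_zero[OF \<mu>s] by (intro tendsto_intros LIMSEQ_power_zero) auto
    then show "(\<lambda>n. Hinf w + \<mu> n * (1/2) ^ n) \<longlonglongrightarrow> Hinf w" by simp
    have "H (Suc n) z \<le> Hinf w + \<mu> n * (1/2) ^ n" if "n \<ge> 1" for n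
      using Hz[of n] near[of n w] Hle[OF w, of n] that w by simp
    then show "\<exists>N. \<forall>n\<ge>N. H (Suc n) z \<le> Hinf w + \<mu> n * (1/2) ^ n" by blast
  qed
  moreover have "Hinf z \<le> G x0"
  proof (rule LIMSEQ_le_const2[OF LIMSEQ_Suc[OF lim[OF z(1)]]])
    have "H (Suc n) z \<le> G x0" for n
      using Hz[of n] dec[of 0 n] by (simp add: H0)
    then show "\<exists>N. \<forall>n\<ge>N. H (Suc n) z \<le> G x0" by blast
  qed
  ultimately show ?thesis using zsD z(1) unfolding Hinf_def by blast
qed

subsection \<open>Increments of a smooth gauge\<close>

context
  fixes Y :: "'a::real_normed_vector set" and s g
  assumes gauge: "smooth_gauge Y s g" and Y: "subspace Y"
begin

lemma gauge_linear: "y \<in> Y \<Longrightarrow> linear_form_on Y (g y)"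
  and gauge_bound: "y \<in> Y \<Longrightarrow> h \<in> Y \<Longrightarrow> \<bar>g y h\<bar> \<le> norm y * norm h"
  and gauge_lower: "y \<in> Y \<Longrightarrow> h \<in> Y \<Longrightarrow> g y h \<le> s (y + h) - s y"
  and gauge_upper: "y \<in> Y \<Longrightarrow> h \<in> Y \<Longrightarrow> s (y + h) - s y \<le> g (y + h) h"
  and gauge_zero: "s 0 = 0"
  and gauge_ge: "y \<in> Y \<Longrightarrow> (norm y)\<^sup>2 / 8 \<le> s y"
  using gauge by (auto simp: smooth_gauge_def)

lemma gauge_derivative_continuous:
  "y \<in> Y \<Longrightarrow> 0 < \<epsilon> \<Longrightarrow> \<exists>\<delta>>0. \<forall>h\<in>Y. norm h < \<delta> \<longrightarrow> (\<forall>k\<in>Y. \<bar>g (y + h) k - g y k\<bar> \<le> \<epsilon> * norm k)"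
  using gauge unfolding smooth_gauge_def by blast

lemma gauge_nonneg: "y \<in> Y \<Longrightarrow> 0 \<le> s y"
  using gauge_ge[of y] by (smt (verit) divide_nonneg_nonneg zero_le_power2)

lemma gauge_le: "y \<in> Y \<Longrightarrow> s y \<le> (norm y)\<^sup>2"
  using gauge_upper[OF subspace_0[OF Y], of y] gauge_bound[of y y] gauge_zero
  by (simp add: power2_eq_square)

lemma gauge_increment_le:
  assumes "y \<in> Y" "h \<in> Y"
  shows "\<bar>s (y + h) - s y\<bar> \<le> (norm y + norm h) * norm h"
proof -
  have "s (y + h) - s y \<le> norm (y + h) * norm h"
    using gauge_upper[OF assms] gauge_bound[OF subspace_add[OF Y assms] assms(2)] by linarith
  also have "\<dots> \<le> (norm y + norm h) * norm h" by (intro mult_right_mono norm_triangle_ineq) simp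
  moreover have "- (norm y * norm h) \<le> s (y + h) - s y"
    using gauge_lower[OF assms] gauge_bound[OF assms] by linarith
  moreover have "norm y * norm h \<le> (norm y + norm h) * norm h" by (intro mult_right_mono) auto
  ultimately show ?thesis by linarith
qed

lemma gauge_tendsto:
  assumes "\<And>n. f n \<in> Y" "a \<in> Y" "f \<longlonglongrightarrow> a"
  shows "(\<lambda>n. s (f n)) \<longlonglongrightarrow> s a"
proof (rule metric_tendsto_imp_tendsto)
  have "(\<lambda>n. (norm a + norm (f n - a)) * norm (f n - a)) \<longlonglongrightarrow> (norm a + norm (a - a)) * norm (a - a)"
    by (intro tendsto_intros assms)
  then show "(\<lambda>n. (norm a + norm (f n - a)) * norm (f n - a)) \<longlonglongrightarrow> 0" by simp
  show "\<forall>\<^sub>F n in sequentially. dist (s (f n)) (s a) \<le> dist ((norm a + norm (f n - a)) * norm (f n - a)) 0"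
    using gauge_increment_le[OF assms(2) subspace_diff[OF Y assms(1,2)]] by (simp add: dist_real_def)
qed

text \<open>Termwise differentiation: continuity of the derivatives handles finitely many terms,
  while in the tail a crude bound on their variation is multiplied by a small remainder of the
  series.\<close>

lemma gauge_series_derivative:
  assumes y: "\<And>i::nat. y i \<in> Y" "\<And>i. norm (y i) \<le> R" and \<mu>: "\<And>i. 0 \<le> \<mu> i" "summable \<mu>"
  shows "summable (\<lambda>i. \<mu> i * s (y i))"
    and "linear_form_on Y (\<lambda>h. \<Sum>i. \<mu> i * g (y i) h)"
    and "h \<in> Y \<Longrightarrow> \<bar>\<Sum>i. \<mu> i * g (y i) h\<bar> \<le> suminf \<mu> * R * norm h"
    and "0 < \<epsilon> \<Longrightarrow> \<exists>\<delta>>0. \<forall>h\<in>Y. norm h < \<delta> \<longrightarrow>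
      (\<Sum>i. \<mu> i * s (y i + h)) - (\<Sum>i. \<mu> i * s (y i)) \<le> (\<Sum>i. \<mu> i * g (y i) h) + \<epsilon> * norm h"
proof -
  have R: "0 \<le> R" using y(2)[of 0] norm_ge_zero order_trans by blast
  have sum_s: "summable (\<lambda>i. \<mu> i * s (y i))" if "\<And>i. y i \<in> Y" "\<And>i. norm (y i) \<le> R" for y and R :: real
  proof (rule summable_comparison_test'[OF summable_mult[OF \<mu>(2), of "R\<^sup>2"]])
    fix i
    have "s (y i) \<le> R\<^sup>2" using gauge_le[OF that(1)[of i]] power_mono[OF that(2)[of i], of 2] by simp
    then show "norm (\<mu> i * s (y i)) \<le> R\<^sup>2 * \<mu> i"
      using \<mu>(1)[of i] gauge_nonneg[OF that(1)[of i]] by (simp add: abs_mult mult.commute mult_left_mono)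
  qed
  show "summable (\<lambda>i. \<mu> i * s (y i))" by (rule sum_s[OF y])
  have gle: "\<bar>\<mu> i * g (y i) h\<bar> \<le> \<mu> i * (R * norm h)" if "h \<in> Y" for i h
  proof -
    have "\<bar>g (y i) h\<bar> \<le> R * norm h"
      using gauge_bound[OF y(1)[of i] that] mult_right_mono[OF y(2)[of i], of "norm h"] by simp
    then show ?thesis using \<mu>(1)[of i] by (simp add: abs_mult mult_left_mono)
  qed
  have sum_g: "summable (\<lambda>i. \<mu> i * g (y i) h)" if "h \<in> Y" for h
    by (rule summable_comparison_test'[OF summable_mult2[OF \<mu>(2), of "R * norm h"]])
       (use gle[OF that] in simp)
  show "linear_form_on Y (\<lambda>h. \<Sum>i. \<mu> i * g (y i) h)"
    unfolding linear_form_on_def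
  proof (intro conjI ballI allI)
    fix h k assume hk: "h \<in> Y" "k \<in> Y"
    have "g (y i) (h + k) = g (y i) h + g (y i) k" for i
      using gauge_linear[OF y(1)[of i]] hk unfolding linear_form_on_def by blast
    then show "(\<Sum>i. \<mu> i * g (y i) (h + k)) = (\<Sum>i. \<mu> i * g (y i) h) + (\<Sum>i. \<mu> i * g (y i) k)"
      using suminf_add[OF sum_g[OF hk(1)] sum_g[OF hk(2)]] by (simp add: distrib_left)
  next
    fix c h assume h: "h \<in> Y"
    have "g (y i) (c *\<^sub>R h) = c * g (y i) h" for i
      using gauge_linear[OF y(1)[of i]] h unfolding linear_form_on_def by blast
    then show "(\<Sum>i. \<mu> i * g (y i) (c *\<^sub>R h)) = c * (\<Sum>i. \<mu> i * g (y i) h)"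
      using suminf_mult[OF sum_g[OF h], of c] by (simp add: mult.left_commute)
  qed
  show "\<bar>\<Sum>i. \<mu> i * g (y i) h\<bar> \<le> suminf \<mu> * R * norm h" if h: "h \<in> Y"
  proof -
    have "norm (\<Sum>i. \<mu> i * g (y i) h) \<le> (\<Sum>i. \<mu> i * (R * norm h))"
      using gle[OF h] by (intro norm_suminf_le summable_mult2 \<mu>(2)) simp
    also have "\<dots> = suminf \<mu> * (R * norm h)" by (rule suminf_mult2[OF \<mu>(2), symmetric])
    finally show ?thesis by (simp add: mult.assoc)
  qed
  show "\<exists>\<delta>>0. \<forall>h\<in>Y. norm h < \<delta> \<longrightarrow>
      (\<Sum>i. \<mu> i * s (y i + h)) - (\<Sum>i. \<mu> i * s (y i)) \<le> (\<Sum>i. \<mu> i * g (y i) h) + \<epsilon> * norm h"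
    if \<epsilon>: "0 < \<epsilon>"
  proof -
    \<comment> \<open>Bounds norm (y i + h) + norm (y i) for norm h < 1, hence the variation of the
      derivative.\<close>
    define C where "C = 2 * R + 1"
    have C: "C > 0" using R by (simp add: C_def add_nonneg_pos)
    obtain N where N: "\<And>n. n \<ge> N \<Longrightarrow> norm (\<Sum>i. \<mu> (i + n)) < \<epsilon> / 2 / C"
      using suminf_exist_split[OF _ \<mu>(2), of "\<epsilon> / 2 / C"] \<epsilon> C by auto
    define m where "m = suminf \<mu> + 1"
    have m: "m > 0" using suminf_nonneg[OF \<mu>(2,1)] by (simp add: m_def)
    define \<epsilon>' where "\<epsilon>' = \<epsilon> / 2 / m"
    have \<epsilon>': "\<epsilon>' > 0" using \<epsilon> m by (simp add: \<epsilon>'_def)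
    obtain d where d: "\<And>i. d i > 0"
      "\<And>i h k. h \<in> Y \<Longrightarrow> norm h < d i \<Longrightarrow> k \<in> Y \<Longrightarrow> \<bar>g (y i + h) k - g (y i) k\<bar> \<le> \<epsilon>' * norm k"
      using gauge_derivative_continuous[OF y(1) \<epsilon>'] by metis
    define \<delta> where "\<delta> = Min (insert 1 (d ` {..<N}))"
    have \<delta>: "\<delta> > 0" "\<delta> \<le> 1" "\<And>i. i < N \<Longrightarrow> \<delta> \<le> d i"
      using d(1) by (auto simp: \<delta>_def)
    have "(\<Sum>i. \<mu> i * s (y i + h)) - (\<Sum>i. \<mu> i * s (y i)) \<le> (\<Sum>i. \<mu> i * g (y i) h) + \<epsilon> * norm h"
      if h: "h \<in> Y" "norm h < \<delta>" for h
    proof -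
      define e where "e i = (if i < N then \<epsilon>' else C)" for i
      have increment: "\<mu> i * s (y i + h) - \<mu> i * s (y i) \<le> \<mu> i * g (y i) h + \<mu> i * e i * norm h" for i
      proof -
        have yh: "y i + h \<in> Y" by (rule subspace_add[OF Y y(1) h(1)])
        have "g (y i + h) h - g (y i) h \<le> e i * norm h"
        proof (cases "i < N")
          case True
          then show ?thesis using d(2)[OF h(1) _ h(1), of i] \<delta>(3)[of i] h(2) by (simp add: e_def)
        next
          case False
          have "g (y i + h) h - g (y i) h \<le> norm (y i + h) * norm h + norm (y i) * norm h"
            using gauge_bound[OF yh h(1)] gauge_bound[OF y(1)[of i] h(1)] by linarith
          also have "\<dots> = (norm (y i + h) + norm (y i)) * norm h" by (simp add: distrib_right)
          also have "\<dots> \<le> C * norm h"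
            using norm_triangle_ineq[of "y i" h] y(2)[of i] h(2) \<delta>(2)
            by (intro mult_right_mono) (auto simp: C_def)
          finally show ?thesis using False by (simp add: e_def)
        qed
        then have "s (y i + h) - s (y i) \<le> g (y i) h + e i * norm h"
          using gauge_upper[OF y(1)[of i] h(1)] by linarith
        from mult_left_mono[OF this \<mu>(1)[of i]] show ?thesis by (simp add: algebra_simps)
      qed
      have se: "summable (\<lambda>i. \<mu> i * e i)"
      proof (rule summable_comparison_test'[OF summable_mult2[OF \<mu>(2), of "\<epsilon>' + C"]])
        fix i show "norm (\<mu> i * e i) \<le> \<mu> i * (\<epsilon>' + C)"
          using \<mu>(1)[of i] \<epsilon>' C by (auto simp: e_def abs_mult intro!: mult_left_mono)
      qed
      have "(\<Sum>i. \<mu> i * e i) = (\<Sum>i. \<mu> (i + N) * e (i + N)) + (\<Sum>i<N. \<mu> i * e i)"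
        by (rule suminf_split_initial_segment[OF se])
      also have "(\<Sum>i. \<mu> (i + N) * e (i + N)) = (\<Sum>i. \<mu> (i + N)) * C"
        using suminf_mult2[OF summable_ignore_initial_segment[OF \<mu>(2), of N], of C] by (simp add: e_def)
      also have "(\<Sum>i. \<mu> (i + N)) * C \<le> \<epsilon> / 2 / C * C"
        using N[of N] C by (intro mult_right_mono) auto
      also have "(\<Sum>i<N. \<mu> i * e i) = (\<Sum>i<N. \<mu> i) * \<epsilon>'" by (simp add: e_def sum_distrib_right)
      also have "\<dots> \<le> m * \<epsilon>'"
        using sum_le_suminf[OF \<mu>(2), of "{..<N}"] \<mu>(1) \<epsilon>' by (intro mult_right_mono) (auto simp: m_def)
      finally have e: "(\<Sum>i. \<mu> i * e i) \<le> \<epsilon>" using m C by (simp add: \<epsilon>'_def)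
      have ss: "summable (\<lambda>i. \<mu> i * s (y i + h))"
      proof (rule sum_s)
        show "y i + h \<in> Y" for i by (rule subspace_add[OF Y y(1) h(1)])
        show "norm (y i + h) \<le> R + norm h" for i using norm_triangle_ineq[of "y i" h] y(2)[of i] by linarith
      qed
      have "(\<Sum>i. \<mu> i * s (y i + h)) - (\<Sum>i. \<mu> i * s (y i)) = (\<Sum>i. \<mu> i * s (y i + h) - \<mu> i * s (y i))"
        by (rule suminf_diff[OF ss sum_s[OF y]])
      also have "\<dots> \<le> (\<Sum>i. \<mu> i * g (y i) h + \<mu> i * e i * norm h)"
        by (intro suminf_le increment summable_diff ss sum_s[OF y] summable_add sum_g h summable_mult2 se)
      also have "\<dots> = (\<Sum>i. \<mu> i * g (y i) h) + (\<Sum>i. \<mu> i * e i * norm h)"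
        by (intro suminf_add[symmetric] sum_g h summable_mult2 se)
      also have "(\<Sum>i. \<mu> i * e i * norm h) = (\<Sum>i. \<mu> i * e i) * norm h"
        by (rule suminf_mult2[OF se, symmetric])
      also have "\<dots> \<le> \<epsilon> * norm h" by (intro mult_right_mono e) simp
      finally show ?thesis by simp
    qed
    then show ?thesis using \<delta>(1) by blast
  qed
qed

end

subsection \<open>Approximate multipliers for a finite maximum\<close>

definition lse :: "real \<Rightarrow> 'i set \<Rightarrow> ('i \<Rightarrow> real) \<Rightarrow> real" where
  "lse \<beta> F a = ln (\<Sum>t\<in>F. exp (\<beta> * a t)) / \<beta>"

definition softmax :: "real \<Rightarrow> 'i set \<Rightarrow> ('i \<Rightarrow> real) \<Rightarrow> 'i \<Rightarrow> real" where
  "softmax \<beta> F a t = exp (\<beta> * a t) / (\<Sum>t\<in>F. exp (\<beta> * a t))"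

context
  fixes F :: "'i set" and \<beta> :: real
  assumes F: "finite F" "F \<noteq> {}" and \<beta>: "0 < \<beta>"
begin

lemma sum_exp_pos: "0 < (\<Sum>t\<in>F. exp (\<beta> * a t))"
  using F by (intro sum_pos) auto

lemma lse_ge:
  assumes "t \<in> F" shows "a t \<le> lse \<beta> F a"
proof -
  have "exp (\<beta> * a t) \<le> (\<Sum>t\<in>F. exp (\<beta> * a t))"
    using assms F by (intro member_le_sum) auto
  then have "\<beta> * a t \<le> ln (\<Sum>t\<in>F. exp (\<beta> * a t))" using sum_exp_pos by (subst ln_ge_iff)
  then show ?thesis using \<beta> by (simp add: lse_def field_simps)
qed

lemma lse_le:
  assumes "\<And>t. t \<in> F \<Longrightarrow> a t \<le> m"
  shows "lse \<beta> F a \<le> m + ln (card F) / \<beta>"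
proof -
  have card: "0 < card F" using F by (simp add: card_gt_0_iff)
  have "(\<Sum>t\<in>F. exp (\<beta> * a t)) \<le> (\<Sum>t\<in>F. exp (\<beta> * m))"
    using assms \<beta> by (intro sum_mono) simp
  also have "\<dots> = card F * exp (\<beta> * m)" by simp
  finally have "ln (\<Sum>t\<in>F. exp (\<beta> * a t)) \<le> ln (card F * exp (\<beta> * m))"
    using sum_exp_pos by (subst ln_le_cancel_iff) (auto simp: card)
  also have "\<dots> = ln (card F) + \<beta> * m" using card by (simp add: ln_mult)
  finally show ?thesis using \<beta> by (simp add: lse_def field_simps)
qed

lemma softmax_pos: "0 < softmax \<beta> F a t"
  using sum_exp_pos by (simp add: softmax_def)

lemma sum_softmax: "(\<Sum>t\<in>F. softmax \<beta> F a t) = 1"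
  using sum_exp_pos[of a] by (simp add: softmax_def sum_divide_distrib[symmetric])

text \<open>Keeping a single term of the denominator suffices. The weight of a function lagging
  behind another one thus decays exponentially in \<beta>.\<close>

lemma softmax_le:
  assumes "r \<in> F" shows "softmax \<beta> F a t \<le> exp (\<beta> * (a t - a r))"
proof -
  have "exp (\<beta> * a r) \<le> (\<Sum>t\<in>F. exp (\<beta> * a t))"
    using assms F by (intro member_le_sum) auto
  then have "softmax \<beta> F a t \<le> exp (\<beta> * a t) / exp (\<beta> * a r)"
    unfolding softmax_def using sum_exp_pos by (intro divide_left_mono mult_pos_pos) auto
  then show ?thesis by (simp add: exp_diff[symmetric] algebra_simps)
qed

lemma lse_tendsto:
  assumes "\<And>t. t \<in> F \<Longrightarrow> (\<lambda>n. A n t) \<longlonglongrightarrow> a t"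
  shows "(\<lambda>n. lse \<beta> F (A n)) \<longlonglongrightarrow> lse \<beta> F a"
  unfolding lse_def using sum_exp_pos[of a] \<beta> by (intro tendsto_intros assms) auto

text \<open>The softmax weight is the partial derivative of the smoothed maximum. One coordinate is
  varied because stationarity is later tested in one variable at a time.\<close>

lemma lse_update_le:
  assumes t: "t \<in> F" and \<epsilon>: "0 < \<epsilon>"
  shows "\<exists>d>0. \<forall>b. \<bar>b - a t\<bar> < d \<longrightarrow>
    lse \<beta> F (a(t := b)) \<le> lse \<beta> F a + softmax \<beta> F a t * (b - a t) + \<epsilon> * \<bar>b - a t\<bar>"
proof -
  define R where "R = (\<Sum>r\<in>F - {t}. exp (\<beta> * a r))"
  have R: "0 \<le> R" by (simp add: R_def sum_nonneg)
  define f where "f b = ln (R + exp (\<beta> * b)) / \<beta>" for b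
  have S: "(\<Sum>r\<in>F. exp (\<beta> * (a(t := b)) r)) = R + exp (\<beta> * b)" for b
  proof -
    have "(\<Sum>r\<in>F - {t}. exp (\<beta> * (a(t := b)) r)) = R" unfolding R_def by (intro sum.cong) auto
    then show ?thesis using sum.remove[OF F(1) t, of "\<lambda>r. exp (\<beta> * (a(t := b)) r)"] by simp
  qed
  have f: "lse \<beta> F (a(t := b)) = f b" for b unfolding lse_def f_def S ..
  have S0: "(\<Sum>r\<in>F. exp (\<beta> * a r)) = R + exp (\<beta> * a t)" using S[of "a t"] by simp
  have "0 < R + exp (\<beta> * a t)" using R by (simp add: add_nonneg_pos)
  then have "(f has_real_derivative exp (\<beta> * a t) * \<beta> / (R + exp (\<beta> * a t)) / \<beta>) (at (a t))"
    unfolding f_def using \<beta> by (auto intro!: derivative_eq_intros)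
  then have "(f has_real_derivative softmax \<beta> F a t) (at (a t))"
    using \<beta> by (simp add: softmax_def S0)
  then have "\<exists>d>0. \<forall>b. norm (b - a t) < d \<longrightarrow>
      norm (f b - f (a t) - softmax \<beta> F a t * (b - a t)) \<le> \<epsilon> * norm (b - a t)"
    using \<epsilon> unfolding has_field_derivative_def has_derivative_at_alt by blast
  then obtain d where "d > 0" and d: "\<And>b. \<bar>b - a t\<bar> < d \<Longrightarrow>
      \<bar>f b - f (a t) - softmax \<beta> F a t * (b - a t)\<bar> \<le> \<epsilon> * \<bar>b - a t\<bar>" by auto
  have "f (a t) = lse \<beta> F a" using f[of "a t"] by simp
  then show ?thesis using \<open>d > 0\<close> d unfolding f by (smt (verit))
qed

end

text \<open>The maximum is replaced by its log-sum-exp smoothing, the functions are decoupled by giving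
  each its own variable \<open>z t\<close>, tied to a point \<open>p\<close> of the slice by a gauge penalty, and the
  perturbed decoupled problem is minimised. Stationarity in \<open>z t\<close> yields a subgradient of
  \<open>\<phi> t\<close>, stationarity in \<open>p\<close> yields the sum rule along the slice.\<close>

lemma approximate_multipliers:
  fixes Y L :: "'a::banach set" and \<phi> :: "'i \<Rightarrow> 'a \<Rightarrow> real"
  assumes gauge: "smooth_gauge Y s g" and Y: "subspace Y" "closed Y"
    and L: "subspace L" "closed L" "L \<subseteq> Y"
    and F: "finite F" "F \<noteq> {}" and c: "0 \<le> c"
    and lip: "\<And>t x y. t \<in> F \<Longrightarrow> \<bar>\<phi> t x - \<phi> t y\<bar> \<le> c * norm (x - y)"
    and x: "x \<in> Y" and \<xi>: "linear \<xi>" "\<And>v. \<bar>\<xi> v\<bar> \<le> K * norm v" and \<eta>: "0 < \<eta>" and r: "0 < r"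
    and growth: "\<And>l. l \<in> L \<Longrightarrow> norm l \<le> r \<Longrightarrow>
      Max ((\<lambda>t. \<phi> t x) ` F) + \<xi> l - \<eta> * norm l \<le> Max ((\<lambda>t. \<phi> t (x + l)) ` F)"
    and \<delta>: "0 < \<delta>"
  shows "\<exists>z \<theta> w \<beta>. 1 / \<delta> \<le> \<beta> \<and> (\<Sum>t\<in>F. \<theta> t) = 1 \<and>
    (\<forall>t\<in>F. z t \<in> Y \<and> norm (z t - x) < \<delta> \<and> linear_form_on Y (w t) \<and> frechet_at (\<phi> t) Y (z t) (w t) \<and>
       0 < \<theta> t \<and> (\<forall>t'\<in>F. \<theta> t \<le> exp (\<beta> * (\<phi> t (z t) - \<phi> t' (z t'))))) \<and>
    (\<forall>v\<in>L. \<bar>(\<Sum>t\<in>F. \<theta> t * w t v) - \<xi> v\<bar> \<le> (2 * \<eta> + \<delta>) * norm v)"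
proof -
  note gbound = gauge_bound[OF gauge Y(1)] and glower = gauge_lower[OF gauge Y(1)]
    and gupper = gauge_upper[OF gauge Y(1)] and gge = gauge_ge[OF gauge Y(1)]
    and gnonneg = gauge_nonneg[OF gauge Y(1)] and gtends = gauge_tendsto[OF gauge Y(1)]
    and gle = gauge_le[OF gauge Y(1)] and glin = gauge_linear[OF gauge Y(1)]
  define k where "k = real (card F)"
  have k: "k \<ge> 1" using F by (simp add: k_def card_gt_0_iff Suc_le_eq)
  \<comment> \<open>Total slack times \<beta>: ln k is the smoothing error and 4 k c^2 the loss from
    completing squares when the penalty absorbs the Lipschitz terms.\<close>
  define C where "C = ln k + 4 * k * c\<^sup>2"
  have C: "C \<ge> 0" using k by (simp add: C_def)
  \<comment> \<open>Every variable ends up within 2m of x, hence closer than \<delta> and strictly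
    inside the ball of radius r, where small variations are admissible.\<close>
  define m where "m = min (\<delta> / 4) (r / 4)"
  have m: "m > 0" using \<delta> r by (simp add: m_def)
  \<comment> \<open>The last two summands keep the slice point within m of x, and each
    \<open>z t\<close> within m of the slice point.\<close>
  define \<beta> where "\<beta> = 1 + 1 / \<delta> + C / (\<eta> * m) + 16 * C / m\<^sup>2"
  have nn: "0 \<le> C / (\<eta> * m)" "0 \<le> 16 * C / m\<^sup>2" "0 < 1 / \<delta>" using C \<eta> m \<delta> by auto
  have \<beta>: "\<beta> > 1" "1 / \<delta> \<le> \<beta>" "C / (\<eta> * m) < \<beta>" "16 * C / m\<^sup>2 < \<beta>"
    using nn unfolding \<beta>_def by linarith+
  then have \<beta>0: "\<beta> > 0" by simp
  have C1: "C / \<beta> < \<eta> * m" using \<beta>(3) \<eta> m \<beta>0 by (simp add: field_simps)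
  have C2: "16 * C / \<beta> < m\<^sup>2" using \<beta>(4) m \<beta>0 by (simp add: field_simps)
  define fmax where "fmax y = Max ((\<lambda>t. \<phi> t y) ` F)" for y
  have fmax_ge: "\<phi> t y \<le> fmax y" if "t \<in> F" for t y
    unfolding fmax_def using that F by (intro Max_ge) auto
  \<comment> \<open>\<open>None\<close> indexes the point on the slice, \<open>Some t\<close> the
    private variable of \<phi> t.\<close>
  define J where "J = insert None (Some ` F)"
  have J: "finite J" using F by (simp add: J_def)
  have sumJ: "(\<Sum>j\<in>J. f j) = f None + (\<Sum>t\<in>F. f (Some t))" for f :: "'i option \<Rightarrow> real"
    unfolding J_def using F by (subst sum.insert) (auto simp: sum.reindex)
  define D where "D = {Z :: 'i option \<Rightarrow> 'a. (\<forall>j\<in>J. Z j \<in> Y \<and> norm (Z j - x) \<le> r) \<and> Z None - x \<in> L}"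
  \<comment> \<open>The growth hypothesis consumes one of the two \<eta>; the other keeps the slice
    point close to x.\<close>
  define G where "G Z = lse \<beta> F (\<lambda>t. \<phi> t (Z (Some t))) + \<beta> * (\<Sum>t\<in>F. s (Z (Some t) - Z None))
      - \<xi> (Z None - x) + 2 * \<eta> * norm (Z None - x)" for Z
  define S where "S Z W = (\<Sum>j\<in>J. s (Z j - W j))" for Z W :: "'i option \<Rightarrow> 'a"
  have DY: "Z j - W j \<in> Y" if "Z \<in> D" "W \<in> D" "j \<in> J" for Z W j
    using that Y(1) by (auto simp: D_def intro: subspace_diff)
  have Dnorm: "norm (Z j - W j) \<le> 2 * r" if "Z \<in> D" "W \<in> D" "j \<in> J" for Z W j
    using that norm_triangle_ineq4[of "Z j - x" "W j - x"] by (fastforce simp: D_def)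
  have DYs: "Z (Some t) - Z None \<in> Y" if "Z \<in> D" "t \<in> F" for Z t
    using that Y(1) by (auto simp: D_def J_def intro!: subspace_diff)
  define x0 :: "'i option \<Rightarrow> 'a" where "x0 = (\<lambda>_. x)"
  have x0D: "x0 \<in> D" using x r subspace_0[OF L(1)] by (auto simp: D_def x0_def)
  have Gx0: "G x0 \<le> fmax x + ln k / \<beta>"
    using lse_le[OF F \<beta>0, of "\<lambda>t. \<phi> t x" "fmax x"] fmax_ge linear_0[OF \<xi>(1)] gauge_zero[OF gauge Y(1)]
    by (simp add: G_def x0_def k_def)
  have Glow: "fmax x + \<eta> * norm (Z None - x) + \<beta> / 16 * (\<Sum>t\<in>F. (norm (Z (Some t) - Z None))\<^sup>2) - 4 * k * c\<^sup>2 / \<beta> \<le> G Z"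
    if Z: "Z \<in> D" for Z
  proof -
    define p where "p = Z None"
    define a where "a t = norm (Z (Some t) - p)" for t
    have l: "p - x \<in> L" "norm (p - x) \<le> r" using Z by (auto simp: D_def p_def J_def)
    have "fmax p \<in> (\<lambda>t. \<phi> t p) ` F" unfolding fmax_def using F by (intro Max_in) auto
    then obtain t0 where t0: "t0 \<in> F" "fmax p = \<phi> t0 p" by blast
    have "fmax p \<le> \<phi> t0 (Z (Some t0)) + c * a t0"
      using lip[OF t0(1), of p "Z (Some t0)"] t0(2) by (simp add: a_def norm_minus_commute)
    also have "\<phi> t0 (Z (Some t0)) \<le> lse \<beta> F (\<lambda>t. \<phi> t (Z (Some t)))"
      by (rule lse_ge[OF F \<beta>0 t0(1)])
    also have "c * a t0 \<le> (\<Sum>t\<in>F. c * a t)"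
      using F t0 c by (intro member_le_sum) (auto simp: a_def)
    finally have 1: "fmax p \<le> lse \<beta> F (\<lambda>t. \<phi> t (Z (Some t))) + (\<Sum>t\<in>F. c * a t)" by simp
    have 2: "fmax x + \<xi> (p - x) - \<eta> * norm (p - x) \<le> fmax p"
      using growth[OF l] by (simp add: fmax_def)
    have "\<beta> / 16 * (a t)\<^sup>2 - 4 * c\<^sup>2 / \<beta> \<le> \<beta> * s (Z (Some t) - p) - c * a t" if t: "t \<in> F" for t
    proof -
      have "0 \<le> (\<beta> * a t - 8 * c)\<^sup>2 / (16 * \<beta>)" using \<beta>0 by simp
      also have "\<dots> = \<beta> / 16 * (a t)\<^sup>2 - c * a t + 4 * c\<^sup>2 / \<beta>"
        using \<beta>0 by (simp add: power2_eq_square field_simps)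
      finally have "\<beta> / 16 * (a t)\<^sup>2 - 4 * c\<^sup>2 / \<beta> \<le> \<beta> * ((a t)\<^sup>2 / 8) - c * a t" by simp
      also have "\<beta> * ((a t)\<^sup>2 / 8) \<le> \<beta> * s (Z (Some t) - p)"
        using gge[OF DYs[OF Z t]] \<beta>0 by (simp add: a_def p_def)
      finally show ?thesis by simp
    qed
    then have "(\<Sum>t\<in>F. \<beta> / 16 * (a t)\<^sup>2 - 4 * c\<^sup>2 / \<beta>) \<le> (\<Sum>t\<in>F. \<beta> * s (Z (Some t) - p) - c * a t)"
      by (rule sum_mono)
    then have "\<beta> / 16 * (\<Sum>t\<in>F. (a t)\<^sup>2) - 4 * k * c\<^sup>2 / \<beta> \<le> \<beta> * (\<Sum>t\<in>F. s (Z (Some t) - p)) - (\<Sum>t\<in>F. c * a t)"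
      by (simp add: sum_subtractf sum_distrib_left k_def ac_simps)
    with 1 2 show ?thesis by (simp add: G_def p_def[symmetric] a_def[symmetric])
  qed
  \<comment> \<open>The derivatives of the perturbation in the k + 1 variables are each bounded by 4
    \<tau> r, so together they contribute exactly \<delta>.\<close>
  define \<tau> where "\<tau> = \<delta> / (4 * r * (k + 1))"
  have \<tau>: "\<tau> > 0" using \<delta> r k by (simp add: \<tau>_def)
  define \<mu> :: "nat \<Rightarrow> real" where "\<mu> i = \<tau> * (1/2) ^ i" for i
  have \<mu>_sums: "\<mu> sums (2 * \<tau>)"
    unfolding \<mu>_def using sums_mult[OF geometric_sums[of "1/2::real"], of \<tau>] by (simp add: mult.commute)
  have \<mu>0: "0 < \<mu> i" for i using \<tau> by (simp add: \<mu>_def)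

  \<comment> \<open>A minimiser of the perturbed decoupled problem\<close>
  have "\<exists>zs z. (\<forall>n. zs n \<in> D) \<and> z \<in> D \<and>
      (\<forall>w\<in>D. G z + (\<Sum>n. \<mu> n * S z (zs n)) \<le> G w + (\<Sum>n. \<mu> n * S w (zs n))) \<and>
      G z + (\<Sum>n. \<mu> n * S z (zs n)) \<le> G x0"
  proof (rule smooth_variational_principle[where b = "fmax x - 4 * k * c\<^sup>2 / \<beta>" and M = "card J * (2 * r)\<^sup>2"])
    show "x0 \<in> D" by (rule x0D)
    show "0 < \<mu> i" for i by (rule \<mu>0)
    show "summable \<mu>" by (rule sums_summable[OF \<mu>_sums])
  next
    fix Z assume Z: "Z \<in> D"
    have "0 \<le> \<eta> * norm (Z None - x) + \<beta> / 16 * (\<Sum>t\<in>F. (norm (Z (Some t) - Z None))\<^sup>2)"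
      using \<eta> \<beta>0 by (intro add_nonneg_nonneg mult_nonneg_nonneg sum_nonneg) auto
    then show "fmax x - 4 * k * c\<^sup>2 / \<beta> \<le> G Z" using Glow[OF Z] by linarith
    show "S Z Z = 0" by (simp add: S_def gauge_zero[OF gauge Y(1)])
    fix W assume W: "W \<in> D"
    show "0 \<le> S Z W" unfolding S_def using DY[OF Z W] by (intro sum_nonneg gnonneg)
    have "S Z W \<le> (\<Sum>j\<in>J. (2 * r)\<^sup>2)"
      unfolding S_def
    proof (rule sum_mono)
      fix j assume j: "j \<in> J"
      have "s (Z j - W j) \<le> (norm (Z j - W j))\<^sup>2" by (rule gle[OF DY[OF Z W j]])
      also have "\<dots> \<le> (2 * r)\<^sup>2" by (intro power_mono Dnorm[OF Z W j]) simp
      finally show "s (Z j - W j) \<le> (2 * r)\<^sup>2" .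
    qed
    then show "S Z W \<le> card J * (2 * r)\<^sup>2" by simp
  next
    fix zs :: "nat \<Rightarrow> 'i option \<Rightarrow> 'a"
    assume zs: "\<And>n. zs n \<in> D" and cau: "\<And>e. 0 < e \<Longrightarrow> \<exists>N. \<forall>n\<ge>N. S (zs n) (zs N) < e"
    have "Cauchy (\<lambda>n. zs n j)" if j: "j \<in> J" for j
      unfolding Cauchy_altdef2
    proof (intro allI impI)
      fix e :: real assume e: "0 < e"
      then obtain N where N: "\<And>n. n \<ge> N \<Longrightarrow> S (zs n) (zs N) < e\<^sup>2 / 8" using cau[of "e\<^sup>2 / 8"] by auto
      have "dist (zs n j) (zs N j) < e" if "n \<ge> N" for n
      proof -
        have "(norm (zs n j - zs N j))\<^sup>2 / 8 \<le> s (zs n j - zs N j)" by (rule gge[OF DY[OF zs zs j]])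
        also have "\<dots> \<le> S (zs n) (zs N)"
          unfolding S_def using J j DY[OF zs zs] by (intro member_le_sum gnonneg) auto
        also have "\<dots> < e\<^sup>2 / 8" by (rule N[OF that])
        finally have "(norm (zs n j - zs N j))\<^sup>2 < e\<^sup>2" by simp
        then show ?thesis using e by (simp add: dist_norm power2_less_imp_less)
      qed
      then show "\<exists>N. \<forall>n\<ge>N. dist (zs n j) (zs N j) < e" by blast
    qed
    then have "\<exists>l. (\<lambda>n. zs n j) \<longlonglongrightarrow> l" if "j \<in> J" for j
      using that Cauchy_convergent convergent_def by blast
    then obtain z where z: "\<And>j. j \<in> J \<Longrightarrow> (\<lambda>n. zs n j) \<longlonglongrightarrow> z j" by metis
    have JN: "None \<in> J" and JS: "\<And>t. t \<in> F \<Longrightarrow> Some t \<in> J" by (auto simp: J_def)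
    have "z j \<in> Y \<and> norm (z j - x) \<le> r" if j: "j \<in> J" for j
    proof
      have "zs n j \<in> Y" for n using zs[of n] j by (simp add: D_def)
      then show "z j \<in> Y" by (rule closed_sequentially[OF Y(2) _ z[OF j]])
      show "norm (z j - x) \<le> r"
      proof (rule LIMSEQ_le_const2)
        show "(\<lambda>n. norm (zs n j - x)) \<longlonglongrightarrow> norm (z j - x)" by (intro tendsto_intros z j)
        show "\<exists>N. \<forall>n\<ge>N. norm (zs n j - x) \<le> r" using zs j by (auto simp: D_def)
      qed
    qed
    moreover have "z None - x \<in> L"
    proof (rule closed_sequentially[OF L(2)])
      show "zs n None - x \<in> L" for n using zs[of n] by (simp add: D_def)
      show "(\<lambda>n. zs n None - x) \<longlonglongrightarrow> z None - x" by (intro tendsto_intros z JN)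
    qed
    ultimately have zD: "z \<in> D" by (simp add: D_def)
    have \<phi>lim: "(\<lambda>n. \<phi> t (zs n (Some t))) \<longlonglongrightarrow> \<phi> t (z (Some t))" if t: "t \<in> F" for t
    proof (rule metric_tendsto_imp_tendsto)
      have "(\<lambda>n. c * norm (zs n (Some t) - z (Some t))) \<longlonglongrightarrow> c * norm (z (Some t) - z (Some t))"
        by (intro tendsto_intros z JS t)
      then show "(\<lambda>n. c * norm (zs n (Some t) - z (Some t))) \<longlonglongrightarrow> 0" by simp
      show "\<forall>\<^sub>F n in sequentially. dist (\<phi> t (zs n (Some t))) (\<phi> t (z (Some t)))
          \<le> dist (c * norm (zs n (Some t) - z (Some t))) 0"
        using lip[OF t] c by (auto simp: dist_real_def abs_mult)
    qed
    have \<xi>lim: "(\<lambda>n. \<xi> (f n)) \<longlonglongrightarrow> \<xi> a" if "f \<longlonglongrightarrow> a" for f a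
      using bounded_linear.tendsto[OF bounded_linear_intro[of \<xi> K] that] \<xi>
      by (simp add: linear_add linear_scale mult.commute)
    have "(\<lambda>n. G (zs n)) \<longlonglongrightarrow> G z"
      unfolding G_def
      by (intro tendsto_intros lse_tendsto[OF F \<beta>0] \<phi>lim \<xi>lim gtends DYs zs zD z JN JS)
    moreover have "(\<lambda>n. S (zs n) w) \<longlonglongrightarrow> S z w" if w: "w \<in> D" for w
      unfolding S_def by (intro tendsto_intros gtends DY zs zD w z)
    ultimately show "\<exists>z\<in>D. (\<lambda>n. G (zs n)) \<longlonglongrightarrow> G z \<and> (\<forall>w\<in>D. (\<lambda>n. S (zs n) w) \<longlonglongrightarrow> S z w)"
      using zD by blast
  qed
  then obtain zs z where zs: "\<And>n. zs n \<in> D" and zD: "z \<in> D"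
    and zmin: "\<And>w. w \<in> D \<Longrightarrow> G z + (\<Sum>n. \<mu> n * S z (zs n)) \<le> G w + (\<Sum>n. \<mu> n * S w (zs n))"
    and zle: "G z + (\<Sum>n. \<mu> n * S z (zs n)) \<le> G x0" by blast
  have JN: "None \<in> J" and JS: "\<And>t. t \<in> F \<Longrightarrow> Some t \<in> J" by (auto simp: J_def)
  note ser = gauge_series_derivative[OF gauge Y(1), where \<mu> = \<mu>, OF _ _ less_imp_le[OF \<mu>0] sums_summable[OF \<mu>_sums]]
  have y: "z j - zs n j \<in> Y" "norm (z j - zs n j) \<le> 2 * r" if "j \<in> J" for j n
    using DY[OF zD zs that] Dnorm[OF zD zs that] by auto
  \<comment> \<open>The perturbation splits into one series for each variable; \<open>pj\<close> is
    that series and \<open>pd\<close> below its derivative at the minimiser.\<close>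
  define pj where "pj j y = (\<Sum>n. \<mu> n * s (y - zs n j))" for j y
  have Psum: "(\<Sum>n. \<mu> n * S W (zs n)) = (\<Sum>j\<in>J. pj j (W j))" if W: "W \<in> D" for W
  proof -
    have "summable (\<lambda>n. \<mu> n * s (W j - zs n j))" if "j \<in> J" for j
      using ser(1)[of "\<lambda>n. W j - zs n j" "2 * r"] DY[OF W zs that] Dnorm[OF W zs that] by blast
    then have "(\<Sum>n. \<Sum>j\<in>J. \<mu> n * s (W j - zs n j)) = (\<Sum>j\<in>J. pj j (W j))"
      unfolding pj_def by (intro suminf_sum)
    then show ?thesis by (simp add: S_def sum_distrib_left)
  qed
  define pd where "pd j h = (\<Sum>n. \<mu> n * g (z j - zs n j) h)" for j h
  have pd_lin: "linear_form_on Y (pd j)" if "j \<in> J" for j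
    unfolding pd_def using ser(2)[of "\<lambda>n. z j - zs n j" "2 * r"] y[OF that] by blast
  have pd_bound: "\<bar>pd j h\<bar> \<le> 4 * \<tau> * r * norm h" if "j \<in> J" "h \<in> Y" for j h
    using ser(3)[of "\<lambda>n. z j - zs n j" "2 * r", OF _ _ that(2)] y[OF that(1)] sums_unique[OF \<mu>_sums, symmetric]
    by (simp add: pd_def mult.assoc)
  have pd_upper: "\<exists>\<delta>>0. \<forall>h\<in>Y. norm h < \<delta> \<longrightarrow> pj j (z j + h) - pj j (z j) \<le> pd j h + \<epsilon> * norm h"
    if j: "j \<in> J" and \<epsilon>: "0 < \<epsilon>" for j \<epsilon>
  proof -
    have shift: "z j + h - zs n j = z j - zs n j + h" for n h by simp
    show ?thesis
      unfolding pj_def pd_def shift using y[OF j] \<epsilon> by (intro ser(4)[where R = "2 * r"])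
  qed
  have pj_nonneg: "0 \<le> pj j (z j)" if "j \<in> J" for j
    unfolding pj_def using y[OF that] less_imp_le[OF \<mu>0]
    by (intro suminf_nonneg ser(1)[of _ "2 * r"] mult_nonneg_nonneg gnonneg) auto
  have zmin': "G z + (\<Sum>j\<in>J. pj j (z j)) \<le> G W + (\<Sum>j\<in>J. pj j (W j))" if "W \<in> D" for W
    using zmin[OF that] Psum[OF that] Psum[OF zD] by simp
  have one: "G z + pj j (z j) \<le> G (z(j := y)) + pj j y" if j: "j \<in> J" and W: "z(j := y) \<in> D" for j y
  proof -
    have "(\<Sum>i\<in>J. pj i ((z(j := y)) i)) = pj j y + (\<Sum>i\<in>J - {j}. pj i (z i))"
      using sum.remove[OF J j, of "\<lambda>i. pj i ((z(j := y)) i)"] by simp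
    then show ?thesis using zmin'[OF W] sum.remove[OF J j, of "\<lambda>i. pj i (z i)"] by simp
  qed
  have "0 \<le> (\<Sum>j\<in>J. pj j (z j))" by (rule sum_nonneg[OF pj_nonneg])
  then have "G z \<le> fmax x + ln k / \<beta>" using zle Psum[OF zD] Gx0 by simp
  \<comment> \<open>The initial value exceeds the lower bound of the functional by at most
    C/\<beta>; this pays for all displacements.\<close>
  then have zC: "\<eta> * norm (z None - x) + \<beta> / 16 * (\<Sum>t\<in>F. (norm (z (Some t) - z None))\<^sup>2) \<le> C / \<beta>"
    using Glow[OF zD] by (simp add: C_def add_divide_distrib)
  have sq: "0 \<le> (\<Sum>t\<in>F. (norm (z (Some t) - z None))\<^sup>2)" by (intro sum_nonneg) simp
  have "0 \<le> \<beta> / 16 * (\<Sum>t\<in>F. (norm (z (Some t) - z None))\<^sup>2)" using \<beta>0 sq by simp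
  then have "\<eta> * norm (z None - x) < \<eta> * m" using zC C1 by linarith
  then have pm: "norm (z None - x) < m" using \<eta> by simp
  have am: "norm (z (Some t) - z None) < m" if t: "t \<in> F" for t
  proof -
    have "(norm (z (Some t) - z None))\<^sup>2 \<le> (\<Sum>t\<in>F. (norm (z (Some t) - z None))\<^sup>2)"
      using t F by (intro member_le_sum) auto
    then have "\<beta> / 16 * (norm (z (Some t) - z None))\<^sup>2 \<le> \<beta> / 16 * (\<Sum>t\<in>F. (norm (z (Some t) - z None))\<^sup>2)"
      using \<beta>0 by simp
    also have "\<dots> \<le> C / \<beta>" using zC \<eta> norm_ge_zero[of "z None - x"] mult_nonneg_nonneg[of \<eta> "norm (z None - x)"] by linarith
    finally have "\<beta> * (norm (z (Some t) - z None))\<^sup>2 \<le> 16 * C / \<beta>" by (simp add: mult.commute)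
    moreover have "1 * (norm (z (Some t) - z None))\<^sup>2 \<le> \<beta> * (norm (z (Some t) - z None))\<^sup>2"
      using \<beta>(1) by (intro mult_right_mono) auto
    ultimately have "(norm (z (Some t) - z None))\<^sup>2 < m\<^sup>2" using C2 by linarith
    then show ?thesis using m by (simp add: power2_less_imp_less)
  qed
  have zx: "norm (z (Some t) - x) < 2 * m" if "t \<in> F" for t
    using norm_triangle_ineq[of "z (Some t) - z None" "z None - x"] am[OF that] pm by simp
  have m2: "2 * m < \<delta>" "2 * m < r" using \<delta> r m by (auto simp: m_def)
  define \<theta> where "\<theta> = softmax \<beta> F (\<lambda>t. \<phi> t (z (Some t)))"
  have \<theta>0: "0 < \<theta> t" for t unfolding \<theta>_def by (rule softmax_pos[OF F \<beta>0])
  define q where "q t = z (Some t) - z None" for t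
  have qY: "q t \<in> Y" if "t \<in> F" for t unfolding q_def by (rule DYs[OF zD that])
  \<comment> \<open>Vanishing of \<theta> t * w + \<beta> * g + pd, the stationarity condition in
    the variable \<open>Some t\<close>, solved for w.\<close>
  define w where "w t h = - (\<beta> * g (q t) h + pd (Some t) h) / \<theta> t" for t h
  have w_lin: "linear_form_on Y (w t)" if t: "t \<in> F" for t
    using glin[OF qY[OF t]] pd_lin[OF JS[OF t]] \<theta>0[of t]
    unfolding linear_form_on_def w_def by (auto simp: field_simps)
  have w_fr: "frechet_at (\<phi> t) Y (z (Some t)) (w t)" if t: "t \<in> F" for t
    unfolding frechet_at_def
  proof (intro allI impI)
    fix \<epsilon> :: real assume \<epsilon>: "0 < \<epsilon>"
    define \<epsilon>' where "\<epsilon>' = \<epsilon> * \<theta> t / (c + \<beta> + 1)"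
    have cb: "c + \<beta> + 1 > 0" using c \<beta>0 by simp
    have \<epsilon>': "\<epsilon>' > 0" using \<epsilon> \<theta>0[of t] cb by (simp add: \<epsilon>'_def)
    obtain d1 where d1: "d1 > 0" "\<And>b. \<bar>b - \<phi> t (z (Some t))\<bar> < d1 \<Longrightarrow>
        lse \<beta> F ((\<lambda>t. \<phi> t (z (Some t)))(t := b)) \<le> lse \<beta> F (\<lambda>t. \<phi> t (z (Some t)))
          + \<theta> t * (b - \<phi> t (z (Some t))) + \<epsilon>' * \<bar>b - \<phi> t (z (Some t))\<bar>"
      using lse_update_le[OF F \<beta>0 t \<epsilon>', of "\<lambda>t. \<phi> t (z (Some t))"] unfolding \<theta>_def by blast
    obtain d2 where d2: "d2 > 0" "\<And>h k. h \<in> Y \<Longrightarrow> norm h < d2 \<Longrightarrow> k \<in> Y \<Longrightarrow> \<bar>g (q t + h) k - g (q t) k\<bar> \<le> \<epsilon>' * norm k"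
      using gauge_derivative_continuous[OF gauge Y(1) qY[OF t] \<epsilon>'] by blast
    obtain d3 where d3: "d3 > 0" "\<And>h. h \<in> Y \<Longrightarrow> norm h < d3 \<Longrightarrow>
        pj (Some t) (z (Some t) + h) - pj (Some t) (z (Some t)) \<le> pd (Some t) h + \<epsilon>' * norm h"
      using pd_upper[OF JS[OF t] \<epsilon>'] by blast
    define d where "d = min (min (d1 / (c + 1)) d2) (min d3 (r - 2 * m))"
    have d: "d > 0" using d1 d2 d3 m2 c by (simp add: d_def)
    have "w t h \<le> \<phi> t (z (Some t) + h) - \<phi> t (z (Some t)) + \<epsilon> * norm h" if h: "h \<in> Y" "norm h < d" for h
    proof -
      define b where "b = \<phi> t (z (Some t) + h)"
      define W where "W = z(Some t := z (Some t) + h)"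
      have "norm (z (Some t) + h - x) \<le> r"
        using norm_triangle_ineq[of "z (Some t) - x" h] zx[OF t] h(2) by (simp add: d_def algebra_simps)
      moreover have "z (Some t) + h \<in> Y" using zD JS[OF t] h(1) Y(1) by (auto simp: D_def intro: subspace_add)
      ultimately have WD: "W \<in> D" using zD by (auto simp: D_def W_def)
      have lse_eq: "lse \<beta> F (\<lambda>t. \<phi> t (W (Some t))) = lse \<beta> F ((\<lambda>t. \<phi> t (z (Some t)))(t := b))"
        by (rule arg_cong[of _ _ "lse \<beta> F"]) (auto simp: W_def b_def)
      have "(\<Sum>t'\<in>F. s (W (Some t') - W None)) = s (q t + h) + (\<Sum>t'\<in>F - {t}. s (q t'))"
        using sum.remove[OF F(1) t, of "\<lambda>t'. s (W (Some t') - W None)"]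
        by (simp add: W_def q_def algebra_simps)
      moreover have "(\<Sum>t'\<in>F. s (z (Some t') - z None)) = s (q t) + (\<Sum>t'\<in>F - {t}. s (q t'))"
        using sum.remove[OF F(1) t, of "\<lambda>t'. s (q t')"] by (simp add: q_def)
      ultimately have "G W - G z = lse \<beta> F ((\<lambda>t. \<phi> t (z (Some t)))(t := b)) - lse \<beta> F (\<lambda>t. \<phi> t (z (Some t)))
          + \<beta> * (s (q t + h) - s (q t))"
        unfolding G_def lse_eq by (simp add: W_def algebra_simps)
      moreover have "G z + pj (Some t) (z (Some t)) \<le> G W + pj (Some t) (z (Some t) + h)"
        using one[OF JS[OF t]] WD by (simp add: W_def)
      moreover have "\<bar>b - \<phi> t (z (Some t))\<bar> \<le> c * norm h"
        using lip[OF t, of "z (Some t) + h" "z (Some t)"] by (simp add: b_def)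
      moreover from this have "\<bar>b - \<phi> t (z (Some t))\<bar> < d1"
      proof -
        have "c * norm h \<le> (c + 1) * norm h" by (simp add: mult_right_mono)
        also have "\<dots> < d1" using h(2) c by (simp add: d_def field_simps)
        finally show ?thesis using \<open>\<bar>b - \<phi> t (z (Some t))\<bar> \<le> c * norm h\<close> by simp
      qed
      from d1(2)[OF this] have "lse \<beta> F ((\<lambda>t. \<phi> t (z (Some t)))(t := b)) - lse \<beta> F (\<lambda>t. \<phi> t (z (Some t)))
          \<le> \<theta> t * (b - \<phi> t (z (Some t))) + \<epsilon>' * \<bar>b - \<phi> t (z (Some t))\<bar>" by simp
      moreover have "\<epsilon>' * \<bar>b - \<phi> t (z (Some t))\<bar> \<le> \<epsilon>' * (c * norm h)"
        using \<epsilon>' \<open>\<bar>b - \<phi> t (z (Some t))\<bar> \<le> c * norm h\<close> by simp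
      moreover have "s (q t + h) - s (q t) \<le> g (q t) h + \<epsilon>' * norm h"
        using gupper[OF qY[OF t] h(1)] d2(2)[OF h(1) _ h(1)] h(2) by (simp add: d_def)
      then have "\<beta> * (s (q t + h) - s (q t)) \<le> \<beta> * (g (q t) h + \<epsilon>' * norm h)" using \<beta>0 by simp
      moreover have "pj (Some t) (z (Some t) + h) - pj (Some t) (z (Some t)) \<le> pd (Some t) h + \<epsilon>' * norm h"
        using d3(2)[OF h(1)] h(2) by (simp add: d_def)
      ultimately have "0 \<le> \<theta> t * (b - \<phi> t (z (Some t))) + \<epsilon>' * (c * norm h) + \<beta> * (g (q t) h + \<epsilon>' * norm h)
          + (pd (Some t) h + \<epsilon>' * norm h)" by linarith
      also have "\<dots> = \<theta> t * (b - \<phi> t (z (Some t))) + (\<beta> * g (q t) h + pd (Some t) h) + \<epsilon>' * (c + \<beta> + 1) * norm h"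
        by (simp add: algebra_simps)
      also have "\<epsilon>' * (c + \<beta> + 1) = \<epsilon> * \<theta> t" using cb by (simp add: \<epsilon>'_def)
      finally have "- (\<beta> * g (q t) h + pd (Some t) h) \<le> \<theta> t * (b - \<phi> t (z (Some t)) + \<epsilon> * norm h)"
        by (simp add: algebra_simps)
      then show ?thesis using \<theta>0[of t] by (simp add: w_def b_def divide_le_eq mult.commute)
    qed
    then show "\<exists>\<delta>>0. \<forall>h\<in>Y. norm h < \<delta> \<longrightarrow> w t h \<le> \<phi> t (z (Some t) + h) - \<phi> t (z (Some t)) + \<epsilon> * norm h"
      using d by blast
  qed
  \<comment> \<open>The negative derivative of the smooth terms as the slice point moves. Minimality
    makes it a Frechet subgradient of 2\<eta> times the norm at 0, hence bounded by 2\<eta>. The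
    gauge term has a plus sign because moving the slice point by l moves every \<open>q t\<close> by
    - l.\<close>
  define v where "v l = \<xi> l + \<beta> * (\<Sum>t\<in>F. g (q t) l) - pd None l" for l
  have v_lin: "linear_form_on L v"
    using glin[OF qY] pd_lin[OF JN] L(3) \<xi>(1) unfolding linear_form_on_def v_def
    by (auto simp: linear_add linear_scale algebra_simps sum.distrib sum_distrib_left subset_iff)
  have v_fr: "frechet_at (\<lambda>l. 2 * \<eta> * norm l) L 0 v"
    unfolding frechet_at_def
  proof (intro allI impI)
    fix \<epsilon> :: real assume \<epsilon>: "0 < \<epsilon>"
    define \<epsilon>' where "\<epsilon>' = \<epsilon> / (\<beta> * k + 1)"
    have bk: "\<beta> * k + 1 > 0" using \<beta>0 k by (simp add: add_pos_pos)
    have \<epsilon>': "\<epsilon>' > 0" using \<epsilon> bk by (simp add: \<epsilon>'_def)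
    have "\<exists>d. \<forall>t\<in>F. d t > 0 \<and> (\<forall>h\<in>Y. norm h < d t \<longrightarrow> (\<forall>k\<in>Y. \<bar>g (q t + h) k - g (q t) k\<bar> \<le> \<epsilon>' * norm k))"
      using gauge_derivative_continuous[OF gauge Y(1) qY \<epsilon>'] by (intro bchoice) blast
    then obtain d2 where d2: "\<And>t. t \<in> F \<Longrightarrow> d2 t > 0" "\<And>t h k. t \<in> F \<Longrightarrow> h \<in> Y \<Longrightarrow> norm h < d2 t \<Longrightarrow> k \<in> Y \<Longrightarrow>
        \<bar>g (q t + h) k - g (q t) k\<bar> \<le> \<epsilon>' * norm k" by blast
    obtain d3 where d3: "d3 > 0" "\<And>h. h \<in> Y \<Longrightarrow> norm h < d3 \<Longrightarrow>
        pj None (z None + h) - pj None (z None) \<le> pd None h + \<epsilon>' * norm h"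
      using pd_upper[OF JN \<epsilon>'] by blast
    define d where "d = min (Min (d2 ` F)) (min d3 (r - 2 * m))"
    have d: "d > 0" using d2(1) d3 m2 F by (simp add: d_def)
    have "v l \<le> 2 * \<eta> * norm (0 + l) - 2 * \<eta> * norm (0::'a) + \<epsilon> * norm l" if l: "l \<in> L" "norm l < d" for l
    proof -
      define h where "h = - l"
      have lY: "l \<in> Y" using l L(3) by blast
      have h: "h \<in> Y" "norm h = norm l" using subspace_neg[OF Y(1) lY] by (auto simp: h_def)
      define W where "W = z(None := z None + l)"
      have "norm (z None + l - x) \<le> r"
        using norm_triangle_ineq[of "z None - x" l] pm m l(2) by (simp add: d_def algebra_simps)
      moreover have "z None + l \<in> Y" using zD JN lY Y(1) by (auto simp: D_def intro: subspace_add)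
      moreover have "z None + l - x \<in> L"
      proof -
        have "(z None - x) + l \<in> L" using zD l(1) L(1) by (auto simp: D_def intro: subspace_add)
        then show ?thesis by (simp add: algebra_simps)
      qed
      ultimately have WD: "W \<in> D" using zD by (auto simp: D_def W_def)
      have qs: "z (Some t) - W None = q t + h" for t by (simp add: W_def q_def h_def)
      have WN: "W None - x = (z None - x) + l" by (simp add: W_def)
      have \<xi>W: "\<xi> (W None - x) = \<xi> (z None - x) + \<xi> l"
        unfolding WN by (rule linear_add[OF \<xi>(1)])
      have WS: "W (Some t) = z (Some t)" for t by (simp add: W_def)
      have GW: "G W - G z = \<beta> * (\<Sum>t\<in>F. s (q t + h) - s (q t)) - \<xi> l + 2 * \<eta> * (norm (W None - x) - norm (z None - x))"
        unfolding G_def qs \<xi>W WS q_def[symmetric] by (simp add: sum_subtractf algebra_simps)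
      have "norm (W None - x) - norm (z None - x) \<le> norm l"
        using norm_triangle_ineq[of "z None - x" l] unfolding WN by simp
      then have nl: "2 * \<eta> * (norm (W None - x) - norm (z None - x)) \<le> 2 * \<eta> * norm l" using \<eta> by simp
      have "s (q t + h) - s (q t) \<le> - g (q t) l + \<epsilon>' * norm l" if t: "t \<in> F" for t
      proof -
        have "norm h < d2 t" using l(2) h(2) t F by (simp add: d_def)
        then have "\<bar>g (q t + h) h - g (q t) h\<bar> \<le> \<epsilon>' * norm l" using d2(2)[OF t h(1) _ h(1)] h(2) by simp
        moreover have "g (q t) ((-1) *\<^sub>R l) = (-1) * g (q t) l"
          using glin[OF qY[OF t]] lY unfolding linear_form_on_def by blast
        ultimately show ?thesis using gupper[OF qY[OF t] h(1)] by (simp add: h_def)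
      qed
      then have "(\<Sum>t\<in>F. s (q t + h) - s (q t)) \<le> (\<Sum>t\<in>F. - g (q t) l + \<epsilon>' * norm l)" by (rule sum_mono)
      also have "\<dots> = - (\<Sum>t\<in>F. g (q t) l) + k * \<epsilon>' * norm l" by (simp add: sum_subtractf k_def)
      finally have "\<beta> * (\<Sum>t\<in>F. s (q t + h) - s (q t)) \<le> \<beta> * (- (\<Sum>t\<in>F. g (q t) l) + k * \<epsilon>' * norm l)"
        using \<beta>0 by simp
      moreover have "pj None (z None + l) - pj None (z None) \<le> pd None l + \<epsilon>' * norm l"
        using d3(2)[OF lY] l(2) by (simp add: d_def)
      moreover have "G z + pj None (z None) \<le> G W + pj None (z None + l)"
        using one[OF JN] WD by (simp add: W_def)
      ultimately have "0 \<le> \<beta> * (- (\<Sum>t\<in>F. g (q t) l) + k * \<epsilon>' * norm l) - \<xi> l + 2 * \<eta> * norm l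
          + (pd None l + \<epsilon>' * norm l)" using GW nl by linarith
      also have "\<dots> = - v l + 2 * \<eta> * norm l + \<epsilon>' * (\<beta> * k + 1) * norm l"
        by (simp add: v_def algebra_simps)
      also have "\<epsilon>' * (\<beta> * k + 1) = \<epsilon>" using bk by (simp add: \<epsilon>'_def)
      finally show ?thesis by simp
    qed
    then show "\<exists>\<delta>>0. \<forall>h\<in>L. norm h < \<delta> \<longrightarrow> v h \<le> 2 * \<eta> * norm (0 + h) - 2 * \<eta> * norm (0::'a) + \<epsilon> * norm h"
      using d by blast
  qed
  have vb: "\<bar>v l\<bar> \<le> 2 * \<eta> * norm l" if "l \<in> L" for l
  proof (rule frechet_at_bound[OF v_lin L(1) _ v_fr that])
    fix a b :: 'a
    have "\<bar>2 * \<eta> * norm a - 2 * \<eta> * norm b\<bar> = 2 * \<eta> * \<bar>norm a - norm b\<bar>"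
      using \<eta> by (simp add: abs_mult right_diff_distrib[symmetric])
    also have "\<dots> \<le> 2 * \<eta> * norm (a - b)" using \<eta> by (simp add: norm_triangle_ineq3)
    finally show "\<bar>2 * \<eta> * norm a - 2 * \<eta> * norm b\<bar> \<le> 2 * \<eta> * norm (a - b)" .
  qed
  have sumw: "\<bar>(\<Sum>t\<in>F. \<theta> t * w t l) - \<xi> l\<bar> \<le> (2 * \<eta> + \<delta>) * norm l" if l: "l \<in> L" for l
  proof -
    have lY: "l \<in> Y" using l L(3) by blast
    have "(\<Sum>t\<in>F. \<theta> t * w t l) = (\<Sum>t\<in>F. - (\<beta> * g (q t) l) - pd (Some t) l)"
    proof (rule sum.cong[OF refl])
      fix t show "\<theta> t * w t l = - (\<beta> * g (q t) l) - pd (Some t) l"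
        using \<theta>0[of t] by (simp add: w_def field_simps)
    qed
    also have "\<dots> = - \<beta> * (\<Sum>t\<in>F. g (q t) l) - (\<Sum>t\<in>F. pd (Some t) l)"
      by (simp add: sum_subtractf sum_negf sum_distrib_left)
    \<comment> \<open>The gauge derivatives of the private variables and of the slice point cancel;
      only v and the perturbation remain.\<close>
    finally have eq: "(\<Sum>t\<in>F. \<theta> t * w t l) - \<xi> l = - v l - (\<Sum>j\<in>J. pd j l)"
      by (simp add: v_def sumJ)
    have "\<bar>\<Sum>j\<in>J. pd j l\<bar> \<le> (\<Sum>j\<in>J. 4 * \<tau> * r * norm l)"
      using pd_bound[OF _ lY] by (intro order_trans[OF sum_abs] sum_mono) blast
    also have "\<dots> = (k + 1) * (4 * \<tau> * r * norm l)" unfolding sumJ by (simp add: k_def algebra_simps)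
    also have "\<dots> = \<tau> * (4 * r * (k + 1)) * norm l" by (simp add: algebra_simps)
    also have "\<tau> * (4 * r * (k + 1)) = \<delta>" using r k by (simp add: \<tau>_def)
    finally show ?thesis using eq vb[OF l] by (simp add: algebra_simps)
  qed
  have "\<forall>t\<in>F. z (Some t) \<in> Y \<and> norm (z (Some t) - x) < \<delta> \<and> linear_form_on Y (w t) \<and>
      frechet_at (\<phi> t) Y (z (Some t)) (w t) \<and> 0 < \<theta> t \<and>
      (\<forall>t'\<in>F. \<theta> t \<le> exp (\<beta> * (\<phi> t (z (Some t)) - \<phi> t' (z (Some t')))))"
  proof (intro ballI conjI)
    fix t assume t: "t \<in> F"
    show "z (Some t) \<in> Y" using zD JS[OF t] by (simp add: D_def)
    show "norm (z (Some t) - x) < \<delta>" using zx[OF t] m2 by simp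
    show "\<theta> t \<le> exp (\<beta> * (\<phi> t (z (Some t)) - \<phi> t' (z (Some t'))))" if "t' \<in> F" for t'
      unfolding \<theta>_def by (rule softmax_le[OF F \<beta>0 that])
  qed (use w_lin w_fr \<theta>0 in auto)
  moreover have "(\<Sum>t\<in>F. \<theta> t) = 1" unfolding \<theta>_def by (rule sum_softmax[OF F \<beta>0])
  ultimately show ?thesis using sumw \<beta>(2)
    by (intro exI[of _ "\<lambda>t. z (Some t)"] exI[of _ \<theta>] exI[of _ w] exI[of _ \<beta>]) blast
qed

subsection \<open>Exact multipliers\<close>

lemma closed_if_bounded_parts_compact:
  fixes S :: "'a::real_normed_vector set"
  assumes "\<And>R. compact (S \<inter> cball 0 R)"
  shows "closed S"
  unfolding closed_sequential_limits
proof (intro allI impI, elim conjE)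
  fix f l assume f: "\<forall>n. f n \<in> S" "f \<longlonglongrightarrow> l"
  have "Bseq f" using f(2) by (intro convergent_imp_Bseq convergentI)
  then obtain R where R: "\<And>n. norm (f n) \<le> R" by (meson BseqE)
  have "closed (S \<inter> cball 0 R)" by (rule compact_imp_closed[OF assms])
  then have "l \<in> S \<inter> cball 0 R"
    by (rule closed_sequentially[OF _ _ f(2)]) (use f(1) R in auto)
  then show "l \<in> S" by simp
qed

text \<open>If v lies outside the closed span of V, its positive distance d from that span bounds
  the coefficient of v by norm y / d. The bounded part of the larger span therefore sits in a
  continuous image of a compact product.\<close>

lemma compact_span_cball:
  fixes V :: "'a::real_normed_vector set"
  assumes "finite V"
  shows "compact (span V \<inter> cball 0 R)"
  using assms
proof (induction V arbitrary: R rule: finite_induct)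
  case empty
  have "span {} \<inter> cball 0 R \<subseteq> {0::'a}" by simp
  then show ?case by (meson finite.emptyI finite_imp_compact finite_insert finite_subset)
next
  case (insert v V)
  have cl: "closed (span V)" by (rule closed_if_bounded_parts_compact[OF insert.IH])
  show ?case
  proof (cases "v \<in> span V")
    case True
    then show ?thesis using insert.IH by (simp add: span_redundant)
  next
    case False
    then have "v \<in> - span V" "open (- span V)" using cl by auto
    then obtain d where d: "d > 0" "ball v d \<subseteq> - span V" using open_contains_ball by blast
    have far: "d \<le> norm (v - u)" if "u \<in> span V" for u
    proof (rule ccontr)
      assume "\<not> ?thesis"
      then have "u \<in> ball v d" by (simp add: dist_norm)
      then show False using d(2) that by blast
    qed
    define M where "M = \<bar>R\<bar> / d"
    define K where "K = (\<lambda>(a, u). a *\<^sub>R v + u) ` ({- M..M} \<times> (span V \<inter> cball 0 (\<bar>R\<bar> + M * norm v)))"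
    have "compact K"
      unfolding K_def
      by (intro compact_continuous_image compact_Times insert.IH compact_Icc)
         (auto simp: case_prod_unfold intro!: continuous_intros)
    moreover have "span (insert v V) \<inter> cball 0 R = K \<inter> cball 0 R"
    proof (intro equalityI subsetI IntI)
      fix y assume y: "y \<in> span (insert v V) \<inter> cball 0 R"
      then obtain a where a: "y - a *\<^sub>R v \<in> span V" by (auto simp: span_breakdown_eq)
      have yR: "norm y \<le> \<bar>R\<bar>" using y by auto
      have aM: "\<bar>a\<bar> \<le> M"
      proof (cases "a = 0")
        case False
        have "(- 1 / a) *\<^sub>R (y - a *\<^sub>R v) \<in> span V" using a by (rule span_scale)
        from far[OF this] have "d \<le> norm ((1 / a) *\<^sub>R y)" using False by (simp add: algebra_simps)
        then have "d * \<bar>a\<bar> \<le> norm y" using False by (simp add: field_simps)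
        then show ?thesis using yR d(1) by (simp add: M_def field_simps)
      qed (use d(1) in \<open>simp add: M_def\<close>)
      have "norm (y - a *\<^sub>R v) \<le> norm y + \<bar>a\<bar> * norm v" using norm_triangle_ineq4[of y "a *\<^sub>R v"] by simp
      also have "\<dots> \<le> \<bar>R\<bar> + M * norm v" using yR aM by (intro add_mono mult_right_mono) auto
      finally have "(a, y - a *\<^sub>R v) \<in> {- M..M} \<times> (span V \<inter> cball 0 (\<bar>R\<bar> + M * norm v))"
        using a aM by auto
      then show "y \<in> K" unfolding K_def by (rule image_eqI[rotated]) simp
      show "y \<in> cball 0 R" using y by simp
    next
      fix y assume "y \<in> K \<inter> cball 0 R"
      then obtain a u where u: "u \<in> span V" "y = a *\<^sub>R v + u" by (auto simp: K_def)
      then show "y \<in> span (insert v V)" by (auto simp: span_breakdown_eq intro!: exI[of _ a])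
    qed auto
    ultimately show ?thesis by (simp add: compact_Int_closed)
  qed
qed

lemma closed_span_finite: "finite V \<Longrightarrow> closed (span V :: 'a::real_normed_vector set)"
  by (rule closed_if_bounded_parts_compact[OF compact_span_cball])

lemma common_subsequence:
  assumes F: "finite F"
    and step: "\<And>t s. t \<in> F \<Longrightarrow> strict_mono (s :: nat \<Rightarrow> nat) \<Longrightarrow> \<exists>r. strict_mono r \<and> P t (s \<circ> r)"
    and hered: "\<And>t s r. P t s \<Longrightarrow> strict_mono (r :: nat \<Rightarrow> nat) \<Longrightarrow> P t (s \<circ> r)"
  shows "\<exists>s. strict_mono s \<and> (\<forall>t\<in>F. P t s)"
  using F step
proof (induction F rule: finite_induct)
  case empty
  show ?case by (intro exI[of _ id]) (simp add: strict_mono_def)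
next
  case (insert t F)
  then obtain s where s: "strict_mono s" "\<forall>t\<in>F. P t s" by blast
  obtain r where r: "strict_mono r" "P t (s \<circ> r)" using insert.prems[of t s] s(1) by blast
  then show ?case using s hered[OF _ r(1)] strict_mono_o[OF s(1) r(1)] by blast
qed

definition limiting_at :: "('a::real_normed_vector \<Rightarrow> real) \<Rightarrow> 'a \<Rightarrow> ('a \<Rightarrow> real) \<Rightarrow> bool" where
  "limiting_at \<phi> x u \<longleftrightarrow> (\<exists>zs us. zs \<longlonglongrightarrow> x \<and>
     (\<forall>n. linear (us n) \<and> frechet_at \<phi> UNIV (zs n) (us n)) \<and> (\<forall>y. (\<lambda>n. us n y) \<longlonglongrightarrow> u y))"

text \<open>Approximate multipliers with \<delta> = 1/(n+1) are computed in one fixed separable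
  subspace, their subgradients are extended to the whole space, and a common subsequence of
  subgradients and weights converges. All base points tend to x, so the limits are limiting
  subgradients there.\<close>

lemma exact_multipliers:
  fixes \<phi> :: "'i \<Rightarrow> 'a::banach \<Rightarrow> real"
  assumes A: "asplund TYPE('a)" and V: "finite V" and F: "finite F" "F \<noteq> {}" and c: "0 \<le> c"
    and lip: "\<And>t x y. t \<in> F \<Longrightarrow> \<bar>\<phi> t x - \<phi> t y\<bar> \<le> c * norm (x - y)"
    and \<xi>: "linear \<xi>" "\<And>v. \<bar>\<xi> v\<bar> \<le> K * norm v" and \<eta>: "0 < \<eta>" and r: "0 < r"
    and growth: "\<And>l. l \<in> span V \<Longrightarrow> norm l \<le> r \<Longrightarrow>
      Max ((\<lambda>t. \<phi> t x) ` F) + \<xi> l - \<eta> * norm l \<le> Max ((\<lambda>t. \<phi> t (x + l)) ` F)"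
  shows "\<exists>\<theta> u. (\<Sum>t\<in>F. \<theta> t) = 1 \<and>
    (\<forall>t\<in>F. 0 \<le> \<theta> t \<and> linear (u t) \<and> (\<forall>y. \<bar>u t y\<bar> \<le> c * norm y) \<and> limiting_at (\<phi> t) x (u t) \<and>
       (0 < \<theta> t \<longrightarrow> \<phi> t x = Max ((\<lambda>t. \<phi> t x) ` F))) \<and>
    (\<forall>v\<in>V. \<bar>(\<Sum>t\<in>F. \<theta> t * u t v) - \<xi> v\<bar> \<le> 2 * \<eta> * norm v)"
proof -
  \<comment> \<open>One set rich for every function of F, and containing x and V, so that the slice
    lies in the subspace and the extension works for all n and t.\<close>
  obtain D where D: "insert x V \<subseteq> D" "\<And>t. t \<in> F \<Longrightarrow> rich_for (\<phi> t) c D" "subspace (closure D)"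
      "separable_space (top_of_set (closure D))"
    using rich_set_exists[OF countable_finite[OF F(1)], of "insert x V" \<phi> c] V
    by (auto simp: countable_finite)
  define Y where "Y = closure D"
  have Y: "subspace Y" "closed Y" using D(3) by (simp_all add: Y_def)
  have xVY: "x \<in> Y" "V \<subseteq> Y" using D(1) closure_subset[of D] by (auto simp: Y_def)
  have LY: "span V \<subseteq> Y" by (rule span_minimal[OF xVY(2) Y(1)])
  have "separable_subspace_dual Y" using A D(3,4) by (simp add: asplund_def Y_def)
  then obtain s g where gauge: "smooth_gauge Y s g"
    using smooth_gauge_exists[OF Y(1)] D(4) unfolding Y_def by blast
  define good where "good n = (\<lambda>(z, \<theta>, w, \<beta>). 1 / (1 / Suc n) \<le> \<beta> \<and> (\<Sum>t\<in>F. \<theta> t) = 1 \<and>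
    (\<forall>t\<in>F. z t \<in> Y \<and> norm (z t - x) < 1 / Suc n \<and> linear_form_on Y (w t) \<and> frechet_at (\<phi> t) Y (z t) (w t) \<and>
       0 < \<theta> t \<and> (\<forall>t'\<in>F. \<theta> t \<le> exp (\<beta> * (\<phi> t (z t) - \<phi> t' (z t'))))) \<and>
    (\<forall>v\<in>span V. \<bar>(\<Sum>t\<in>F. \<theta> t * w t v) - \<xi> v\<bar> \<le> (2 * \<eta> + 1 / Suc n) * norm v))" for n
  have "\<exists>z \<theta> w \<beta>. good n (z, \<theta>, w, \<beta>)" for n
    unfolding good_def prod.case
    by (rule approximate_multipliers[OF gauge Y subspace_span closed_span_finite[OF V] LY F c lip xVY(1) \<xi> \<eta> r growth])
       (auto simp del: of_nat_Suc)
  then have "\<exists>p. good n p" for n by blast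
  then obtain p where p: "\<And>n. good n (p n)" by metis
  define z where "z n = fst (p n)" for n
  define \<theta> where "\<theta> n = fst (snd (p n))" for n
  define w where "w n = fst (snd (snd (p n)))" for n
  define \<beta> where "\<beta> n = snd (snd (snd (p n)))" for n
  have pn: "good n (z n, \<theta> n, w n, \<beta> n)" for n
    using p[of n] by (simp add: z_def \<theta>_def w_def \<beta>_def)
  have \<beta>: "real (Suc n) \<le> \<beta> n" and \<theta>1: "(\<Sum>t\<in>F. \<theta> n t) = 1" for n
    using pn[of n] by (simp_all add: good_def)
  have z: "z n t \<in> Y \<and> norm (z n t - x) < 1 / Suc n"
    and w: "linear_form_on Y (w n t) \<and> frechet_at (\<phi> t) Y (z n t) (w n t)"
    and \<theta>0: "0 < \<theta> n t" if "t \<in> F" for n t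
    using pn[of n] that unfolding good_def prod.case by blast+
  have \<theta>exp: "\<theta> n t \<le> exp (\<beta> n * (\<phi> t (z n t) - \<phi> t' (z n t')))" if "t \<in> F" "t' \<in> F" for n t t'
    using pn[of n] that unfolding good_def prod.case by blast
  have sumw: "\<bar>(\<Sum>t\<in>F. \<theta> n t * w n t v) - \<xi> v\<bar> \<le> (2 * \<eta> + 1 / Suc n) * norm v" if "v \<in> span V" for n v
    using pn[of n] that unfolding good_def prod.case by blast
  define ext where "ext n t u \<longleftrightarrow> linear u \<and> (\<forall>x. \<bar>u x\<bar> \<le> c * norm x) \<and>
      frechet_at (\<phi> t) UNIV (z n t) u \<and> (\<forall>y\<in>Y. u y = w n t y)" for n t u
  define u where "u n t = (SOME u. ext n t u)" for n t
  have "ext n t (u n t)" if "t \<in> F" for n t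
  proof -
    have "\<exists>u. ext n t u"
      unfolding ext_def
      by (rule frechet_at_extend[OF D(2)[OF that] Y_def Y(1) c lip[OF that]]) (use z w that in auto)
    then show ?thesis unfolding u_def by (rule someI_ex)
  qed
  then have u: "\<And>n t. t \<in> F \<Longrightarrow> linear (u n t)"
    "\<And>n t x. t \<in> F \<Longrightarrow> \<bar>u n t x\<bar> \<le> c * norm x"
    "\<And>n t. t \<in> F \<Longrightarrow> frechet_at (\<phi> t) UNIV (z n t) (u n t)"
    "\<And>n t y. t \<in> F \<Longrightarrow> y \<in> Y \<Longrightarrow> u n t y = w n t y"
    unfolding ext_def by blast+
  have \<theta>le: "\<theta> n t \<le> 1" if "t \<in> F" for n t
    using member_le_sum[of t F "\<theta> n"] that \<theta>0 F(1) \<theta>1[of n] by (force intro: less_imp_le)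
  define P where "P t s \<longleftrightarrow> (\<exists>v. linear v \<and> (\<forall>y. (\<lambda>n. u (s n) t y) \<longlonglongrightarrow> v y)) \<and> convergent (\<lambda>n. \<theta> (s n) t)"
    for t and s :: "nat \<Rightarrow> nat"
  have "\<exists>s. strict_mono s \<and> (\<forall>t\<in>F. P t s)"
  proof (rule common_subsequence[OF F(1)])
    fix t and s :: "nat \<Rightarrow> nat" assume t: "t \<in> F" and s: "strict_mono s"
    obtain r v where r: "strict_mono r" "linear v" "\<And>y. (\<lambda>n. u (s (r n)) t y) \<longlonglongrightarrow> v y"
      using asplund_dual_sequentially_compact[OF A, of "\<lambda>n. u (s n) t" c] u(1,2)[OF t] by blast
    have "\<bar>\<theta> n t\<bar> \<le> 1" for n using \<theta>0[OF t, of n] \<theta>le[OF t, of n] by simp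
    then have "bounded (range (\<lambda>n. \<theta> (s (r n)) t))"
      unfolding bounded_iff by (intro exI[of _ 1]) auto
    then obtain l r' where r': "strict_mono r'" "((\<lambda>n. \<theta> (s (r n)) t) \<circ> r') \<longlonglongrightarrow> l"
      using bounded_imp_convergent_subsequence by blast
    have "(\<lambda>n. u (s (r (r' n))) t y) \<longlonglongrightarrow> v y" for y
      using LIMSEQ_subseq_LIMSEQ[OF r(3) r'(1)] by (simp add: o_def)
    then have "P t (s \<circ> (r \<circ> r'))"
      using r(2) r'(2) by (auto simp: P_def o_def convergent_def)
    then show "\<exists>r. strict_mono r \<and> P t (s \<circ> r)" using strict_mono_o[OF r(1) r'(1)] by blast
  next
    fix t and s r :: "nat \<Rightarrow> nat" assume "P t s" and r: "strict_mono r"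
    then obtain v l where v: "linear v" "\<And>y. (\<lambda>n. u (s n) t y) \<longlonglongrightarrow> v y" "(\<lambda>n. \<theta> (s n) t) \<longlonglongrightarrow> l"
      by (auto simp: P_def convergent_def)
    have "(\<lambda>n. u (s (r n)) t y) \<longlonglongrightarrow> v y" for y
      using LIMSEQ_subseq_LIMSEQ[OF v(2) r] by (simp add: o_def)
    moreover have "(\<lambda>n. \<theta> (s (r n)) t) \<longlonglongrightarrow> l"
      using LIMSEQ_subseq_LIMSEQ[OF v(3) r] by (simp add: o_def)
    ultimately show "P t (s \<circ> r)" using v(1) by (auto simp: P_def convergent_def)
  qed
  then obtain \<sigma> where \<sigma>: "strict_mono \<sigma>" "\<And>t. t \<in> F \<Longrightarrow> P t \<sigma>" by blast
  have "\<exists>v l. linear v \<and> (\<forall>y. (\<lambda>n. u (\<sigma> n) t y) \<longlonglongrightarrow> v y) \<and> (\<lambda>n. \<theta> (\<sigma> n) t) \<longlonglongrightarrow> l" if "t \<in> F" for t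
    using \<sigma>(2)[OF that] by (auto simp: P_def convergent_def)
  then obtain v l where v: "\<And>t. t \<in> F \<Longrightarrow> linear (v t)" "\<And>t y. t \<in> F \<Longrightarrow> (\<lambda>n. u (\<sigma> n) t y) \<longlonglongrightarrow> v t y"
    and l: "\<And>t. t \<in> F \<Longrightarrow> (\<lambda>n. \<theta> (\<sigma> n) t) \<longlonglongrightarrow> l t"
    by metis
  have \<sigma>n: "n \<le> \<sigma> n" for n using seq_suble[OF \<sigma>(1)] .
  have small: "1 / real (Suc (\<sigma> n)) \<le> 1 / real (Suc n)" for n
    using \<sigma>n[of n] by (intro divide_left_mono) auto
  have zlim: "(\<lambda>n. z (\<sigma> n) t) \<longlonglongrightarrow> x" if t: "t \<in> F" for t
  proof (rule metric_tendsto_imp_tendsto[OF LIMSEQ_Suc[OF lim_1_over_n]])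
    have "dist (z (\<sigma> n) t) x \<le> 1 / real (Suc n)" for n
      using z[OF t, of "\<sigma> n"] small[of n] by (simp add: dist_norm)
    then show "\<forall>\<^sub>F n in sequentially. dist (z (\<sigma> n) t) x \<le> dist (1 / real (Suc n)) 0"
      by (simp add: dist_real_def)
  qed
  have \<phi>lim: "(\<lambda>n. \<phi> t (z (\<sigma> n) t)) \<longlonglongrightarrow> \<phi> t x" if t: "t \<in> F" for t
  proof (rule metric_tendsto_imp_tendsto)
    have "(\<lambda>n. c * norm (z (\<sigma> n) t - x)) \<longlonglongrightarrow> c * norm (x - x)"
      by (intro tendsto_intros zlim t)
    then show "(\<lambda>n. c * norm (z (\<sigma> n) t - x)) \<longlonglongrightarrow> 0" by simp
    show "\<forall>\<^sub>F n in sequentially. dist (\<phi> t (z (\<sigma> n) t)) (\<phi> t x) \<le> dist (c * norm (z (\<sigma> n) t - x)) 0"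
      using lip[OF t] c by (auto simp: dist_real_def abs_mult)
  qed
  have "(\<lambda>n. \<Sum>t\<in>F. \<theta> (\<sigma> n) t) \<longlonglongrightarrow> (\<Sum>t\<in>F. l t)" by (intro tendsto_sum l)
  then have suml: "(\<Sum>t\<in>F. l t) = 1" using LIMSEQ_unique[OF _ tendsto_const] by (simp add: \<theta>1)
  have lnonneg: "0 \<le> l t" if "t \<in> F" for t
    using LIMSEQ_le_const[OF l[OF that], of 0] \<theta>0[OF that] less_imp_le by blast
  have "\<bar>v t y\<bar> \<le> c * norm y" if "t \<in> F" for t y
    using LIMSEQ_le_const2[OF tendsto_rabs[OF v(2)[OF that]]] u(2)[OF that] by blast
  moreover have "limiting_at (\<phi> t) x (v t)" if "t \<in> F" for t
    unfolding limiting_at_def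
    by (intro exI[of _ "\<lambda>n. z (\<sigma> n) t"] exI[of _ "\<lambda>n. u (\<sigma> n) t"]) (use zlim u v that in auto)
  moreover have "\<phi> t x = Max ((\<lambda>t. \<phi> t x) ` F)" if t: "t \<in> F" "0 < l t" for t
  proof (rule ccontr)
    assume ne: "\<phi> t x \<noteq> Max ((\<lambda>t. \<phi> t x) ` F)"
    have "Max ((\<lambda>t. \<phi> t x) ` F) \<in> (\<lambda>t. \<phi> t x) ` F" using F by (intro Max_in) auto
    then obtain t' where t': "t' \<in> F" "Max ((\<lambda>t. \<phi> t x) ` F) = \<phi> t' x" by blast
    have "\<phi> t x \<le> \<phi> t' x" unfolding t'(2)[symmetric] using F t by (intro Max_ge) auto
    \<comment> \<open>With half the gap to the maximum, the difference of values is eventually below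
      - \<gamma>; as \<beta> at index n of the subsequence is at least n, the weight is below a
      geometric sequence.\<close>
    define \<gamma> where "\<gamma> = (\<phi> t' x - \<phi> t x) / 2"
    have \<gamma>: "\<gamma> > 0" using \<open>\<phi> t x \<le> \<phi> t' x\<close> ne t'(2) by (simp add: \<gamma>_def)
    have "(\<lambda>n. \<phi> t (z (\<sigma> n) t) - \<phi> t' (z (\<sigma> n) t')) \<longlonglongrightarrow> \<phi> t x - \<phi> t' x"
      by (intro tendsto_diff \<phi>lim t t')
    then have "\<forall>\<^sub>F n in sequentially. \<phi> t (z (\<sigma> n) t) - \<phi> t' (z (\<sigma> n) t') < - \<gamma>"
      by (rule order_tendstoD) (use \<gamma> in \<open>simp add: \<gamma>_def field_simps\<close>)
    then have "\<forall>\<^sub>F n in sequentially. \<theta> (\<sigma> n) t \<le> exp (- \<gamma>) ^ n"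
    proof eventually_elim
      case (elim n)
      have "\<theta> (\<sigma> n) t \<le> exp (\<beta> (\<sigma> n) * (\<phi> t (z (\<sigma> n) t) - \<phi> t' (z (\<sigma> n) t')))" by (rule \<theta>exp[OF t(1) t'(1)])
      also have "\<dots> \<le> exp (real n * (- \<gamma>))"
      proof -
        have nb: "real n \<le> \<beta> (\<sigma> n)" using \<beta>[of "\<sigma> n"] \<sigma>n[of n] by linarith
        have "\<beta> (\<sigma> n) * (\<phi> t (z (\<sigma> n) t) - \<phi> t' (z (\<sigma> n) t')) \<le> \<beta> (\<sigma> n) * (- \<gamma>)"
          using elim nb by (intro mult_left_mono) auto
        also have "\<dots> \<le> real n * (- \<gamma>)" using nb \<gamma> by simp
        finally show ?thesis by simp
      qed
      also have "\<dots> = exp (- \<gamma>) ^ n" by (rule exp_of_nat_mult)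
      finally show ?case .
    qed
    then have "\<exists>N. \<forall>n\<ge>N. \<theta> (\<sigma> n) t \<le> exp (- \<gamma>) ^ n" by (simp add: eventually_sequentially)
    then have "l t \<le> 0"
      using \<gamma> by (intro LIMSEQ_le[OF l[OF t(1)] LIMSEQ_power_zero]) auto
    then show False using t(2) by simp
  qed
  moreover have "\<bar>(\<Sum>t\<in>F. l t * v t y) - \<xi> y\<bar> \<le> 2 * \<eta> * norm y" if y: "y \<in> V" for y
  proof (rule LIMSEQ_le)
    show "(\<lambda>n. \<bar>(\<Sum>t\<in>F. \<theta> (\<sigma> n) t * u (\<sigma> n) t y) - \<xi> y\<bar>) \<longlonglongrightarrow> \<bar>(\<Sum>t\<in>F. l t * v t y) - \<xi> y\<bar>"
      by (intro tendsto_intros l v)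
    have "(\<lambda>n. (2 * \<eta> + 1 / real (Suc n)) * norm y) \<longlonglongrightarrow> (2 * \<eta> + 0) * norm y"
      by (intro tendsto_intros LIMSEQ_Suc[OF lim_1_over_n])
    then show "(\<lambda>n. (2 * \<eta> + 1 / real (Suc n)) * norm y) \<longlonglongrightarrow> 2 * \<eta> * norm y" by simp
    have "\<bar>(\<Sum>t\<in>F. \<theta> (\<sigma> n) t * u (\<sigma> n) t y) - \<xi> y\<bar> \<le> (2 * \<eta> + 1 / real (Suc n)) * norm y" for n
    proof -
      have "(\<Sum>t\<in>F. \<theta> (\<sigma> n) t * u (\<sigma> n) t y) = (\<Sum>t\<in>F. \<theta> (\<sigma> n) t * w (\<sigma> n) t y)"
        using u(4) y xVY(2) by (intro sum.cong) auto
      then have "\<bar>(\<Sum>t\<in>F. \<theta> (\<sigma> n) t * u (\<sigma> n) t y) - \<xi> y\<bar> \<le> (2 * \<eta> + 1 / real (Suc (\<sigma> n))) * norm y"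
        using sumw[OF span_base[OF y], of "\<sigma> n"] by simp
      also have "\<dots> \<le> (2 * \<eta> + 1 / real (Suc n)) * norm y" using small[of n] by (intro mult_right_mono) auto
      finally show ?thesis .
    qed
    then show "\<exists>N. \<forall>n\<ge>N. \<bar>(\<Sum>t\<in>F. \<theta> (\<sigma> n) t * u (\<sigma> n) t y) - \<xi> y\<bar> \<le> (2 * \<eta> + 1 / real (Suc n)) * norm y"
      by blast
  qed
  ultimately show ?thesis using suml lnonneg v(1) by (intro exI[of _ l] exI[of _ v]) blast
qed

subsection \<open>The weak* topology\<close>

lemma limitin_weak_starI:
  assumes "\<And>y. (\<lambda>n. blinfun_apply (f n) y) \<longlonglongrightarrow> blinfun_apply l y"
  shows "limitin weak_star f l sequentially"
proof -
  have lim: "limitin euclidean (\<lambda>n. blinfun_apply (f n)) (blinfun_apply l) sequentially"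
    unfolding euclidean_product_topology[symmetric] limitin_componentwise using assms by simp
  show ?thesis
    unfolding limitin_def
  proof (intro conjI allI impI)
    show "l \<in> topspace weak_star" by (simp add: strong_operator_topology_topspace)
    fix U assume "openin weak_star U \<and> l \<in> U"
    then obtain W where W: "open W" "U = blinfun_apply -` W" "l \<in> U"
      by (auto simp: strong_operator_topology_def openin_pullback_topology)
    then show "\<forall>\<^sub>F n in sequentially. f n \<in> U"
      using limitinD[OF lim, of W] by simp
  qed
qed

lemma limitin_weak_starD:
  assumes "limitin weak_star f l sequentially"
  shows "(\<lambda>n. blinfun_apply (f n) y) \<longlonglongrightarrow> blinfun_apply l y"
  using continuous_map_limit[OF strong_operator_topology_continuous_evaluation[of y] assms]
  by (simp add: o_def)

text \<open>A basic neighbourhood in the product topology restricts only finitely many coordinates,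
  and these coordinates are the test vectors.\<close>

lemma weak_star_closureI:
  fixes x :: "'a::real_normed_vector \<Rightarrow>\<^sub>L real"
  assumes "\<And>V \<delta>. finite V \<Longrightarrow> 0 < \<delta> \<Longrightarrow> \<exists>y\<in>S. \<forall>v\<in>V. \<bar>blinfun_apply y v - blinfun_apply x v\<bar> < \<delta>"
  shows "x \<in> weak_star closure_of S"
  unfolding in_closure_of
proof (intro conjI allI impI)
  show "x \<in> topspace weak_star" by (simp add: strong_operator_topology_topspace)
  fix U assume "x \<in> U \<and> openin weak_star U"
  then obtain W where W: "openin (product_topology (\<lambda>i. euclidean) UNIV) W" "U = blinfun_apply -` W" "blinfun_apply x \<in> W"
    by (auto simp: strong_operator_topology_def openin_pullback_topology euclidean_product_topology)
  from product_topology_open_contains_basis[OF W(1,3)]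
  obtain X where X: "\<And>i. blinfun_apply x i \<in> X i" "\<And>i. open (X i)" "finite {i. X i \<noteq> UNIV}" "Pi UNIV X \<subseteq> W"
    by (auto simp: PiE_UNIV_domain)
  define V where "V = {i. X i \<noteq> UNIV}"
  have "\<exists>d>0. \<forall>c. \<bar>c - blinfun_apply x v\<bar> < d \<longrightarrow> c \<in> X v" for v
    using X(1,2)[of v] unfolding open_dist by (auto simp: dist_real_def)
  then obtain d where d: "\<And>v. d v > 0" "\<And>v c. \<bar>c - blinfun_apply x v\<bar> < d v \<Longrightarrow> c \<in> X v" by metis
  define \<delta> where "\<delta> = Min (insert 1 (d ` V))"
  have V: "finite V" using X(3) by (simp add: V_def)
  have \<delta>: "\<delta> > 0" "\<And>v. v \<in> V \<Longrightarrow> \<delta> \<le> d v" using V d(1) by (auto simp: \<delta>_def)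
  obtain y where y: "y \<in> S" "\<And>v. v \<in> V \<Longrightarrow> \<bar>blinfun_apply y v - blinfun_apply x v\<bar> < \<delta>"
    using assms[OF V \<delta>(1)] by blast
  have "blinfun_apply y v \<in> X v" for v
  proof (cases "v \<in> V")
    case True then show ?thesis using d(2) y(2)[OF True] \<delta>(2)[OF True] by force
  qed (simp add: V_def)
  then have "blinfun_apply y \<in> W" using X(4) by blast
  then show "\<exists>y. y \<in> S \<and> y \<in> U" using y(1) W(2) by blast
qed

subsection \<open>Subdifferentials of extended-real-valued functions\<close>

lemma frechet_subdiff_increment:
  assumes "x' \<in> frechet_subdiff g x" "0 < \<epsilon>"
  shows "\<exists>\<delta>>0. \<forall>h. norm h < \<delta> \<longrightarrow>
    ereal (real_of_ereal (g x) + blinfun_apply x' h - \<epsilon> * norm h) \<le> g (x + h)"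
proof -
  have fin: "\<bar>g x\<bar> \<noteq> \<infinity>" using assms(1) by (simp add: frechet_subdiff_def)
  then obtain m where m: "g x = ereal m" by auto
  have "0 \<le> Liminf (at 0) (\<lambda>h. (g (x + h) - g x - ereal (blinfun_apply x' h)) / ereal (norm h))"
    using assms(1) by (simp add: frechet_subdiff_def)
  then have "\<forall>\<^sub>F h in at 0. ereal (- \<epsilon>) < (g (x + h) - g x - ereal (blinfun_apply x' h)) / ereal (norm h)"
    using assms(2) unfolding le_Liminf_iff by simp
  then obtain \<delta> where \<delta>: "\<delta> > 0" "\<And>h. h \<noteq> 0 \<Longrightarrow> norm h < \<delta> \<Longrightarrow>
      ereal (- \<epsilon>) < (g (x + h) - g x - ereal (blinfun_apply x' h)) / ereal (norm h)"
    unfolding eventually_at by auto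
  have "ereal (m + blinfun_apply x' h - \<epsilon> * norm h) \<le> g (x + h)" if h: "norm h < \<delta>" for h
  proof (cases "h = 0")
    case True then show ?thesis using m by (simp add: blinfun.zero_right)
  next
    case False
    then have n: "norm h > 0" by simp
    note lt = \<delta>(2)[OF False h]
    show ?thesis
    proof (cases "g (x + h)")
      case (real r)
      then have "- \<epsilon> < (r - m - blinfun_apply x' h) / norm h" using lt m n by simp
      then have "- \<epsilon> * norm h < r - m - blinfun_apply x' h" using n by (simp add: pos_less_divide_eq)
      then show ?thesis using real by simp
    next
      case MInf
      then show ?thesis using lt m n by simp
    qed simp
  qed
  then show ?thesis using \<delta>(1) m by auto
qed

lemma frechet_subdiffI:
  assumes eq: "\<And>y. y \<in> ball z \<rho> \<Longrightarrow> g y = ereal (\<phi> y)" and \<rho>: "0 < \<rho>"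
    and fr: "frechet_at \<phi> UNIV z (blinfun_apply u)"
  shows "u \<in> frechet_subdiff g z"
proof -
  have gz: "g z = ereal (\<phi> z)" using eq \<rho> by simp
  have "0 \<le> Liminf (at 0) (\<lambda>h. (g (z + h) - g z - ereal (blinfun_apply u h)) / ereal (norm h))"
    unfolding le_Liminf_iff
  proof (intro allI impI)
    fix b :: ereal assume "b < 0"
    then obtain r where r: "b < ereal r" "ereal r < 0" using ereal_dense2 by blast
    define \<epsilon> where "\<epsilon> = - r"
    have \<epsilon>: "\<epsilon> > 0" "b < ereal (- \<epsilon>)" using r by (auto simp: \<epsilon>_def)
    obtain \<delta> where \<delta>: "\<delta> > 0" "\<And>h. norm h < \<delta> \<Longrightarrow> blinfun_apply u h \<le> \<phi> (z + h) - \<phi> z + \<epsilon> * norm h"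
      using fr \<epsilon>(1) unfolding frechet_at_def by blast
    show "\<forall>\<^sub>F h in at 0. b < (g (z + h) - g z - ereal (blinfun_apply u h)) / ereal (norm h)"
      unfolding eventually_at
    proof (intro exI[of _ "min \<delta> \<rho>"] conjI ballI impI)
      fix h :: 'a assume "h \<noteq> 0 \<and> dist h 0 < min \<delta> \<rho>"
      then have h: "norm h > 0" "norm h < \<delta>" "norm h < \<rho>" by auto
      have "g (z + h) = ereal (\<phi> (z + h))" using eq[of "z + h"] h by (simp add: dist_norm)
      then have "(g (z + h) - g z - ereal (blinfun_apply u h)) / ereal (norm h)
          = ereal ((\<phi> (z + h) - \<phi> z - blinfun_apply u h) / norm h)" using gz h by simp
      moreover have "- \<epsilon> \<le> (\<phi> (z + h) - \<phi> z - blinfun_apply u h) / norm h"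
        using \<delta>(2)[OF h(2)] h(1) by (simp add: pos_le_divide_eq)
      ultimately show "b < (g (z + h) - g z - ereal (blinfun_apply u h)) / ereal (norm h)"
        using \<epsilon>(2) by (simp add: order_less_le_trans)
    qed (use \<delta> \<rho> in auto)
  qed
  then show ?thesis using gz by (simp add: frechet_subdiff_def)
qed

lemma bounded_linear_Blinfun:
  fixes u :: "'a::real_normed_vector \<Rightarrow> real"
  assumes "linear u" "\<And>y. \<bar>u y\<bar> \<le> c * norm y"
  shows "blinfun_apply (Blinfun u) = u"
  using assms
  by (intro bounded_linear_Blinfun_apply bounded_linear_intro[of u c])
     (auto simp: linear_add linear_scale mult.commute)

text \<open>Frechet subgradients depend only on values near the base point, so on the tail of the
  sequence inside the ball those of \<phi> are those of g. The Lipschitz bound makes the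
  approximating functionals continuous.\<close>

lemma limiting_subdiffI:
  fixes x :: "'a::real_normed_vector"
  assumes eq: "\<And>y. y \<in> ball x \<rho> \<Longrightarrow> g y = ereal (\<phi> y)" and \<rho>: "0 < \<rho>"
    and lip: "\<And>x y. \<bar>\<phi> x - \<phi> y\<bar> \<le> c * norm (x - y)"
    and u: "linear u" "\<And>y. \<bar>u y\<bar> \<le> c * norm y" and lim: "limiting_at \<phi> x u"
  shows "Blinfun u \<in> limiting_subdiff g x"
proof -
  obtain zs us where zs: "zs \<longlonglongrightarrow> x" and us: "\<And>n. linear (us n)" "\<And>n. frechet_at \<phi> UNIV (zs n) (us n)"
    and lim: "\<And>y. (\<lambda>n. us n y) \<longlonglongrightarrow> u y"
    using lim unfolding limiting_at_def by blast
  obtain N where N: "\<And>n. n \<ge> N \<Longrightarrow> dist (zs n) x < \<rho>"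
    using zs \<rho> unfolding LIMSEQ_def by blast
  have ball: "zs (n + N) \<in> ball x \<rho>" for n using N[of "n + N"] by (simp add: dist_commute)
  have usb: "\<bar>us n y\<bar> \<le> c * norm y" for n y
    by (rule frechet_at_bound[OF linear_form_on_linear[OF us(1)] subspace_UNIV lip us(2)]) simp
  have us_app: "blinfun_apply (Blinfun (us n)) = us n" for n
    by (rule bounded_linear_Blinfun[OF us(1) usb])
  have zsN: "(\<lambda>n. zs (n + N)) \<longlonglongrightarrow> x" by (rule LIMSEQ_ignore_initial_segment[OF zs])
  have gx: "g x = ereal (\<phi> x)" using eq \<rho> by simp
  have "(\<lambda>n. \<phi> (zs (n + N))) \<longlonglongrightarrow> \<phi> x"
  proof (rule metric_tendsto_imp_tendsto)
    have "(\<lambda>n. c * norm (zs (n + N) - x)) \<longlonglongrightarrow> c * norm (x - x)" by (intro tendsto_intros zsN)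
    then show "(\<lambda>n. c * norm (zs (n + N) - x)) \<longlonglongrightarrow> 0" by simp
    have "dist (\<phi> (zs (n + N))) (\<phi> x) \<le> dist (c * norm (zs (n + N) - x)) 0" for n
      using lip[of "zs (n + N)" x] by (simp add: dist_real_def)
    then show "\<forall>\<^sub>F n in sequentially. dist (\<phi> (zs (n + N))) (\<phi> x) \<le> dist (c * norm (zs (n + N) - x)) 0"
      by simp
  qed
  then have "(\<lambda>n. g (zs (n + N))) \<longlonglongrightarrow> g x" using eq[OF ball] gx by simp
  then have "tendsto_along g (\<lambda>n. zs (n + N)) x" using zsN by (simp add: tendsto_along_def)
  moreover have "Blinfun (us (n + N)) \<in> frechet_subdiff g (zs (n + N))" for n
  proof (rule frechet_subdiffI)
    show "0 < \<rho> - dist x (zs (n + N))" using ball[of n] by simp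
    show "g y = ereal (\<phi> y)" if "y \<in> ball (zs (n + N)) (\<rho> - dist x (zs (n + N)))" for y
      using that dist_triangle[of x y "zs (n + N)"] by (intro eq) simp
    show "frechet_at \<phi> UNIV (zs (n + N)) (blinfun_apply (Blinfun (us (n + N))))"
      unfolding us_app by (rule us(2))
  qed
  moreover have "limitin weak_star (\<lambda>n. Blinfun (us (n + N))) (Blinfun u) sequentially"
    by (rule limitin_weak_starI)
       (simp add: us_app bounded_linear_Blinfun[OF u] LIMSEQ_ignore_initial_segment[OF lim])
  ultimately show ?thesis using gx unfolding limiting_subdiff_def
    by (intro CollectI conjI exI[of _ "\<lambda>n. zs (n + N)"] exI[of _ "\<lambda>n. Blinfun (us (n + N))"]) auto
qed

text \<open>McShane's formula. It supplies the globally Lipschitz functions demanded by separable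
  reduction and by the multiplier rule.\<close>

lemma lipschitz_extension:
  fixes f :: "'a::real_normed_vector \<Rightarrow> real"
  assumes f: "c-lipschitz_on S f" and ne: "S \<noteq> {}"
  shows "\<exists>\<phi>. (\<forall>y\<in>S. \<phi> y = f y) \<and> (\<forall>x y. \<bar>\<phi> x - \<phi> y\<bar> \<le> c * norm (x - y))"
proof -
  have c: "0 \<le> c" by (rule lipschitz_on_nonneg[OF f])
  define \<phi> where "\<phi> y = (INF w\<in>S. f w + c * norm (y - w))" for y
  have lip: "f v \<le> f w + c * norm (v - w)" if "v \<in> S" "w \<in> S" for v w
    using lipschitz_onD[OF f that] by (simp add: dist_norm)
  have tri: "c * norm (y - w) \<le> c * norm (y - v) + c * norm (v - w)" for y v w :: 'a
    using norm_triangle_ineq[of "y - v" "v - w"] c by (simp add: distrib_left[symmetric] mult_left_mono)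
  obtain w0 where w0: "w0 \<in> S" using ne by blast
  have bdd: "bdd_below ((\<lambda>w. f w + c * norm (y - w)) ` S)" for y
  proof (rule bdd_belowI2)
    fix w assume "w \<in> S"
    then show "f w0 - c * norm (w0 - y) \<le> f w + c * norm (y - w)"
      using lip[OF w0, of w] tri[of w0 w y] by simp
  qed
  have le: "\<phi> y \<le> f w + c * norm (y - w)" if "w \<in> S" for y w
    unfolding \<phi>_def by (rule cINF_lower[OF bdd that])
  have "\<phi> y = f y" if y: "y \<in> S" for y
  proof (rule antisym)
    show "\<phi> y \<le> f y" using le[OF y, of y] by simp
    show "f y \<le> \<phi> y" unfolding \<phi>_def using lip[OF y] by (intro cINF_greatest ne)
  qed
  moreover have one: "\<phi> x \<le> \<phi> y + c * norm (x - y)" for x y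
  proof -
    have "\<phi> x - c * norm (x - y) \<le> f w + c * norm (y - w)" if "w \<in> S" for w
      using le[OF that, of x] tri[of x w y] by simp
    then have "\<phi> x - c * norm (x - y) \<le> \<phi> y" unfolding \<phi>_def[of y] by (intro cINF_greatest ne)
    then show ?thesis by simp
  qed
  have "\<bar>\<phi> x - \<phi> y\<bar> \<le> c * norm (x - y)" for x y
    using one[of x y] one[of y x] by (simp add: abs_le_iff norm_minus_commute)
  ultimately show ?thesis by blast
qed

lemma locally_lipschitz_on_finite: "locally_lipschitz_on U g \<Longrightarrow> y \<in> U \<Longrightarrow> \<bar>g y\<bar> \<noteq> \<infinity>"
  by (simp add: locally_lipschitz_on_def)

lemma common_lipschitz_extension:
  assumes U: "open U" "y \<in> U" and F: "finite F"
    and lip: "\<And>t. t \<in> F \<Longrightarrow> locally_lipschitz_on U (f t)"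
  shows "\<exists>\<phi> c \<rho>. 0 \<le> c \<and> 0 < \<rho> \<and> ball y \<rho> \<subseteq> U \<and> (\<forall>t\<in>F. (\<forall>v\<in>ball y \<rho>. f t v = ereal (\<phi> t v)) \<and>
      (\<forall>v w. \<bar>\<phi> t v - \<phi> t w\<bar> \<le> c * norm (v - w)))"
proof -
  obtain \<rho>0 where \<rho>0: "\<rho>0 > 0" "ball y \<rho>0 \<subseteq> U" using U open_contains_ball by blast
  have "\<exists>r L. 0 < r \<and> L-lipschitz_on (ball y r \<inter> U) (\<lambda>v. real_of_ereal (f t v))" if "t \<in> F" for t
    using lip[OF that] U(2) unfolding locally_lipschitz_on_def by blast
  then obtain r L where rL: "\<And>t. t \<in> F \<Longrightarrow> 0 < r t"
      "\<And>t. t \<in> F \<Longrightarrow> (L t)-lipschitz_on (ball y (r t) \<inter> U) (\<lambda>v. real_of_ereal (f t v))" by metis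
  define \<rho> where "\<rho> = Min (insert \<rho>0 (r ` F))"
  define c where "c = Max (insert 0 (L ` F))"
  have \<rho>: "\<rho> > 0" "\<rho> \<le> \<rho>0" "\<And>t. t \<in> F \<Longrightarrow> \<rho> \<le> r t" using F \<rho>0 rL(1) by (auto simp: \<rho>_def)
  have c: "0 \<le> c" "\<And>t. t \<in> F \<Longrightarrow> L t \<le> c" using F by (auto simp: c_def)
  have ballU: "ball y \<rho> \<subseteq> U" using \<rho>0(2) \<rho>(2) by (auto simp: subset_iff)
  have "c-lipschitz_on (ball y \<rho>) (\<lambda>v. real_of_ereal (f t v))" if t: "t \<in> F" for t
  proof (rule lipschitz_on_mono[OF rL(2)[OF t] _ c(2)[OF t]])
    show "ball y \<rho> \<subseteq> ball y (r t) \<inter> U" using ballU \<rho>(3)[OF t] by auto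
  qed
  then have "\<exists>\<phi>. (\<forall>v\<in>ball y \<rho>. \<phi> v = real_of_ereal (f t v)) \<and> (\<forall>v w. \<bar>\<phi> v - \<phi> w\<bar> \<le> c * norm (v - w))"
    if "t \<in> F" for t
    using that \<rho>(1) by (intro lipschitz_extension) auto
  then obtain \<phi> where \<phi>: "\<And>t v. t \<in> F \<Longrightarrow> v \<in> ball y \<rho> \<Longrightarrow> \<phi> t v = real_of_ereal (f t v)"
      "\<And>t v w. t \<in> F \<Longrightarrow> \<bar>\<phi> t v - \<phi> t w\<bar> \<le> c * norm (v - w)" by metis
  have "f t v = ereal (\<phi> t v)" if "t \<in> F" "v \<in> ball y \<rho>" for t v
  proof -
    have "v \<in> U" using that(2) ballU by blast
    then have "\<bar>f t v\<bar> \<noteq> \<infinity>" by (rule locally_lipschitz_on_finite[OF lip[OF that(1)]])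
    then show ?thesis using \<phi>(1)[OF that] by (simp add: ereal_real)
  qed
  then show ?thesis using c(1) \<rho>(1) ballU \<phi>(2) by blast
qed

lemma locally_lipschitz_on_continuous:
  assumes "locally_lipschitz_on U g" "open U"
  shows "continuous_on U (\<lambda>y. real_of_ereal (g y))"
  unfolding continuous_on_eq_continuous_at[OF assms(2)]
proof
  fix y assume y: "y \<in> U"
  then obtain r L where r: "0 < r" "L-lipschitz_on (ball y r \<inter> U) (\<lambda>y. real_of_ereal (g y))"
    using assms(1) unfolding locally_lipschitz_on_def by blast
  have "continuous_on (ball y r \<inter> U) (\<lambda>y. real_of_ereal (g y))" by (rule lipschitz_on_continuous_on[OF r(2)])
  then show "isCont (\<lambda>y. real_of_ereal (g y)) y"
    using y r(1) assms(2) by (simp add: continuous_on_eq_continuous_at open_Int)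
qed

lemma continuous_on_Max_finite:
  fixes \<phi> :: "'i \<Rightarrow> 'a::topological_space \<Rightarrow> real"
  assumes "finite F" "F \<noteq> {}" "\<And>t. t \<in> F \<Longrightarrow> continuous_on S (\<phi> t)"
  shows "continuous_on S (\<lambda>y. Max ((\<lambda>t. \<phi> t y) ` F))"
  using assms
proof (induction F rule: finite_ne_induct)
  case (insert t F)
  then have "continuous_on S (\<lambda>y. max (\<phi> t y) (Max ((\<lambda>t. \<phi> t y) ` F)))"
    by (intro continuous_on_max) auto
  then show ?case using insert.hyps by simp
qed simp

subsection \<open>Subgradients of the supremum\<close>

text \<open>On a compact piece of a finite-dimensional slice through \<open>z\<close>, lower semicontinuity reduces the
  supremum to a finite maximum up to \<open>\<kappa>\<close>; a minimiser of the tilted maximum over that piece is an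
  interior point at which the multiplier rule applies.\<close>

lemma frechet_subgradient_of_supremum:
  fixes f :: "'i \<Rightarrow> 'a::banach \<Rightarrow> ereal"
  assumes A: "asplund TYPE('a)" and U: "open U" "z \<in> U"
    and lip: "\<And>t. t \<in> T \<Longrightarrow> locally_lipschitz_on U (f t)"
    and x': "x' \<in> frechet_subdiff (sup_fun T f) z" and V: "finite V" and \<delta>: "0 < \<delta>"
  shows "\<exists>F y \<theta> u m. F \<subseteq> T \<and> finite F \<and> F \<noteq> {} \<and> dist z y < \<delta> \<and> (\<Sum>t\<in>F. \<theta> t) = 1 \<and>
    (\<forall>t\<in>F. 0 < \<theta> t \<and> u t \<in> limiting_subdiff (f t) y \<and> f t y = ereal m) \<and>
    \<bar>m - real_of_ereal (sup_fun T f z)\<bar> \<le> \<delta> \<and>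
    (\<forall>v\<in>V. \<bar>blinfun_apply (\<Sum>t\<in>F. \<theta> t *\<^sub>R u t) v - blinfun_apply x' v\<bar> < \<delta>)"
proof -
  define g where "g = sup_fun T f"
  define m0 where "m0 = real_of_ereal (g z)"
  have gz: "g z = ereal m0"
    using x' unfolding m0_def g_def frechet_subdiff_def by (simp add: ereal_real)
  define \<xi> where "\<xi> = blinfun_apply x'"
  have \<xi>: "linear \<xi>" unfolding \<xi>_def by (rule bounded_linear.linear[OF blinfun.bounded_linear_right])
  define K where "K = norm x'"
  have \<xi>K: "\<bar>\<xi> v\<bar> \<le> K * norm v" for v
    using norm_blinfun[of x' v] by (simp add: \<xi>_def K_def)
  have K: "0 \<le> K" by (simp add: K_def)
  define M where "M = 1 + (\<Sum>v\<in>V. norm v)"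
  have M: "M > 0" "\<And>v. v \<in> V \<Longrightarrow> norm v \<le> M"
    using member_le_sum[of _ V norm] V by (auto simp: M_def sum_nonneg add_pos_nonneg add_increasing)
  \<comment> \<open>The multiplier rule will leave an error of 4\<eta> norm v, at most \<delta>/2 on
    V.\<close>
  define \<eta> where "\<eta> = \<delta> / (8 * M)"
  have \<eta>: "\<eta> > 0" using \<delta> M by (simp add: \<eta>_def)
  obtain d where d: "d > 0" "\<And>h. norm h < d \<Longrightarrow> ereal (m0 + \<xi> h - \<eta> * norm h) \<le> g (z + h)"
    using frechet_subdiff_increment[OF x' \<eta>] by (auto simp: g_def m0_def \<xi>_def)
  obtain r0 where r0: "r0 > 0" "ball z r0 \<subseteq> U" using U open_contains_ball by blast
  \<comment> \<open>Small enough for the Frechet inequality, for staying in U and near z, and, by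
    the last term, for the value at the minimiser to be within \<delta> of
    \<open>m0\<close>.\<close>
  define r where "r = min (min (d / 2) (r0 / 2)) (min (\<delta> / 2) (\<delta> / (K + 2 * \<eta> + 1)))"
  have K1: "K + 2 * \<eta> + 1 > 0" using K \<eta> by simp
  have r: "r > 0" "r < d" "r < r0" "r < \<delta>" using d r0 \<delta> K1 by (auto simp: r_def)
  have "r * (K + 2 * \<eta> + 1) \<le> \<delta>"
  proof -
    have "r \<le> \<delta> / (K + 2 * \<eta> + 1)" by (simp add: r_def)
    then show ?thesis using K1 by (simp add: pos_le_divide_eq)
  qed
  then have rK: "K * r + 2 * \<eta> * r \<le> \<delta>" using r(1) by (simp add: algebra_simps)
  \<comment> \<open>Strictly less than \<eta> r, the surplus that the tilt provides on the sphere of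
    radius r.\<close>
  define \<kappa> where "\<kappa> = \<eta> * r / 2"
  have \<kappa>: "0 < \<kappa>" "\<kappa> < \<eta> * r" using \<eta> r by (auto simp: \<kappa>_def)
  define C where "C = (\<lambda>l. z + l) ` (span V \<inter> cball 0 r)"
  have "compact C" unfolding C_def
    by (intro compact_continuous_image compact_span_cball V continuous_intros)
  have zC: "z \<in> C" using r(1) span_zero by (auto simp: C_def intro!: image_eqI[of _ _ 0])
  have CU: "C \<subseteq> U" using r0(2) r(3) by (auto simp: C_def dist_norm subset_iff)
  define \<phi> where "\<phi> t y = real_of_ereal (f t y)" for t y
  have f\<phi>: "f t y = ereal (\<phi> t y)" if "t \<in> T" "y \<in> U" for t y
    using locally_lipschitz_on_finite[OF lip[OF that(1)] that(2)] by (simp add: \<phi>_def ereal_real)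
  have \<phi>cont: "continuous_on U (\<phi> t)" if "t \<in> T" for t
    unfolding \<phi>_def[abs_def] by (rule locally_lipschitz_on_continuous[OF lip[OF that] U(1)])
  have \<xi>cont: "continuous_on S (\<lambda>y. \<xi> (y - z))" for S
    unfolding \<xi>_def by (intro continuous_intros)
  define W where "W t = U \<inter> (\<lambda>y. \<phi> t y - \<xi> (y - z) + \<eta> * norm (y - z)) -` {m0 - \<kappa><..}" for t
  have Wopen: "open (W t)" if "t \<in> T" for t
    unfolding W_def by (intro continuous_open_preimage U(1) open_greaterThan continuous_intros \<phi>cont \<xi>cont that)
  have cover: "C \<subseteq> (\<Union>t\<in>T. W t)"
  proof
    fix y assume y: "y \<in> C"
    then have h: "norm (y - z) < d" using r(2) by (auto simp: C_def)
    have "ereal (m0 + \<xi> (y - z) - \<eta> * norm (y - z)) \<le> g y" using d(2)[OF h] by simp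
    then have "ereal (m0 + \<xi> (y - z) - \<eta> * norm (y - z) - \<kappa>) < g y"
      using \<kappa>(1) by (metis diff_less_eq ereal_less_eq(3) less_add_same_cancel1 less_ereal.simps(1) less_le_trans)
    then obtain t where t: "t \<in> T" "ereal (m0 + \<xi> (y - z) - \<eta> * norm (y - z) - \<kappa>) < f t y"
      unfolding g_def sup_fun_def by (auto simp: less_SUP_iff)
    moreover have "y \<in> U" using y CU by blast
    ultimately have "y \<in> W t" using f\<phi>[of t y] by (simp add: W_def)
    then show "y \<in> (\<Union>t\<in>T. W t)" using t(1) by blast
  qed
  obtain F where F: "F \<subseteq> T" "finite F" "C \<subseteq> (\<Union>t\<in>F. W t)"
    using compactE_image[OF \<open>compact C\<close> Wopen cover] by blast
  have Fne: "F \<noteq> {}" using F(3) zC by blast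
  define fm where "fm y = Max ((\<lambda>t. \<phi> t y) ` F)" for y
  have fm_ge: "\<phi> t y \<le> fm y" if "t \<in> F" for t y
    unfolding fm_def using that F(2) by (intro Max_ge) auto
  have fm_low: "m0 + \<xi> (y - z) - \<eta> * norm (y - z) - \<kappa> < fm y" if y: "y \<in> C" for y
  proof -
    obtain t where "t \<in> F" "y \<in> W t" using F(3) y by blast
    then show ?thesis using fm_ge[of t y] by (auto simp: W_def)
  qed
  have fm_z: "fm z \<le> m0"
  proof -
    have "\<phi> t z \<le> m0" if "t \<in> F" for t
    proof -
      have "f t z \<le> g z" unfolding g_def sup_fun_def using that F(1) by (intro SUP_upper) auto
      then show ?thesis using f\<phi>[of t z] that F(1) U(2) gz by auto
    qed
    then show ?thesis unfolding fm_def using F(2) Fne by simp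
  qed
  \<comment> \<open>The slope is 2\<eta>, against \<eta> in the Frechet inequality: on the sphere
    the value exceeds m0 - \<kappa> + \<eta> r > m0, while at z it is at most m0.\<close>
  define \<psi> where "\<psi> y = fm y - \<xi> (y - z) + 2 * \<eta> * norm (y - z)" for y
  have "continuous_on C fm"
    unfolding fm_def[abs_def]
    by (intro continuous_on_Max_finite F(2) Fne continuous_on_subset[OF \<phi>cont CU]) (use F(1) in auto)
  then have "continuous_on C \<psi>" unfolding \<psi>_def[abs_def] by (intro continuous_intros \<xi>cont)
  then obtain y where y: "y \<in> C" "\<And>w. w \<in> C \<Longrightarrow> \<psi> y \<le> \<psi> w"
    using continuous_attains_inf[OF \<open>compact C\<close>, of \<psi>] zC by blast
  define l0 where "l0 = y - z"
  have l0: "l0 \<in> span V" "norm l0 \<le> r" using y(1) by (auto simp: C_def l0_def)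
  have \<psi>z: "\<psi> y \<le> m0" using y(2)[OF zC] fm_z linear_0[OF \<xi>] by (simp add: \<psi>_def)
  have fml: "m0 + \<xi> l0 - \<eta> * norm l0 - \<kappa> < fm y" using fm_low[OF y(1)] by (simp add: l0_def)
  have fmu: "fm y - \<xi> l0 + 2 * \<eta> * norm l0 \<le> m0" using \<psi>z by (simp add: \<psi>_def l0_def)
  have l0r: "norm l0 < r"
  proof (rule ccontr)
    assume "\<not> ?thesis"
    then have "norm l0 = r" using l0(2) by simp
    then show False using fml fmu \<kappa>(2) by simp
  qed
  have Kl: "\<bar>\<xi> l0\<bar> \<le> K * r" using \<xi>K[of l0] mult_left_mono[OF l0(2) K] by simp
  have \<eta>l: "0 \<le> \<eta> * norm l0" "\<eta> * norm l0 \<le> \<eta> * r" using \<eta> l0(2) by auto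
  have m_close: "\<bar>fm y - m0\<bar> \<le> \<delta>"
    using fml fmu Kl \<eta>l \<kappa> rK by (simp add: abs_le_iff)
  have yU: "y \<in> U" using y(1) CU by blast
  obtain \<Phi> c \<rho> where c: "0 \<le> c" and \<rho>: "0 < \<rho>" "ball y \<rho> \<subseteq> U"
    and \<Phi>: "\<And>t v. t \<in> F \<Longrightarrow> v \<in> ball y \<rho> \<Longrightarrow> f t v = ereal (\<Phi> t v)"
    and \<Phi>lip: "\<And>t v w. t \<in> F \<Longrightarrow> \<bar>\<Phi> t v - \<Phi> t w\<bar> \<le> c * norm (v - w)"
    using common_lipschitz_extension[OF U(1) yU F(2), of f] lip F(1) by blast
  have \<Phi>m: "Max ((\<lambda>t. \<Phi> t v) ` F) = fm v" if v: "v \<in> ball y \<rho>" for v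
  proof -
    have "\<Phi> t v = \<phi> t v" if "t \<in> F" for t using \<Phi>[OF that v] by (simp add: \<phi>_def)
    then show ?thesis by (simp add: fm_def)
  qed
  define r1 where "r1 = min (\<rho> / 2) (r - norm l0)"
  have r1: "r1 > 0" using \<rho>(1) l0r by (simp add: r1_def)
  \<comment> \<open>Minimality of y gives the growth condition with slope 2\<eta>, since the norm
    grows by at most norm l.\<close>
  have growth: "Max ((\<lambda>t. \<Phi> t y) ` F) + \<xi> l - (2 * \<eta>) * norm l \<le> Max ((\<lambda>t. \<Phi> t (y + l)) ` F)"
    if l: "l \<in> span V" "norm l \<le> r1" for l
  proof -
    have "norm (l0 + l) \<le> r" using norm_triangle_ineq[of l0 l] l(2) by (simp add: r1_def)
    then have "y + l \<in> C"
      unfolding C_def by (intro image_eqI[of _ _ "l0 + l"]) (auto simp: l0_def span_add l0(1)[unfolded l0_def] l(1))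
    from y(2)[OF this] have "fm y - \<xi> l0 + 2 * \<eta> * norm l0 \<le> fm (y + l) - \<xi> (l0 + l) + 2 * \<eta> * norm (l0 + l)"
      by (simp add: \<psi>_def l0_def algebra_simps)
    moreover have "2 * \<eta> * norm (l0 + l) \<le> 2 * \<eta> * (norm l0 + norm l)"
      using \<eta> by (intro mult_left_mono norm_triangle_ineq) auto
    ultimately have "fm y + \<xi> l - (2 * \<eta>) * norm l \<le> fm (y + l)"
      by (simp add: linear_add[OF \<xi>] algebra_simps)
    moreover have "y + l \<in> ball y \<rho>" using l(2) \<rho>(1) by (simp add: r1_def dist_norm)
    ultimately show ?thesis using \<Phi>m[of "y + l"] \<Phi>m[of y] \<rho>(1) by simp
  qed
  have \<eta>2: "0 < 2 * \<eta>" using \<eta> by simp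
  obtain \<theta> u where \<theta>: "(\<Sum>t\<in>F. \<theta> t) = 1" and tu: "\<And>t. t \<in> F \<Longrightarrow> 0 \<le> \<theta> t \<and> linear (u t) \<and>
        (\<forall>y. \<bar>u t y\<bar> \<le> c * norm y) \<and> limiting_at (\<Phi> t) y (u t) \<and>
       (0 < \<theta> t \<longrightarrow> \<Phi> t y = Max ((\<lambda>t. \<Phi> t y) ` F))"
    and sum: "\<And>v. v \<in> V \<Longrightarrow> \<bar>(\<Sum>t\<in>F. \<theta> t * u t v) - \<xi> v\<bar> \<le> 2 * (2 * \<eta>) * norm v"
    using exact_multipliers[OF A V F(2) Fne c \<Phi>lip \<xi> \<xi>K \<eta>2 r1 growth] by blast
  \<comment> \<open>Zero weights are dropped, so all remaining functions attain the maximum at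
    y.\<close>
  define F' where "F' = {t \<in> F. 0 < \<theta> t}"
  have F': "F' \<subseteq> F" "finite F'" using F(2) by (auto simp: F'_def)
  have restr: "(\<Sum>t\<in>F. \<theta> t * b t) = (\<Sum>t\<in>F'. \<theta> t * b t)" for b :: "'i \<Rightarrow> real"
    using tu F(2) F' by (intro sum.mono_neutral_right) (auto simp: F'_def order_le_less)
  have \<theta>': "(\<Sum>t\<in>F'. \<theta> t) = 1" using restr[of "\<lambda>_. 1"] \<theta> by simp
  have F'ne: "F' \<noteq> {}" using \<theta>' by auto
  have app: "blinfun_apply (Blinfun (u t)) = u t" if "t \<in> F" for t
    using tu[OF that] by (intro bounded_linear_Blinfun[of "u t" c]) auto
  have "Blinfun (u t) \<in> limiting_subdiff (f t) y" if "t \<in> F" for t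
    using tu[OF that] by (intro limiting_subdiffI[OF \<Phi>[OF that] \<rho>(1) \<Phi>lip[OF that]]) auto
  moreover have "f t y = ereal (fm y)" if "t \<in> F'" for t
  proof -
    have "\<Phi> t y = Max ((\<lambda>t. \<Phi> t y) ` F)" using tu[of t] that by (auto simp: F'_def)
    then show ?thesis using \<Phi>m[of y] \<Phi>[of t y] that F'(1) \<rho>(1) by auto
  qed
  moreover have "\<bar>blinfun_apply (\<Sum>t\<in>F'. \<theta> t *\<^sub>R Blinfun (u t)) v - blinfun_apply x' v\<bar> < \<delta>" if v: "v \<in> V" for v
  proof -
    have "blinfun_apply (\<Sum>t\<in>F'. \<theta> t *\<^sub>R Blinfun (u t)) v = (\<Sum>t\<in>F'. \<theta> t * u t v)"
      unfolding blinfun.sum_left using app F'(1) by (intro sum.cong) (auto simp: blinfun.scaleR_left)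
    then have "\<bar>blinfun_apply (\<Sum>t\<in>F'. \<theta> t *\<^sub>R Blinfun (u t)) v - blinfun_apply x' v\<bar> \<le> 4 * \<eta> * norm v"
      using sum[OF v] restr[of "\<lambda>t. u t v"] by (simp add: \<xi>_def)
    also have "\<dots> \<le> 4 * \<eta> * M" using M(2)[OF v] \<eta> by (intro mult_left_mono) auto
    also have "\<dots> < \<delta>" using M(1) \<delta> by (simp add: \<eta>_def field_simps)
    finally show ?thesis .
  qed
  moreover have "dist z y < \<delta>" using l0r r(4) by (simp add: l0_def dist_norm norm_minus_commute)
  ultimately show ?thesis
    using F(1) F' F'ne \<theta>' m_close unfolding m0_def g_def
    by (intro exI[of _ F'] exI[of _ y] exI[of _ \<theta>] exI[of _ "\<lambda>t. Blinfun (u t)"] exI[of _ "fm y"])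
       (auto simp: F'_def)
qed

lemma max_fun_eq:
  assumes "finite F" "F \<noteq> {}" "\<And>t. t \<in> F \<Longrightarrow> f t y = a"
  shows "max_fun F f y = a"
proof -
  have "(\<lambda>s. f s y) ` F = {a}" using assms(2,3) by auto
  then show ?thesis by (simp add: max_fun_def)
qed

theorem theorem4p9:
  fixes T :: "'i set" and f :: "'i \<Rightarrow> 'a::banach \<Rightarrow> ereal" and x :: 'a
  assumes "asplund TYPE('a)"
    and "T \<noteq> {}"
    and "sup_fun T f x < \<infinity>"
    and "\<exists>U. open U \<and> x \<in> U \<and> (\<forall>t\<in>T. locally_lipschitz_on U (f t))"
  shows "limiting_subdiff (sup_fun T f) x
           \<subseteq> (\<Inter>e\<in>{0<..}. weak_star closure_of fuzzy_sums T f x e)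
       \<and> singular_subdiff (sup_fun T f) x
           \<subseteq> (\<Inter>e\<in>{0<..}. weak_star closure_of {a *\<^sub>R y | a y. a \<in> {0..e} \<and> y \<in> fuzzy_sums T f x e})
       \<and> (uniformly_locally_lipschitz_at T f x \<longrightarrow>
           limiting_subdiff (sup_fun T f) x
             \<subseteq> (\<Inter>e\<in>{0<..}. weak_star closure_of active_fuzzy_sums T f x e))"
proof -
  let ?g = "sup_fun T f"
  obtain U where U: "open U" "x \<in> U" "\<And>t. t \<in> T \<Longrightarrow> locally_lipschitz_on U (f t)" using assms(4) by blast
  define good where "good F y \<theta> u m e \<longleftrightarrow> F \<subseteq> T \<and> finite F \<and> F \<noteq> {} \<and> dist x y < e \<and> (\<Sum>t\<in>F. \<theta> t) = 1 \<and>
      (\<forall>t\<in>F. 0 < \<theta> t \<and> u t \<in> limiting_subdiff (f t) y \<and> f t y = ereal m) \<and>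
      \<bar>m - real_of_ereal (?g x)\<bar> \<le> e" for F y m e and \<theta> :: "'i \<Rightarrow> real" and u :: "'i \<Rightarrow> 'a \<Rightarrow>\<^sub>L real"
  \<comment> \<open>How large n must be depends only on e; test vectors and accuracy remain free
    afterwards.\<close>
  have near: "\<forall>\<^sub>F n in sequentially. \<forall>V \<delta>. finite V \<longrightarrow> 0 < \<delta> \<longrightarrow> (\<exists>F y \<theta> u m. good F y \<theta> u m e \<and>
      (\<forall>v\<in>V. \<bar>blinfun_apply (\<Sum>t\<in>F. \<theta> t *\<^sub>R u t) v - blinfun_apply (ys n) v\<bar> < \<delta>))"
    if xs: "tendsto_along ?g xs x" and ys: "\<And>n. ys n \<in> frechet_subdiff ?g (xs n)"
      and fin: "\<bar>?g x\<bar> \<noteq> \<infinity>" and e: "0 < e" for xs ys and e :: real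
  proof -
    have e2: "0 < e / 2" using e by simp
    have xs1: "xs \<longlonglongrightarrow> x" and g1: "(\<lambda>n. ?g (xs n)) \<longlonglongrightarrow> ?g x" using xs by (auto simp: tendsto_along_def)
    have g2: "(\<lambda>n. real_of_ereal (?g (xs n))) \<longlonglongrightarrow> real_of_ereal (?g x)"
      using g1 fin by (intro lim_real_of_ereal) (simp add: ereal_real)
    have "\<forall>\<^sub>F n in sequentially. xs n \<in> U" by (rule topological_tendstoD[OF xs1 U(1,2)])
    moreover have "\<forall>\<^sub>F n in sequentially. dist (xs n) x < e / 2" by (rule tendstoD[OF xs1 e2])
    moreover have "\<forall>\<^sub>F n in sequentially. dist (real_of_ereal (?g (xs n))) (real_of_ereal (?g x)) < e / 2"
      by (rule tendstoD[OF g2 e2])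
    ultimately show ?thesis
    proof eventually_elim
      case (elim n)
      show ?case
      proof (intro allI impI)
        fix V :: "'a set" and \<delta> :: real assume V: "finite V" and \<delta>: "0 < \<delta>"
        have \<delta>': "0 < min \<delta> (e / 2)" using \<delta> e by simp
        obtain F y \<theta> u m where *: "F \<subseteq> T" "finite F" "F \<noteq> {}" "dist (xs n) y < min \<delta> (e / 2)" "(\<Sum>t\<in>F. \<theta> t) = 1"
          "\<forall>t\<in>F. 0 < \<theta> t \<and> u t \<in> limiting_subdiff (f t) y \<and> f t y = ereal m"
          "\<bar>m - real_of_ereal (?g (xs n))\<bar> \<le> min \<delta> (e / 2)"
          "\<forall>v\<in>V. \<bar>blinfun_apply (\<Sum>t\<in>F. \<theta> t *\<^sub>R u t) v - blinfun_apply (ys n) v\<bar> < min \<delta> (e / 2)"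
          using frechet_subgradient_of_supremum[OF assms(1) U(1) elim(1) U(3) ys V \<delta>'] by blast
        have "dist x y < e"
          using dist_triangle[of x y "xs n"] *(4) elim(2) by (simp add: dist_commute)
        moreover have "\<bar>m - real_of_ereal (?g x)\<bar> \<le> e"
          using *(7) elim(3) unfolding dist_real_def by linarith
        ultimately have "good F y \<theta> u m e" using * unfolding good_def by blast
        moreover have "\<forall>v\<in>V. \<bar>blinfun_apply (\<Sum>t\<in>F. \<theta> t *\<^sub>R u t) v - blinfun_apply (ys n) v\<bar> < \<delta>"
          using *(8) by simp
        ultimately show "\<exists>F y \<theta> u m. good F y \<theta> u m e \<and>
            (\<forall>v\<in>V. \<bar>blinfun_apply (\<Sum>t\<in>F. \<theta> t *\<^sub>R u t) v - blinfun_apply (ys n) v\<bar> < \<delta>)" by blast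
      qed
    qed
  qed
  have weights: "\<theta> \<in> simplex_weights F" if "good F y \<theta> u m e" for F y \<theta> u m e
    using that by (auto simp: good_def simplex_weights_def less_imp_le)
  \<comment> \<open>All weights are positive, so \<open>circ_subdiff\<close> is the scaled limiting
    subdifferential; the common value m makes every member of F active.\<close>
  have fuzzy: "(\<Sum>t\<in>F. \<theta> t *\<^sub>R u t) \<in> fuzzy_sums T f x e"
    if G: "good F y \<theta> u m e" and fin: "\<bar>?g x\<bar> \<noteq> \<infinity>" for F y \<theta> u m e
  proof -
    have mx: "max_fun F f y = ereal m" using G by (intro max_fun_eq) (auto simp: good_def)
    obtain a where a: "?g x = ereal a" using fin by auto
    have "(\<Sum>t\<in>F. \<theta> t *\<^sub>R u t) \<in> minkowski_sum F (\<lambda>t. circ_subdiff (\<theta> t) (f t) y)"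
      using G by (auto simp: minkowski_sum_def circ_subdiff_def good_def intro!: exI[of _ "\<lambda>t. \<theta> t *\<^sub>R u t"])
    moreover have "\<bar>max_fun F f y - ?g x\<bar> \<le> ereal e" using G mx a by (simp add: good_def)
    ultimately show ?thesis
      unfolding fuzzy_sums_def using G weights[OF G] mx
      by (intro UnionI[of "minkowski_sum F (\<lambda>t. circ_subdiff (\<theta> t) (f t) y)"] CollectI
          exI[of _ F] exI[of _ y] exI[of _ \<theta>]) (auto simp: good_def weight_support_def)
  qed
  have approx: "\<exists>F y \<theta> u m. good F y \<theta> u m e \<and>
      (\<forall>v\<in>V. \<bar>blinfun_apply (\<Sum>t\<in>F. \<theta> t *\<^sub>R u t) v - blinfun_apply x' v\<bar> < \<delta>)"
    if x': "x' \<in> limiting_subdiff ?g x" and e: "0 < e" and V: "finite V" and \<delta>: "0 < \<delta>" for x' e V \<delta>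
  proof -
    obtain xs ys where *: "tendsto_along ?g xs x" "\<And>n. ys n \<in> frechet_subdiff ?g (xs n)"
        "limitin weak_star ys x' sequentially" "\<bar>?g x\<bar> \<noteq> \<infinity>"
      using x' by (auto simp: limiting_subdiff_def)
    have \<delta>2: "0 < \<delta> / 2" using \<delta> by simp
    have "\<forall>\<^sub>F n in sequentially. \<forall>v\<in>V. dist (blinfun_apply (ys n) v) (blinfun_apply x' v) < \<delta> / 2"
      using tendstoD[OF limitin_weak_starD[OF *(3)] \<delta>2] V by (simp add: eventually_ball_finite)
    with near[OF *(1,2,4) e] have "\<forall>\<^sub>F n in sequentially. \<exists>F y \<theta> u m. good F y \<theta> u m e \<and>
        (\<forall>v\<in>V. \<bar>blinfun_apply (\<Sum>t\<in>F. \<theta> t *\<^sub>R u t) v - blinfun_apply x' v\<bar> < \<delta>)"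
    proof eventually_elim
      case (elim n)
      obtain F y \<theta> u m where G: "good F y \<theta> u m e"
        "\<And>v. v \<in> V \<Longrightarrow> \<bar>blinfun_apply (\<Sum>t\<in>F. \<theta> t *\<^sub>R u t) v - blinfun_apply (ys n) v\<bar> < \<delta> / 2"
        using elim(1)[rule_format, OF V \<delta>2] by blast
      have "\<bar>blinfun_apply (\<Sum>t\<in>F. \<theta> t *\<^sub>R u t) v - blinfun_apply x' v\<bar> < \<delta>" if v: "v \<in> V" for v
      proof -
        have "\<bar>blinfun_apply (ys n) v - blinfun_apply x' v\<bar> < \<delta> / 2"
          using elim(2) v by (simp add: dist_real_def)
        then show ?thesis using G(2)[OF v] by linarith
      qed
      then show ?case using G(1) by blast
    qed
    then show ?thesis by (auto dest: eventually_happens)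
  qed
  have "x' \<in> weak_star closure_of fuzzy_sums T f x e"
    if x': "x' \<in> limiting_subdiff ?g x" and e: "0 < e" for x' e
  proof (rule weak_star_closureI)
    fix V :: "'a set" and \<delta> :: real assume V: "finite V" "0 < \<delta>"
    have fin: "\<bar>?g x\<bar> \<noteq> \<infinity>" using x' by (simp add: limiting_subdiff_def)
    show "\<exists>y\<in>fuzzy_sums T f x e. \<forall>v\<in>V. \<bar>blinfun_apply y v - blinfun_apply x' v\<bar> < \<delta>"
      using approx[OF x' e V] fuzzy[OF _ fin] by blast
  qed
  moreover have "x' \<in> weak_star closure_of {a *\<^sub>R y | a y. a \<in> {0..e} \<and> y \<in> fuzzy_sums T f x e}"
    if x': "x' \<in> singular_subdiff ?g x" and e: "0 < e" for x' e
  proof (rule weak_star_closureI)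
    fix V :: "'a set" and \<delta> :: real assume V: "finite V" and \<delta>: "0 < \<delta>"
    obtain xs ys l where *: "tendsto_along ?g xs x" "\<And>n. ys n \<in> frechet_subdiff ?g (xs n)"
        "\<And>n. 0 < l n" "l \<longlonglongrightarrow> 0"
        "limitin weak_star (\<lambda>n. l n *\<^sub>R ys n) x' sequentially" "\<bar>?g x\<bar> \<noteq> \<infinity>"
      using x' by (auto simp: singular_subdiff_def)
    have \<delta>2: "0 < \<delta> / 2" using \<delta> by simp
    have "\<forall>\<^sub>F n in sequentially. \<forall>v\<in>V. dist (blinfun_apply (l n *\<^sub>R ys n) v) (blinfun_apply x' v) < \<delta> / 2"
      using tendstoD[OF limitin_weak_starD[OF *(5)] \<delta>2] V by (simp add: eventually_ball_finite)
    \<comment> \<open>The bound 1 keeps the scaled approximation error at \<delta>/2, and the bound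
      e places the factor in the required interval.\<close>
    moreover have "\<forall>\<^sub>F n in sequentially. l n < min 1 e" using *(4) e by (intro order_tendstoD(2)) auto
    ultimately have "\<forall>\<^sub>F n in sequentially.
        \<exists>y\<in>{a *\<^sub>R y | a y. a \<in> {0..e} \<and> y \<in> fuzzy_sums T f x e}. \<forall>v\<in>V. \<bar>blinfun_apply y v - blinfun_apply x' v\<bar> < \<delta>"
      using near[OF *(1,2,6) e]
    proof eventually_elim
      case (elim n)
      obtain F y \<theta> u m where G: "good F y \<theta> u m e"
        "\<And>v. v \<in> V \<Longrightarrow> \<bar>blinfun_apply (\<Sum>t\<in>F. \<theta> t *\<^sub>R u t) v - blinfun_apply (ys n) v\<bar> < \<delta> / 2"
        using elim(3)[rule_format, OF V \<delta>2] by blast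
      define w where "w = (\<Sum>t\<in>F. \<theta> t *\<^sub>R u t)"
      have "\<bar>blinfun_apply (l n *\<^sub>R w) v - blinfun_apply x' v\<bar> < \<delta>" if v: "v \<in> V" for v
      proof -
        have "\<bar>l n * blinfun_apply (ys n) v - blinfun_apply x' v\<bar> < \<delta> / 2"
          using elim(1) v by (simp add: dist_real_def blinfun.scaleR_left)
        moreover have "\<bar>l n * blinfun_apply w v - l n * blinfun_apply (ys n) v\<bar> \<le> 1 * (\<delta> / 2)"
          using G(2)[OF v] *(3)[of n] elim(2) unfolding right_diff_distrib[symmetric] abs_mult w_def
          by (intro mult_mono) auto
        ultimately show ?thesis unfolding blinfun.scaleR_left real_scaleR_def by argo
      qed
      moreover have "w \<in> fuzzy_sums T f x e" unfolding w_def by (rule fuzzy[OF G(1) *(6)])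
      moreover have "l n \<in> {0..e}" using *(3)[of n] elim(2) by auto
      ultimately show ?case by blast
    qed
    then show "\<exists>y\<in>{a *\<^sub>R y | a y. a \<in> {0..e} \<and> y \<in> fuzzy_sums T f x e}.
        \<forall>v\<in>V. \<bar>blinfun_apply y v - blinfun_apply x' v\<bar> < \<delta>"
      by (auto dest: eventually_happens)
  qed
  moreover have "x' \<in> weak_star closure_of active_fuzzy_sums T f x e"
    if unif: "uniformly_locally_lipschitz_at T f x" and x': "x' \<in> limiting_subdiff ?g x" and e: "0 < e" for x' e
  proof (rule weak_star_closureI)
    fix V :: "'a set" and \<delta> :: real assume V: "finite V" "0 < \<delta>"
    obtain a where a: "?g x = ereal a" using x' by (auto simp: limiting_subdiff_def)
    obtain k e0 where k: "k > 0" "e0 > 0" "\<And>t y. t \<in> T \<Longrightarrow> y \<in> cball x e0 \<Longrightarrow> \<bar>f t y\<bar> \<noteq> \<infinity>"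
        "\<And>t. t \<in> T \<Longrightarrow> k-lipschitz_on (cball x e0) (\<lambda>y. real_of_ereal (f t y))"
      using unif unfolding uniformly_locally_lipschitz_at_def by metis
    \<comment> \<open>Near-activity at x costs e' for the value at y and k e' for moving from y to
      x; together they are at most e. A single Lipschitz constant for all of T makes this choice
      possible before F is known.\<close>
    define e' where "e' = min (min e e0) (e / (k + 1))"
    have e': "0 < e'" "e' \<le> e" "e' \<le> e0" "e' \<le> e / (k + 1)"
      using e k(1,2) by (auto simp: e'_def)
    then have e'k: "e' * (k + 1) \<le> e" using k(1) by (simp add: pos_le_divide_eq)
    obtain F y \<theta> u m where G: "good F y \<theta> u m e'"
      and close: "\<forall>v\<in>V. \<bar>blinfun_apply (\<Sum>t\<in>F. \<theta> t *\<^sub>R u t) v - blinfun_apply x' v\<bar> < \<delta>"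
      using approx[OF x' e'(1) V] by blast
    have mx: "max_fun F f y = ereal m" using G by (intro max_fun_eq) (auto simp: good_def)
    have "t \<in> eps_active T f x e" if t: "t \<in> F" for t
    proof -
      have tT: "t \<in> T" and ft: "f t y = ereal m" and d: "dist x y < e'" and ma: "\<bar>m - a\<bar> \<le> e'"
        using G t a by (auto simp: good_def)
      have "x \<in> cball x e0" "y \<in> cball x e0" using d e'(3) k(2) by auto
      obtain b where b: "f t x = ereal b" using k(3)[OF tT \<open>x \<in> cball x e0\<close>] by auto
      have "\<bar>b - m\<bar> \<le> k * dist x y"
        using lipschitz_onD[OF k(4)[OF tT] \<open>x \<in> cball x e0\<close> \<open>y \<in> cball x e0\<close>] b ft by (simp add: dist_real_def)
      also have "\<dots> \<le> k * e'" using d k(1) by simp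
      finally have "a \<le> b + e'  * (k + 1)" using ma by (simp add: algebra_simps)
      then have "a \<le> b + e" using e'k by simp
      then show ?thesis using tT a b by (simp add: eps_active_def)
    qed
    then have "F \<subseteq> eps_active T f x e" by blast
    moreover have "(\<Sum>t\<in>F. \<theta> t *\<^sub>R u t) \<in> minkowski_sum F (\<lambda>t. (\<lambda>y'. \<theta> t *\<^sub>R y') ` limiting_subdiff (f t) y)"
      using G by (auto simp: minkowski_sum_def good_def intro!: exI[of _ "\<lambda>t. \<theta> t *\<^sub>R u t"])
    moreover have "y \<in> cball x e" using G e'(2) by (simp add: good_def)
    ultimately have "(\<Sum>t\<in>F. \<theta> t *\<^sub>R u t) \<in> active_fuzzy_sums T f x e"
      unfolding active_fuzzy_sums_def using G weights[OF G] mx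
      by (intro UnionI[of "minkowski_sum F (\<lambda>t. (\<lambda>y'. \<theta> t *\<^sub>R y') ` limiting_subdiff (f t) y)"] CollectI
          exI[of _ F] exI[of _ y] exI[of _ \<theta>]) (auto simp: good_def)
    then show "\<exists>y\<in>active_fuzzy_sums T f x e. \<forall>v\<in>V. \<bar>blinfun_apply y v - blinfun_apply x' v\<bar> < \<delta>"
      using close by blast
  qed
  ultimately show ?thesis by blast
qed

end
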